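(* Let $d\ge2$ and let $S$ be a stationary Poisson process in $\mathbb{R}^d$ with intensity $\lambda>0$. For every initial configuration $\eta\in\mathcal{S}_{d-1}$ and time $t'\in\mathbb{R}$, the process $(\eta^{\eta,t'}_t: t\ge t')$ is Markov with generator defined by $$Lf(\eta)=\lambda\int_{\mathbb{R}^{d-1}}\bigl[f\bigl((\eta\setminus B(u))\cup\{u\}\bigr)-f(\eta)\bigr]\,du$$ for functions $f:\mathcal{S}_{d-1}\to\mathbb{R}$ depending on bounded regions. Furthermore, $(\eta_t)_{t\in\mathbb{R}}$ is a stationary version of the unique stationary process with generator $L$. In particular, for any given $t$ the marginal distribution of $\eta_t$ is the unique invariant measure for the generator $L$.
   Context: $\mathcal{S}_{d-1}$ is the set of locally finite configurations (subsets) of $\mathbb{R}^{d-1}$. A function $f$ on $\mathcal{S}_{d-1}$ depends on bounded regions if there is a bounded $\Lambda\subset\mathbb{R}^{d-1}$ with $f(\eta)=f(\eta\cap\Lambda)$ for all $\eta$. For $x\in\mathbb{R}^{d-1}$, $B(x)=\{x'\in\mathbb{R}^{d-1}:|x'-x|\le1\}$. For $s\in\mathbb{R}^d$ write $s=(x(s),r(s))$ with $x(s)\in\mathbb{R}^{d-1}$ the first $d-1$ coordinates and $r(s)=s_d$. For $(x,r)\in\mathbb{R}^{d-1}\times\mathbb{R}$ let $\tau((x,r),S)=\inf\{t>r:\ \exists (x',t)\in S\text{ with }|x-x'|\le1\}$ and let $\alpha(x,r)$ be the (a.s. unique) point $(x',r')\in S$ with $r'=\tau((x,r),S)$ and $|x-x'|\le1$.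 Put $\alpha^0(s)=s$, $\alpha^n(s)=\alpha(\alpha^{n-1}(s))$, $\tau^n(s)=r(\alpha^n(s))$, and $$X^{(x,r)}_t=x(\alpha^n(x,r))\quad\text{for } t\in[\tau^n(x,r),\tau^{n+1}(x,r)),\ n\ge0 .$$ Define $$\eta_t=\{X^{(x,r)}_t:(x,r)\in S,\ r\le t\},\qquad t\in\mathbb{R},$$ and, for $\eta\in\mathcal{S}_{d-1}$ and $t\ge t'$, $$\eta^{\eta,t'}_t=\{X^{(x,r)}_t:\ (x,r)\in S \text{ with } t'\le r\le t,\ \text{ or } x\in\eta \text{ and } r=t'\}.$$ *)

theory Defs
  imports "HOL-Probability.Probability"
begin

text \<open>Configurations, with the sigma-algebra generated by the counts in bounded Borel sets.\<close>

definition configs :: "'a::euclidean_space set set" where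
  "configs = {\<eta>. \<forall>B. bounded B \<longrightarrow> finite (\<eta> \<inter> B)}"

definition config_space :: "'a::euclidean_space set measure" where
  "config_space = sigma configs
     {{\<eta> \<in> configs. card (\<eta> \<inter> B) = k} | B k. B \<in> sets borel \<and> bounded B}"

definition poisson_process ::
  "'w measure \<Rightarrow> real \<Rightarrow> ('w \<Rightarrow> 'a::euclidean_space set) \<Rightarrow> bool" where
  "poisson_process M lam S \<longleftrightarrow>
     S \<in> M \<rightarrow>\<^sub>M config_space \<and>
     (\<forall>A k. A \<in> sets borel \<and> bounded A \<longrightarrow>
        measure M {\<omega> \<in> space M. card (S \<omega> \<inter> A) = k} =
          exp (- (lam * measure lborel A)) * (lam * measure lborel A) ^ k / fact k) \<and>
     (\<forall>(A :: nat \<Rightarrow> 'a set) I.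
        finite I \<and> (\<forall>i\<in>I. A i \<in> sets borel \<and> bounded (A i)) \<and> disjoint_family_on A I \<longrightarrow>
        prob_space.indep_vars M (\<lambda>_. count_space UNIV) (\<lambda>i \<omega>. card (S \<omega> \<inter> A i)) I)"

text \<open>
  A point s of the d-dimensional space is a pair: fst s collects its first d - 1
  coordinates and snd s is the last one, the time. For a Poisson process the three
  descriptions below are almost surely proper (the infimum is over a nonempty set, the point
  is unique, the index exists for the particles considered); on the exceptional null event
  their values are arbitrary.
\<close>

definition tau :: "('a::euclidean_space \<times> real) set \<Rightarrow> 'a \<times> real \<Rightarrow> real" where
  "tau S s = Inf {t. t > snd s \<and> (\<exists>x'. (x', t) \<in> S \<and> norm (fst s - x') \<le> 1)}"

definition alpha :: "('a::euclidean_space \<times> real) set \<Rightarrow> 'a \<times> real \<Rightarrow> 'a \<times> real" where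
  "alpha S s = (THE p. p \<in> S \<and> snd p = tau S s \<and> norm (fst s - fst p) \<le> 1)"

definition tau_iter :: "('a::euclidean_space \<times> real) set \<Rightarrow> nat \<Rightarrow> 'a \<times> real \<Rightarrow> real" where
  "tau_iter S n s = snd ((alpha S ^^ n) s)"

definition position :: "('a::euclidean_space \<times> real) set \<Rightarrow> 'a \<times> real \<Rightarrow> real \<Rightarrow> 'a" where
  "position S s t =
     fst ((alpha S ^^ (THE n. tau_iter S n s \<le> t \<and> t < tau_iter S (Suc n) s)) s)"

definition eta :: "('a::euclidean_space \<times> real) set \<Rightarrow> real \<Rightarrow> 'a set" where
  "eta S t = {position S (x, r) t | x r. (x, r) \<in> S \<and> r \<le> t}"

definition eta_from ::
  "('a::euclidean_space \<times> real) set \<Rightarrow> 'a set \<Rightarrow> real \<Rightarrow> real \<Rightarrow> 'a set" where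
  "eta_from S \<eta> t' t =
     {position S (x, r) t | x r. ((x, r) \<in> S \<and> t' \<le> r \<and> r \<le> t) \<or> (x \<in> \<eta> \<and> r = t')}"

text \<open>
  Boundedness and measurability of the test functions are what makes the expectations and the
  integral below meaningful.
\<close>

definition local_functions :: "('a::euclidean_space set \<Rightarrow> real) set" where
  "local_functions =
     {f \<in> borel_measurable config_space. bounded (f ` configs) \<and>
        (\<exists>\<Lambda>. bounded \<Lambda> \<and> (\<forall>\<eta>\<in>configs. f \<eta> = f (\<eta> \<inter> \<Lambda>)))}"

definition gen :: "real \<Rightarrow> ('a::euclidean_space set \<Rightarrow> real) \<Rightarrow> 'a set \<Rightarrow> real" where
  "gen lam f \<eta> = lam * (LINT u|lborel. (f ((\<eta> - cball u 1) \<union> {u}) - f \<eta>))"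

definition transition_semigroup :: "'b measure \<Rightarrow> (real \<Rightarrow> 'b \<Rightarrow> 'b measure) \<Rightarrow> bool" where
  "transition_semigroup E P \<longleftrightarrow>
     (\<forall>t\<ge>0. P t \<in> E \<rightarrow>\<^sub>M prob_algebra E) \<and>
     (\<forall>x\<in>space E. P 0 x = return E x) \<and>
     (\<forall>s\<ge>0. \<forall>t\<ge>0. \<forall>x\<in>space E. P (s + t) x = P s x \<bind> P t)"

text \<open>Right derivative at time 0 in the supremum norm, on the bounded local functions.\<close>

definition has_generator ::
  "(real \<Rightarrow> 'a::euclidean_space set \<Rightarrow> 'a set measure) \<Rightarrow>
   (('a set \<Rightarrow> real) \<Rightarrow> 'a set \<Rightarrow> real) \<Rightarrow> bool" where
  "has_generator P L \<longleftrightarrow>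
     (\<forall>f\<in>local_functions.
        uniform_limit configs (\<lambda>h \<eta>. ((LINT \<zeta>|P h \<eta>. f \<zeta>) - f \<eta>) / h) (L f) (at_right 0))"

definition past ::
  "'w measure \<Rightarrow> real set \<Rightarrow> 'b measure \<Rightarrow> (real \<Rightarrow> 'w \<Rightarrow> 'b) \<Rightarrow> real \<Rightarrow> 'w measure" where
  "past M T E Y s =
     sigma (space M) {Y u -` A \<inter> space M | u A. u \<in> T \<and> u \<le> s \<and> A \<in> sets E}"

definition markov_process ::
  "'w measure \<Rightarrow> real set \<Rightarrow> 'b measure \<Rightarrow> (real \<Rightarrow> 'b \<Rightarrow> 'b measure) \<Rightarrow>
   (real \<Rightarrow> 'w \<Rightarrow> 'b) \<Rightarrow> bool" where
  "markov_process M T E P Y \<longleftrightarrow>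
     (\<forall>t\<in>T. Y t \<in> M \<rightarrow>\<^sub>M E) \<and>
     (\<forall>s\<in>T. \<forall>t\<in>T. s \<le> t \<longrightarrow> (\<forall>A\<in>sets E.
        AE \<omega> in M. real_cond_exp M (past M T E Y s) (indicator {\<omega> \<in> space M. Y t \<omega> \<in> A}) \<omega>
                    = measure (P (t - s) (Y s \<omega>)) A))"

definition markov_with_generator ::
  "'w measure \<Rightarrow> real set \<Rightarrow> (('a::euclidean_space set \<Rightarrow> real) \<Rightarrow> 'a set \<Rightarrow> real) \<Rightarrow>
   (real \<Rightarrow> 'w \<Rightarrow> 'a set) \<Rightarrow> bool" where
  "markov_with_generator M T L Y \<longleftrightarrow>
     (\<exists>P. transition_semigroup config_space P \<and> has_generator P L \<and>
          markov_process M T config_space P Y)"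

definition process_law ::
  "'w measure \<Rightarrow> (real \<Rightarrow> 'w \<Rightarrow> 'a::euclidean_space set) \<Rightarrow> (real \<Rightarrow> 'a set) measure" where
  "process_law M Y = distr M (PiM UNIV (\<lambda>_. config_space)) (\<lambda>\<omega> t. Y t \<omega>)"

definition stationary ::
  "'w measure \<Rightarrow> (real \<Rightarrow> 'w \<Rightarrow> 'a::euclidean_space set) \<Rightarrow> bool" where
  "stationary M Y \<longleftrightarrow> (\<forall>h. process_law M (\<lambda>t. Y (t + h)) = process_law M Y)"

definition invariant_measure ::
  "(('a::euclidean_space set \<Rightarrow> real) \<Rightarrow> 'a set \<Rightarrow> real) \<Rightarrow> 'a set measure \<Rightarrow> bool" where
  "invariant_measure L \<mu> \<longleftrightarrow>
     \<mu> \<in> space (prob_algebra config_space) \<and>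
     (\<exists>P. transition_semigroup config_space P \<and> has_generator P L \<and>
          (\<forall>t\<ge>0. \<mu> \<bind> P t = \<mu>))"

end

theory Submission
  imports Defs "HOL-Library.Transitive_Closure_Table"
begin

text \<open>
  A point \<open>(u, s)\<close> of \<open>S\<close> deletes at time \<open>s\<close> every particle within distance 1 of \<open>u\<close> and
  leaves one particle at \<open>u\<close>. Forgetting which particle has jumped to \<open>u\<close>, the configuration at
  time \<open>t\<close> has a description without any path: \<open>x\<close> is occupied if and only if some
  \<open>(x, s)\<close> in \<open>S\<close> with \<open>s \<le> t\<close> (or an initial particle) is followed by no point of \<open>S\<close> in
  \<open>cball x 1\<close> up to time \<open>t\<close>. This is the flow map \<open>flow S r t\<close>, and \<open>alive S t\<close> when the start is at
  time minus infinity. These maps are defined for every locally finite \<open>S\<close>, they satisfy the flow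
  equation exactly, and what they leave in a window of radius \<open>R\<close> depends only on the initial
  particles in the window and on the points of \<open>S\<close> over the window of radius \<open>R + 1\<close>.

  Markov property. A Poisson process has independent restrictions to disjoint regions
  (\<open>indep_restrict\<close>), so the flow over \<open>(s, t]\<close> is independent of everything up to time \<open>s\<close>; with
  the flow equation this gives the Markov property for the kernels \<open>kernel s t\<close>, the laws of the
  flow maps.

  Generator. During a short time \<open>h\<close> the enlarged window receives no point, or one point, which is
  uniformly distributed, or at least two points, with probability of order \<open>h\<^sup>2\<close>. This gives the
  expansion \<open>kernel_generator\<close> with an error of order \<open>h\<^sup>2\<close>, uniformly in the configuration and in
  time.

  Uniqueness of the semigroup. On the functions of a fixed window the generator is a bounded
  operator that does not leave this class. Taylor's formula therefore gives the expectation of such a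
  function as the exponential series of the generator, for every evolution with this generator
  (\<open>local_evolution_unique\<close>). It follows that \<open>kernel s t\<close> depends on \<open>t - s\<close> only and
  that any transition semigroup with the same generator coincides with it.

  Invariant law. As soon as every small ball of a finite cover of the window has been hit, the flow
  has forgotten its initial configuration inside the window. Hence \<open>semigroup n \<eta>\<close> converges on local
  events to a limit that does not depend on \<open>\<eta>\<close>; the limit is the law of \<open>alive S t\<close> and the only
  invariant law. A Markov process indexed by the real line is determined in law by its kernels and
  its marginals (\<open>markov_process_law_unique\<close>), which gives both the stationarity of \<open>alive S t\<close> and
  the uniqueness of the stationary process.

  Paths. It remains to identify \<open>eta\<close> and \<open>eta_from\<close>, which are defined by iterated jumps, with the
  flow. This holds whenever the points of \<open>S\<close> have distinct times (different from the initial
  time, in the case of \<open>eta_from\<close>), every ball is hit again and again, and no particle makes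
  infinitely many jumps in a bounded time. The last property is the only one that needs an idea: in
  a thin time slab the occupied unit cells do not percolate (\<open>AE_not_explosive\<close>).
\<close>

section \<open>Measurability on the configuration space\<close>

lemma configs_subset: "\<eta> \<in> configs \<Longrightarrow> \<zeta> \<subseteq> \<eta> \<Longrightarrow> \<zeta> \<in> configs"
  unfolding configs_def using finite_subset[OF Int_mono[OF _ order_refl]] by blast

lemma finite_configs_Int: "\<eta> \<in> configs \<Longrightarrow> bounded B \<Longrightarrow> finite (\<eta> \<inter> B)"
  unfolding configs_def by auto

lemma empty_in_configs [simp]: "{} \<in> configs"
  unfolding configs_def by auto

lemma configs_Int: "\<eta> \<in> configs \<Longrightarrow> \<eta> \<inter> U \<in> configs"
  by (rule configs_subset) auto

lemma space_config_space [simp]: "space config_space = configs"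
  unfolding config_space_def by (rule space_measure_of) auto

lemma sets_config_space_gen:
  "sets config_space = sigma_sets configs
     {{\<eta> \<in> configs. card (\<eta> \<inter> B) = k} | B k. B \<in> sets borel \<and> bounded B}"
  unfolding config_space_def by (rule sets_measure_of) auto

lemma measurable_card_Int:
  assumes "B \<in> sets borel" "bounded B"
  shows "(\<lambda>\<eta>. card (\<eta> \<inter> B)) \<in> config_space \<rightarrow>\<^sub>M count_space UNIV"
proof (rule measurable_count_space_eq2_countable[THEN iffD2])
  show "(\<lambda>\<eta>. card (\<eta> \<inter> B)) \<in> space config_space \<rightarrow> UNIV \<and>
    (\<forall>k\<in>UNIV. (\<lambda>\<eta>. card (\<eta> \<inter> B)) -` {k} \<inter> space config_space \<in> sets config_space)"
  proof (intro conjI ballI)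
    fix k :: nat
    have "{\<eta> \<in> configs. card (\<eta> \<inter> B) = k} \<in> sets config_space"
      unfolding sets_config_space_gen using assms by (intro sigma_sets.Basic) blast
    moreover have "(\<lambda>\<eta>. card (\<eta> \<inter> B)) -` {k} \<inter> space config_space = {\<eta> \<in> configs. card (\<eta> \<inter> B) = k}"
      by auto
    ultimately show "(\<lambda>\<eta>. card (\<eta> \<inter> B)) -` {k} \<inter> space config_space \<in> sets config_space"
      by (simp only:)
  qed auto
qed

lemma measurable_configI:
  fixes f :: "'w \<Rightarrow> 'a::euclidean_space set"
  assumes "\<And>x. x \<in> space G \<Longrightarrow> f x \<in> configs"
    and "\<And>B. B \<in> sets borel \<Longrightarrow> bounded B \<Longrightarrow> (\<lambda>x. card (f x \<inter> B)) \<in> G \<rightarrow>\<^sub>M count_space UNIV"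
  shows "f \<in> G \<rightarrow>\<^sub>M config_space"
  unfolding config_space_def
proof (rule measurable_measure_of)
  fix y :: "'a set set" assume "y \<in> {{\<eta> \<in> configs. card (\<eta> \<inter> B) = k} |B k. B \<in> sets borel \<and> bounded B}"
  then obtain B k where y: "y = {\<eta> \<in> configs. card (\<eta> \<inter> B) = k}" and B: "B \<in> sets borel" "bounded B"
    by auto
  have "f -` y \<inter> space G = {x \<in> space G. card (f x \<inter> B) = k}"
    using assms(1) y by auto
  then show "f -` y \<inter> space G \<in> sets G"
    using assms(2)[OF B] by simp
qed (use assms in auto)

lemma measurable_ennreal_nat_count:
  fixes f :: "'p \<Rightarrow> nat"
  assumes "(\<lambda>x. of_nat (f x) :: ennreal) \<in> borel_measurable G"
  shows "f \<in> G \<rightarrow>\<^sub>M count_space UNIV"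
proof (rule measurable_count_space_eq2_countable[THEN iffD2])
  show "f \<in> space G \<rightarrow> UNIV \<and> (\<forall>k\<in>UNIV. f -` {k} \<inter> space G \<in> sets G)"
  proof (intro conjI ballI)
    fix k
    have "f -` {k} \<inter> space G = {x \<in> space G. (of_nat (f x) :: ennreal) = of_nat k}" by auto
    then show "f -` {k} \<inter> space G \<in> sets G"
      by (simp only:) (intro borel_measurable_eq assms borel_measurable_const)
  qed auto
qed

text \<open>
  Every measurability proof about configurations reduces to this one: it allows the counted set to
  depend measurably on a parameter, in particular on another configuration. The sets \<open>A\<close> for which
  it holds form a Dynkin system that contains the rectangles; finiteness of \<open>\<eta> \<inter> B\<close> is what
  makes complements work.
\<close>

lemma measurable_card_section:
  fixes A :: "('p \<times> 'a::euclidean_space) set"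
  assumes A: "A \<in> sets (F \<Otimes>\<^sub>M borel)" and B: "B \<in> sets borel" "bounded B"
  shows "(\<lambda>(p, \<eta>). card {x \<in> \<eta> \<inter> B. (p, x) \<in> A}) \<in> F \<Otimes>\<^sub>M config_space \<rightarrow>\<^sub>M count_space UNIV"
proof -
  let ?c = "\<lambda>A (p, \<eta>). emeasure (count_space UNIV) {x \<in> \<eta> \<inter> B. (p, x) \<in> A}"
  let ?G = "F \<Otimes>\<^sub>M (config_space :: 'a set measure)"
  have fin: "finite {x \<in> \<eta> \<inter> B. Q x}" if "\<eta> \<in> configs" for \<eta> :: "'a set" and Q
    by (rule finite_subset[OF _ finite_configs_Int[OF that B(2)]]) auto
  have "?c A \<in> borel_measurable ?G"
    using Int_stable_pair_measure_generator pair_measure_closed A[unfolded sets_pair_measure]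
  proof (induction A rule: sigma_sets_induct_disjoint)
    case (basic A)
    then obtain a b where A: "A = a \<times> b" "a \<in> sets F" "b \<in> sets borel" by auto
    have bB: "b \<inter> B \<in> sets borel" "bounded (b \<inter> B)"
      using A B by (auto intro: bounded_subset)
    note [measurable] = measurable_card_Int[OF bB] A(2)
    have "(\<lambda>w. if fst w \<in> a then of_nat (card (snd w \<inter> (b \<inter> B))) else 0 :: ennreal) \<in> borel_measurable ?G"
      by measurable
    then show ?case
    proof (rule measurable_cong[THEN iffD1, rotated])
      fix w assume "w \<in> space ?G"
      then have *: "snd w \<in> configs" by (auto simp: space_pair_measure)
      have "{x \<in> snd w \<inter> B. (fst w, x) \<in> A} = (if fst w \<in> a then snd w \<inter> (b \<inter> B) else {})"
        using A by auto
      then show "(if fst w \<in> a then of_nat (card (snd w \<inter> (b \<inter> B))) else 0) = ?c A w"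
        using finite_configs_Int[OF * bB(2)] by (simp add: split_beta)
    qed
  next
    case empty
    then show ?case by simp
  next
    case (compl A)
    note [measurable] = compl(2) measurable_card_Int[OF B]
    have "(\<lambda>w. of_nat (card (snd w \<inter> B)) - ?c A w :: ennreal) \<in> borel_measurable ?G"
      by measurable
    then show ?case
    proof (rule measurable_cong[THEN iffD1, rotated])
      fix w assume w: "w \<in> space ?G"
      then have *: "snd w \<in> configs" "fst w \<in> space F" by (auto simp: space_pair_measure)
      have "{x \<in> snd w \<inter> B. (fst w, x) \<in> space F \<times> space borel - A} = (snd w \<inter> B) - {x \<in> snd w \<inter> B. (fst w, x) \<in> A}"
        using * by auto
      moreover have "emeasure (count_space UNIV) ((snd w \<inter> B) - {x \<in> snd w \<inter> B. (fst w, x) \<in> A})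
        = emeasure (count_space UNIV) (snd w \<inter> B) - emeasure (count_space UNIV) {x \<in> snd w \<inter> B. (fst w, x) \<in> A}"
        using fin[OF *(1)] by (intro emeasure_Diff) auto
      ultimately show "of_nat (card (snd w \<inter> B)) - ?c A w = ?c (space F \<times> space borel - A) w"
        using finite_configs_Int[OF *(1) B(2)] by (simp add: split_beta)
    qed
  next
    case (union A)
    note [measurable] = union(3)
    have "(\<lambda>w. \<Sum>i. ?c (A i) w) \<in> borel_measurable ?G"
      by measurable
    then show ?case
    proof (rule measurable_cong[THEN iffD1, rotated])
      fix w assume w: "w \<in> space ?G"
      have "(\<Sum>i. emeasure (count_space UNIV) {x \<in> snd w \<inter> B. (fst w, x) \<in> A i})
        = emeasure (count_space UNIV) (\<Union>i. {x \<in> snd w \<inter> B. (fst w, x) \<in> A i})"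
        using union(1) by (intro suminf_emeasure) (auto simp: disjoint_family_on_def)
      also have "(\<Union>i. {x \<in> snd w \<inter> B. (fst w, x) \<in> A i}) = {x \<in> snd w \<inter> B. (fst w, x) \<in> (\<Union>i. A i)}"
        by auto
      finally show "(\<Sum>i. ?c (A i) w) = ?c (\<Union>i. A i) w"
        by (simp add: split_beta)
    qed
  qed
  then have "(\<lambda>w. of_nat (case w of (p, \<eta>) \<Rightarrow> card {x \<in> \<eta> \<inter> B. (p, x) \<in> A}) :: ennreal) \<in> borel_measurable ?G"
  proof (rule measurable_cong[THEN iffD1, rotated])
    fix w assume "w \<in> space ?G"
    then show "?c A w = of_nat (case w of (p, \<eta>) \<Rightarrow> card {x \<in> \<eta> \<inter> B. (p, x) \<in> A})"
      by (cases w) (simp add: space_pair_measure fin[unfolded Int_iff conj_assoc])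
  qed
  then show ?thesis by (rule measurable_ennreal_nat_count)
qed

lemma measurable_card_Collect:
  fixes X :: "'w \<Rightarrow> 'a::euclidean_space set"
  assumes X: "X \<in> G \<rightarrow>\<^sub>M config_space"
    and Q: "Measurable.pred (G \<Otimes>\<^sub>M borel) (\<lambda>(w, x). Q w x)"
    and B: "B \<in> sets borel" "bounded B"
  shows "(\<lambda>w. card {x \<in> X w \<inter> B. Q w x}) \<in> G \<rightarrow>\<^sub>M count_space UNIV"
proof -
  have "{wx \<in> space (G \<Otimes>\<^sub>M borel). case wx of (w, x) \<Rightarrow> Q w x} \<in> sets (G \<Otimes>\<^sub>M borel)"
    using Q by measurable
  from measurable_compose[OF measurable_Pair[OF measurable_ident X] measurable_card_section[OF this B]]
  show ?thesis
    by (rule measurable_cong[THEN iffD1, rotated]) (auto simp: space_pair_measure intro!: arg_cong[where f=card])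
qed

lemma measurable_restrict_config:
  assumes [measurable]: "U \<in> sets borel"
  shows "(\<lambda>\<eta>. \<eta> \<inter> U) \<in> config_space \<rightarrow>\<^sub>M (config_space :: 'a::euclidean_space set measure)"
proof (rule measurable_configI)
  fix B :: "'a set" assume "B \<in> sets borel" "bounded B"
  then have "U \<inter> B \<in> sets borel" "bounded (U \<inter> B)" by (auto intro: bounded_subset)
  from measurable_card_Int[OF this] show "(\<lambda>x. card (x \<inter> U \<inter> B)) \<in> config_space \<rightarrow>\<^sub>M count_space UNIV"
    by (simp add: Int_assoc)
qed (auto intro: configs_Int)

text \<open>
  The pairs prescribe counts in finitely many sets. Since one set may occur with two different
  numbers, the empty event is included, which makes the class closed under intersections.
\<close>

definition counts_event :: "('a::euclidean_space set \<times> nat) set \<Rightarrow> 'a set set" where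
  "counts_event I = {\<eta> \<in> configs. \<forall>(B, k)\<in>I. card (\<eta> \<inter> B) = k}"

definition count_events :: "'a::euclidean_space set set set" where
  "count_events = {counts_event I | I. finite I \<and> (\<forall>(B, k)\<in>I. B \<in> sets borel \<and> bounded B)}"

lemma count_events_subset: "count_events \<subseteq> Pow configs"
  unfolding count_events_def counts_event_def by auto

lemma configs_in_count_events: "configs \<in> count_events"
  unfolding count_events_def counts_event_def by (rule CollectI, rule exI[of _ "{}"]) auto

lemma Int_stable_count_events: "Int_stable (count_events :: 'a::euclidean_space set set set)"
proof (rule Int_stableI)
  fix a b :: "'a set set" assume "a \<in> count_events" "b \<in> count_events"
  then obtain I J where IJ: "a = counts_event I" "b = counts_event J" "finite I" "finite J"
    "\<forall>(B, k)\<in>I. B \<in> sets borel \<and> bounded B" "\<forall>(B, k)\<in>J. B \<in> sets borel \<and> bounded B"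
    unfolding count_events_def by auto
  have "a \<inter> b = counts_event (I \<union> J)"
    unfolding IJ(1,2) counts_event_def ball_Un
    by (rule set_eqI, unfold Int_iff mem_Collect_eq) iprover
  then show "a \<inter> b \<in> count_events"
    unfolding count_events_def using IJ by (intro CollectI exI[of _ "I \<union> J"]) auto
qed

lemma counts_event_sets:
  assumes "finite I" "\<forall>(B, k)\<in>I. B \<in> sets borel \<and> bounded B"
  shows "counts_event I \<in> sets config_space"
proof -
  have "{\<eta> \<in> space config_space. \<forall>Bk\<in>I. card (\<eta> \<inter> fst Bk) = snd Bk} \<in> sets config_space"
  proof (intro sets.sets_Collect_finite_All)
    fix Bk assume "Bk \<in> I"
    then have "fst Bk \<in> sets borel" "bounded (fst Bk)" using assms(2) by auto
    note [measurable] = measurable_card_Int[OF this]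
    show "{\<eta> \<in> space config_space. card (\<eta> \<inter> fst Bk) = snd Bk} \<in> sets config_space" by measurable
  qed (rule assms)
  then show ?thesis unfolding counts_event_def by (simp add: split_beta)
qed

lemma sets_config_space:
  "sets (config_space :: 'a::euclidean_space set measure) = sigma_sets configs count_events"
proof (rule antisym)
  show "sets (config_space :: 'a set measure) \<subseteq> sigma_sets configs count_events"
    unfolding sets_config_space_gen
  proof (rule sigma_sets_mono, rule subsetI)
    fix E :: "'a set set" assume "E \<in> {{\<eta> \<in> configs. card (\<eta> \<inter> B) = k} |B k. B \<in> sets borel \<and> bounded B}"
    then obtain B k where E: "E = {\<eta> \<in> configs. card (\<eta> \<inter> B) = k}" and "B \<in> sets borel" "bounded B"
      by auto
    then have "counts_event {(B, k)} \<in> count_events" unfolding count_events_def by blast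
    then show "E \<in> sigma_sets configs count_events"
      unfolding E by (intro sigma_sets.Basic) (simp add: counts_event_def)
  qed
  have "count_events \<subseteq> sets (config_space :: 'a set measure)"
    unfolding count_events_def using counts_event_sets by auto
  then show "sigma_sets configs count_events \<subseteq> sets (config_space :: 'a set measure)"
    using sets.sigma_sets_subset[of count_events config_space] by simp
qed

section \<open>The flow driven by a point set\<close>

text \<open>
  The time interval is open on the left: a particle born at time \<open>r\<close> is not deleted by its own point.
\<close>

definition clear :: "('a::euclidean_space \<times> real) set \<Rightarrow> 'a \<Rightarrow> real \<Rightarrow> real \<Rightarrow> bool" where
  "clear S x r t \<longleftrightarrow> (\<forall>u s. (u, s) \<in> S \<and> r < s \<and> s \<le> t \<longrightarrow> 1 < dist x u)"

definition flow :: "('a::euclidean_space \<times> real) set \<Rightarrow> real \<Rightarrow> real \<Rightarrow> 'a set \<Rightarrow> 'a set" where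
  "flow S r t \<eta> = {x \<in> \<eta>. clear S x r t} \<union> {x. \<exists>s. (x, s) \<in> S \<and> r < s \<and> s \<le> t \<and> clear S x s t}"

definition alive :: "('a::euclidean_space \<times> real) set \<Rightarrow> real \<Rightarrow> 'a set" where
  "alive S t = {x. \<exists>s. (x, s) \<in> S \<and> s \<le> t \<and> clear S x s t}"

lemma clear_split: "r \<le> s \<Longrightarrow> s \<le> t \<Longrightarrow> clear S x r t \<longleftrightarrow> clear S x r s \<and> clear S x s t"
  unfolding clear_def by (meson le_less_trans less_le_trans less_imp_le not_le order_trans)

lemma clear_refl [simp]: "clear S x t t"
  unfolding clear_def by auto

lemma flow_refl [simp]: "flow S t t \<eta> = \<eta>"
  unfolding flow_def by auto

text \<open>
  Being clear over \<open>(r, t]\<close> means being clear over \<open>(r, s]\<close> and over \<open>(s, t]\<close>, so a particle survives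
  until \<open>t\<close> if and only if it survives until \<open>s\<close> and then until \<open>t\<close>.
\<close>

lemma flow_flow:
  assumes "r \<le> s" "s \<le> t"
  shows "flow S s t (flow S r s \<eta>) = flow S r t \<eta>"
proof (intro set_eqI iffI)
  fix x assume "x \<in> flow S s t (flow S r s \<eta>)"
  then consider "x \<in> \<eta>" "clear S x r s" "clear S x s t"
    | q where "(x, q) \<in> S" "r < q" "q \<le> s" "clear S x q s" "clear S x s t"
    | q where "(x, q) \<in> S" "s < q" "q \<le> t" "clear S x q t"
    unfolding flow_def by blast
  then show "x \<in> flow S r t \<eta>"
  proof cases
    case 1
    then show ?thesis unfolding flow_def using clear_split[OF assms] by auto
  next
    case 2
    then have "q \<le> t" "clear S x q t" using clear_split[of q s t S x] assms by auto
    then show ?thesis unfolding flow_def using 2 by auto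
  next
    case 3
    then have "r < q" using assms by auto
    then show ?thesis unfolding flow_def using 3 by auto
  qed
next
  fix x assume "x \<in> flow S r t \<eta>"
  then consider "x \<in> \<eta>" "clear S x r t" | q where "(x, q) \<in> S" "r < q" "q \<le> t" "clear S x q t"
    unfolding flow_def by auto
  then show "x \<in> flow S s t (flow S r s \<eta>)"
  proof cases
    case 1
    then show ?thesis unfolding flow_def using clear_split[OF assms] by auto
  next
    case 2
    then show ?thesis unfolding flow_def using clear_split[of q s t S x] assms
      by (cases "q \<le> s") auto
  qed
qed

lemma flow_alive:
  assumes "s \<le> t"
  shows "flow S s t (alive S s) = alive S t"
proof (intro set_eqI iffI)
  fix x assume "x \<in> flow S s t (alive S s)"
  then consider q where "(x, q) \<in> S" "q \<le> s" "clear S x q s" "clear S x s t"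
    | q where "(x, q) \<in> S" "s < q" "q \<le> t" "clear S x q t"
    unfolding flow_def alive_def by blast
  then show "x \<in> alive S t"
  proof cases
    case 1
    then have "q \<le> t" "clear S x q t" using clear_split[of q s t S x] assms by auto
    then show ?thesis unfolding alive_def using 1 by auto
  next
    case 2
    then show ?thesis unfolding alive_def by auto
  qed
next
  fix x assume "x \<in> alive S t"
  then obtain q where q: "(x, q) \<in> S" "q \<le> t" "clear S x q t"
    unfolding alive_def by auto
  show "x \<in> flow S s t (alive S s)"
  proof (cases "q \<le> s")
    case True
    then have "clear S x q s" "clear S x s t" using clear_split[of q s t S x] assms q by auto
    then show ?thesis unfolding flow_def alive_def using True q by blast
  next
    case False
    then show ?thesis unfolding flow_def using q by auto
  qed
qed

lemma clear_cong:
  assumes "\<And>u s. r < s \<Longrightarrow> s \<le> t \<Longrightarrow> dist x u \<le> 1 \<Longrightarrow> (u, s) \<in> S \<longleftrightarrow> (u, s) \<in> S'"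
  shows "clear S x r t \<longleftrightarrow> clear S' x r t"
  unfolding clear_def using assms by (meson not_le)

lemma flow_cong:
  assumes "\<And>u s. r < s \<Longrightarrow> s \<le> t \<Longrightarrow> (u, s) \<in> S \<longleftrightarrow> (u, s) \<in> S'"
  shows "flow S r t \<eta> = flow S' r t \<eta>"
proof -
  have cl: "clear S x q t \<longleftrightarrow> clear S' x q t" if "r \<le> q" for x q
    by (rule clear_cong) (use assms that in auto)
  have "(x, s) \<in> S \<and> r < s \<and> s \<le> t \<and> clear S x s t \<longleftrightarrow> (x, s) \<in> S' \<and> r < s \<and> s \<le> t \<and> clear S' x s t" for x s
    using cl[of s x] assms[of s x] by auto
  then show ?thesis unfolding flow_def using cl[of r] by simp
qed

lemma alive_cong:
  assumes "\<And>u s. s \<le> t \<Longrightarrow> (u, s) \<in> S \<longleftrightarrow> (u, s) \<in> S'"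
  shows "alive S t = alive S' t"
proof -
  have cl: "clear S x q t \<longleftrightarrow> clear S' x q t" for x q
    by (rule clear_cong) (use assms in auto)
  have "(x, s) \<in> S \<and> s \<le> t \<and> clear S x s t \<longleftrightarrow> (x, s) \<in> S' \<and> s \<le> t \<and> clear S' x s t" for x s
    using cl[of x s] assms[of s x] by auto
  then show ?thesis unfolding alive_def by simp
qed

lemma bounded_slab: "bounded B \<Longrightarrow> bounded (B \<times> {r<..t::real})"
  by (intro bounded_Times bounded_subset[OF bounded_closed_interval[of r t]]) auto

text \<open>
  The projection of the surviving arrivals to space is injective, because a later point at the same
  place deletes the earlier one; for the same reason no surviving old particle lies under a surviving
  arrival. So the flow is counted by two counts of the type treated in \<open>measurable_card_Collect\<close>.
\<close>

lemma card_flow: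
  assumes S: "S \<in> configs" and \<eta>: "\<eta> \<in> configs" and B: "bounded B"
  shows "finite (flow S r t \<eta> \<inter> B)"
    and "card (flow S r t \<eta> \<inter> B) = card {x \<in> \<eta> \<inter> B. clear S x r t}
      + card {p \<in> S \<inter> B \<times> {r<..t}. clear S (fst p) (snd p) t}"
proof -
  let ?old = "{x \<in> \<eta> \<inter> B. clear S x r t}"
  let ?new = "{p \<in> S \<inter> B \<times> {r<..t}. clear S (fst p) (snd p) t}"
  have eq: "flow S r t \<eta> \<inter> B = ?old \<union> fst ` ?new"
    unfolding flow_def by force
  have fin: "finite ?old" "finite ?new"
    by (rule finite_subset[OF _ finite_configs_Int[OF \<eta> B]], auto)
      (rule finite_subset[OF _ finite_configs_Int[OF S bounded_slab[OF B, of r t]]], auto)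
  show "finite (flow S r t \<eta> \<inter> B)"
    unfolding eq using fin by blast
  have inj: "inj_on fst ?new"
  proof (rule inj_onI)
    fix p q assume pq: "p \<in> ?new" "q \<in> ?new" "fst p = fst q"
    then have "snd p \<le> snd q" "snd q \<le> snd p"
      unfolding clear_def by (cases p; cases q; force simp: not_less[symmetric])+
    with pq show "p = q" by (auto simp: prod_eq_iff)
  qed
  have "?old \<inter> fst ` ?new = {}"
    unfolding clear_def by force
  then show "card (flow S r t \<eta> \<inter> B) = card ?old + card ?new"
    unfolding eq using fin inj by (simp add: card_Un_disjoint card_image)
qed

lemma flow_in_configs:
  assumes "S \<in> configs" "\<eta> \<in> configs" shows "flow S r t \<eta> \<in> configs"
  unfolding configs_def using card_flow(1)[OF assms] by auto

text \<open>
  No point of \<open>X w\<close> in an unbounded region is the conjunction over \<open>n\<close> of vanishing counts in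
  bounded boxes.
\<close>

lemma measurable_clear [measurable (raw)]:
  fixes X :: "'w \<Rightarrow> ('a::euclidean_space \<times> real) set"
  assumes X [measurable]: "X \<in> G \<rightarrow>\<^sub>M config_space"
    and [measurable]: "f \<in> borel_measurable G" "r \<in> borel_measurable G"
  shows "Measurable.pred G (\<lambda>w. clear (X w) (f w) (r w) t)"
proof -
  let ?B = "\<lambda>n::nat. cball (0::'a) n \<times> {- real n<..t}"
  let ?Q = "\<lambda>w p. r w < snd p \<and> dist (f w) (fst p) \<le> 1"
  have "(\<lambda>w. card {p \<in> X w \<inter> ?B n. ?Q w p}) \<in> G \<rightarrow>\<^sub>M count_space UNIV" for n
    by (rule measurable_card_Collect[OF X])
      (auto intro!: bounded_slab borel_Times simp: borel_prod[symmetric])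
  then have "Measurable.pred G (\<lambda>w. \<forall>n. card {p \<in> X w \<inter> ?B n. ?Q w p} = 0)"
    by measurable
  then show ?thesis
  proof (rule measurable_cong[THEN iffD1, rotated])
    fix w assume "w \<in> space G"
    then have X: "X w \<in> configs" using measurable_space[OF X] by simp
    have "finite {p \<in> X w \<inter> ?B n. ?Q w p}" for n
      by (rule finite_subset[OF _ finite_configs_Int[OF X bounded_slab[OF bounded_cball]]]) auto
    then have "(\<forall>n. card {p \<in> X w \<inter> ?B n. ?Q w p} = 0) \<longleftrightarrow> (\<forall>n. {p \<in> X w \<inter> ?B n. ?Q w p} = {})"
      by simp
    also have "\<dots> \<longleftrightarrow> clear (X w) (f w) (r w) t"
    proof
      assume *: "\<forall>n. {p \<in> X w \<inter> ?B n. ?Q w p} = {}"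
      show "clear (X w) (f w) (r w) t" unfolding clear_def
      proof (intro allI impI)
        fix u s assume us: "(u, s) \<in> X w \<and> r w < s \<and> s \<le> t"
        obtain n :: nat where "max (norm u) (1 - s) \<le> n" using real_arch_simple by blast
        then have "(u, s) \<in> ?B n" using us by auto
        with us *[rule_format, of n] show "1 < dist (f w) u" by fastforce
      qed
    qed (auto simp: clear_def)
    finally show "(\<forall>n. card {p \<in> X w \<inter> ?B n. ?Q w p} = 0) = clear (X w) (f w) (r w) t" .
  qed
qed

lemma measurable_flow [measurable (raw)]:
  fixes X :: "'w \<Rightarrow> ('a::euclidean_space \<times> real) set"
  assumes X [measurable]: "X \<in> G \<rightarrow>\<^sub>M config_space"
    and H [measurable]: "H \<in> G \<rightarrow>\<^sub>M config_space"
  shows "(\<lambda>w. flow (X w) r t (H w)) \<in> G \<rightarrow>\<^sub>M config_space"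
proof (rule measurable_configI)
  have XH: "X w \<in> configs" "H w \<in> configs" if "w \<in> space G" for w
    using that measurable_space[OF X] measurable_space[OF H] by auto
  then show "flow (X w) r t (H w) \<in> configs" if "w \<in> space G" for w
    by (rule flow_in_configs) (use XH that in auto)
  fix B :: "'a set" assume B [measurable]: "B \<in> sets borel" and bB: "bounded B"
  have "(\<lambda>w. card {x \<in> H w \<inter> B. clear (X w) x r t}) \<in> G \<rightarrow>\<^sub>M count_space UNIV"
    by (rule measurable_card_Collect[OF H _ B bB]) measurable
  moreover have "(\<lambda>w. card {p \<in> X w \<inter> B \<times> {r<..t}. clear (X w) (fst p) (snd p) t}) \<in> G \<rightarrow>\<^sub>M count_space UNIV"
    by (rule measurable_card_Collect[OF X _ _ bounded_slab[OF bB]])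
      (auto intro!: borel_Times simp: borel_prod[symmetric])
  ultimately have "(\<lambda>w. card {x \<in> H w \<inter> B. clear (X w) x r t}
      + card {p \<in> X w \<inter> B \<times> {r<..t}. clear (X w) (fst p) (snd p) t}) \<in> G \<rightarrow>\<^sub>M count_space UNIV"
    by measurable
  then show "(\<lambda>w. card (flow (X w) r t (H w) \<inter> B)) \<in> G \<rightarrow>\<^sub>M count_space UNIV"
    by (rule measurable_cong[THEN iffD1, rotated]) (simp add: card_flow(2)[OF XH bB])
qed

text \<open>
  The effect on a configuration of a single arrival at \<open>u\<close>, in the form in which it occurs in \<open>gen\<close>.
\<close>

definition arrival :: "'a::euclidean_space \<Rightarrow> 'a set \<Rightarrow> 'a set" where
  "arrival u \<eta> = (\<eta> - cball u 1) \<union> {u}"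

lemma arrival_in_configs:
  assumes "\<eta> \<in> configs" shows "arrival u \<eta> \<in> configs"
  unfolding configs_def arrival_def
proof (intro CollectI allI impI)
  fix B :: "'a set" assume "bounded B"
  then have "finite (insert u (\<eta> \<inter> B))" using finite_configs_Int[OF assms] by auto
  then show "finite ((\<eta> - cball u 1 \<union> {u}) \<inter> B)" by (rule rev_finite_subset) auto
qed

lemma measurable_arrival [measurable (raw)]:
  fixes H :: "'w \<Rightarrow> 'a::euclidean_space set"
  assumes [measurable]: "U \<in> borel_measurable G" and H [measurable]: "H \<in> G \<rightarrow>\<^sub>M config_space"
  shows "(\<lambda>w. arrival (U w) (H w)) \<in> G \<rightarrow>\<^sub>M config_space"
proof (rule measurable_configI)
  have H': "H w \<in> configs" if "w \<in> space G" for w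
    using that measurable_space[OF H] by auto
  then show "arrival (U w) (H w) \<in> configs" if "w \<in> space G" for w
    using that arrival_in_configs by auto
  fix B :: "'a set" assume B [measurable]: "B \<in> sets borel" and bB: "bounded B"
  have [measurable]: "(\<lambda>w. card {x \<in> H w \<inter> B. 1 < dist (U w) x}) \<in> G \<rightarrow>\<^sub>M count_space UNIV"
    by (rule measurable_card_Collect[OF H _ B bB]) measurable
  have "(\<lambda>w. card {x \<in> H w \<inter> B. 1 < dist (U w) x} + (if U w \<in> B then 1 else 0)) \<in> G \<rightarrow>\<^sub>M count_space UNIV"
    by measurable
  then show "(\<lambda>w. card (arrival (U w) (H w) \<inter> B)) \<in> G \<rightarrow>\<^sub>M count_space UNIV"
  proof (rule measurable_cong[THEN iffD1, rotated])
    fix w assume w: "w \<in> space G"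
    have fin: "finite {x \<in> H w \<inter> B. 1 < dist (U w) x}"
      by (rule finite_subset[OF _ finite_configs_Int[OF H'[OF w] bB]]) auto
    have "arrival (U w) (H w) \<inter> B = (if U w \<in> B then insert (U w) else id) {x \<in> H w \<inter> B. 1 < dist (U w) x}"
      unfolding arrival_def by auto
    then show "card {x \<in> H w \<inter> B. 1 < dist (U w) x} + (if U w \<in> B then 1 else 0) = card (arrival (U w) (H w) \<inter> B)"
      using fin by simp
  qed
qed

text \<open>
  A point at distance more than \<open>R + 1\<close> from the origin neither reaches a particle in the window of
  radius \<open>R\<close> nor lies in it.
\<close>

lemma flow_no_arrival:
  assumes "S \<inter> (cball 0 (R + 1) \<times> {r<..t}) = {}"
  shows "flow S r t \<eta> \<inter> cball 0 R = \<eta> \<inter> cball 0 R"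
proof -
  have far: "1 < dist x u" if "norm x \<le> R" "(u, s) \<in> S" "r < s" "s \<le> t" for x u s
  proof -
    have "R + 1 < norm u" using assms that by (force simp: not_le[symmetric])
    then show ?thesis using that(1) norm_triangle_sub[of u x] by (simp add: dist_norm norm_minus_commute)
  qed
  then have "clear S x r t" if "norm x \<le> R" for x
    unfolding clear_def using that by blast
  moreover have "(x, s) \<notin> S" if "norm x \<le> R" "r < s" "s \<le> t" for x s
    using far[OF that(1), of x s] that by auto
  ultimately show ?thesis unfolding flow_def by auto
qed

lemma flow_one_arrival:
  assumes "S \<inter> (cball 0 (R + 1) \<times> {r<..t}) = {(u, q)}"
  shows "flow S r t \<eta> \<inter> cball 0 R = arrival u \<eta> \<inter> cball 0 R"
proof -
  have "(u, q) \<in> S \<inter> (cball 0 (R + 1) \<times> {r<..t})" using assms by simp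
  then have uq: "(u, q) \<in> S" "r < q" "q \<le> t" by auto
  have far: "1 < dist x v" if "norm x \<le> R" "(v, s) \<in> S" "r < s" "s \<le> t" "(v, s) \<noteq> (u, q)" for x v s
  proof -
    have "(v, s) \<notin> cball 0 (R + 1) \<times> {r<..t}" using assms that(2,5) by blast
    then have "R + 1 < norm v" using that by auto
    then show ?thesis using that(1) norm_triangle_sub[of v x] by (simp add: dist_norm norm_minus_commute)
  qed
  have "clear S x r t \<longleftrightarrow> 1 < dist x u" if "norm x \<le> R" for x
    unfolding clear_def using that uq far by blast
  moreover have "(x, s) \<in> S \<and> r < s \<and> s \<le> t \<longleftrightarrow> (x, s) = (u, q)" if "norm x \<le> R" for x s
    using far[OF that, of x s] uq by auto
  moreover have "clear S u q t" if "norm u \<le> R"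
    unfolding clear_def using far[OF that] uq
    by (metis less_trans order_less_irrefl prod.inject)
  ultimately show ?thesis unfolding flow_def arrival_def
    by (auto simp: dist_commute) blast+
qed

section \<open>Independence over disjoint regions\<close>

text \<open>
  The definition of a Poisson process speaks of disjoint sets only. Arbitrary finite families are
  reduced to disjoint ones by the atoms of the finite algebra that they generate: two points are in
  the same atom if they belong to the same members of the family.
\<close>

lemma finite_family_atoms:
  fixes \<A> :: "'a::euclidean_space set set"
  assumes fin: "finite \<A>" and \<A>: "\<And>A. A \<in> \<A> \<Longrightarrow> A \<in> sets borel \<and> bounded A"
  obtains \<C> where "finite \<C>" "disjoint \<C>" "{} \<notin> \<C>" "\<Union>\<C> \<subseteq> \<Union>\<A>"
    "\<And>C. C \<in> \<C> \<Longrightarrow> C \<in> sets borel \<and> bounded C"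
    "\<And>A. A \<in> \<A> \<Longrightarrow> A = \<Union>{C \<in> \<C>. C \<subseteq> A}"
proof -
  define atom where "atom J = {x \<in> \<Union>\<A>. {A \<in> \<A>. x \<in> A} = J}" for J
  define \<C> where "\<C> = atom ` Pow \<A> - {{}}"
  have atom: "atom J \<in> sets borel \<and> bounded (atom J)" if J: "J \<subseteq> \<A>" for J
  proof -
    have eq: "atom J = \<Union>\<A> \<inter> (\<Inter>A\<in>\<A>. if A \<in> J then A else - A)"
      unfolding atom_def using J by (auto split: if_splits)
    have "atom J \<in> sets borel"
    proof (cases "\<A> = {}")
      case False
      then show ?thesis unfolding eq using fin \<A>
        by (intro sets.Int sets.finite_Union sets.finite_INT) (auto intro: borel_comp)
    qed (simp add: atom_def)
    moreover have "bounded (\<Union>\<A>)" using fin \<A> by auto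
    then have "bounded (atom J)" by (rule bounded_subset) (auto simp: atom_def)
    ultimately show ?thesis by simp
  qed
  show ?thesis
  proof (rule that[of \<C>])
    show "finite \<C>" "{} \<notin> \<C>" unfolding \<C>_def using fin by simp_all
    have "atom J \<subseteq> \<Union>\<A>" for J unfolding atom_def by blast
    then show "\<Union>\<C> \<subseteq> \<Union>\<A>" unfolding \<C>_def by blast
    have "J = K" if "x \<in> atom J" "x \<in> atom K" for x J K
      using that unfolding atom_def mem_Collect_eq by (elim conjE) (rule trans[OF sym])
    then show "disjoint \<C>" unfolding \<C>_def disjoint_def by blast
    show "C \<in> sets borel \<and> bounded C" if "C \<in> \<C>" for C
      using that atom unfolding \<C>_def by auto
    show "A = \<Union>{C \<in> \<C>. C \<subseteq> A}" if A: "A \<in> \<A>" for A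
    proof (intro equalityI subsetI)
      fix x assume x: "x \<in> A"
      let ?C = "atom {A \<in> \<A>. x \<in> A}"
      have "x \<in> ?C" "?C \<subseteq> A" using x A unfolding atom_def by blast+
      then have "?C \<in> \<C>" unfolding \<C>_def by blast
      then show "x \<in> \<Union>{C \<in> \<C>. C \<subseteq> A}" using \<open>x \<in> ?C\<close> \<open>?C \<subseteq> A\<close> by blast
    qed blast
  qed
qed

lemma window_atoms:
  fixes I :: "('a::euclidean_space set \<times> nat) set"
  assumes W: "W \<in> sets borel" and I: "finite I" "\<forall>(B, k)\<in>I. B \<in> sets borel \<and> bounded B"
  obtains \<C> where "finite \<C>" "disjoint \<C>" "{} \<notin> \<C>" "\<Union>\<C> \<subseteq> W"
    "\<And>C. C \<in> \<C> \<Longrightarrow> C \<in> sets borel \<and> bounded C"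
    "\<And>B k. (B, k) \<in> I \<Longrightarrow> W \<inter> B = \<Union>{C \<in> \<C>. C \<subseteq> W \<inter> B}"
proof -
  let ?A = "(\<lambda>Bk. W \<inter> fst Bk) ` I"
  have "finite ?A" using I by simp
  moreover have "A \<in> sets borel \<and> bounded A" if "A \<in> ?A" for A
    using that I(2) W by (force intro: bounded_subset)
  ultimately obtain \<C> where C: "finite \<C>" "disjoint \<C>" "{} \<notin> \<C>" "\<Union>\<C> \<subseteq> \<Union>?A"
    "\<And>C. C \<in> \<C> \<Longrightarrow> C \<in> sets borel \<and> bounded C"
    "\<And>A. A \<in> ?A \<Longrightarrow> A = \<Union>{C \<in> \<C>. C \<subseteq> A}"
    using finite_family_atoms[of ?A] by blast
  show ?thesis
  proof (rule that[OF C(1-3) _ C(5)])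
    show "\<Union>\<C> \<subseteq> W" using C(4) by blast
    show "W \<inter> B = \<Union>{C \<in> \<C>. C \<subseteq> W \<inter> B}" if "(B, k) \<in> I" for B k
      by (rule C(6)) (use that in \<open>force\<close>)
  qed
qed

locale poisson = prob_space M for M :: "'w measure" +
  fixes S :: "'w \<Rightarrow> 'b::euclidean_space set" and lam :: real
  assumes lam_pos: "0 < lam" and poisson: "poisson_process M lam S"
begin

lemma measurable_S [measurable]: "S \<in> M \<rightarrow>\<^sub>M config_space"
  using poisson unfolding poisson_process_def by auto

lemma S_configs: "\<omega> \<in> space M \<Longrightarrow> S \<omega> \<in> configs"
  using measurable_space[OF measurable_S] by simp

lemma measurable_card_S:
  "B \<in> sets borel \<Longrightarrow> bounded B \<Longrightarrow> (\<lambda>\<omega>. card (S \<omega> \<inter> B)) \<in> M \<rightarrow>\<^sub>M count_space UNIV"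
  by (rule measurable_compose[OF measurable_S measurable_card_Int])

lemma prob_card:
  "A \<in> sets borel \<Longrightarrow> bounded A \<Longrightarrow> \<P>(\<omega> in M. card (S \<omega> \<inter> A) = k) =
    exp (- (lam * measure lborel A)) * (lam * measure lborel A) ^ k / fact k"
  using poisson unfolding poisson_process_def by blast

lemma indep_counts:
  fixes A :: "nat \<Rightarrow> 'b set"
  assumes "finite I" "\<And>i. i \<in> I \<Longrightarrow> A i \<in> sets borel \<and> bounded (A i)" "disjoint_family_on A I"
  shows "indep_vars (\<lambda>_. count_space UNIV) (\<lambda>i \<omega>. card (S \<omega> \<inter> A i)) I"
  using poisson assms unfolding poisson_process_def by blast

text \<open>
  All atoms of both families, those inside \<open>U\<close> and those inside \<open>V\<close>, form one disjoint family, whose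
  counts are independent. Each of the two events is determined by the counts of its own atoms,
  because the count of a set is the sum of the counts of the atoms contained in it.
\<close>

lemma indep_restrict_counts_event:
  assumes [measurable]: "U \<in> sets borel" "V \<in> sets borel" and UV: "U \<inter> V = {}"
    and I: "finite I" "\<forall>(B, k)\<in>I. B \<in> sets borel \<and> bounded B"
    and J: "finite J" "\<forall>(B, k)\<in>J. B \<in> sets borel \<and> bounded B"
  shows "\<P>(\<omega> in M. S \<omega> \<inter> U \<in> counts_event I \<and> S \<omega> \<inter> V \<in> counts_event J)
    = \<P>(\<omega> in M. S \<omega> \<inter> U \<in> counts_event I) * \<P>(\<omega> in M. S \<omega> \<inter> V \<in> counts_event J)"
proof -
  obtain \<C> where C: "finite \<C>" "disjoint \<C>" "{} \<notin> \<C>"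
    "\<Union>\<C> \<subseteq> U" "\<And>C. C \<in> \<C> \<Longrightarrow> C \<in> sets borel \<and> bounded C"
    "\<And>B k. (B, k) \<in> I \<Longrightarrow> U \<inter> B = \<Union>{C \<in> \<C>. C \<subseteq> U \<inter> B}"
  proof (rule window_atoms[OF assms(1) I], goal_cases)
    case (1 \<C>)
    from 1(2-) show thesis by (rule 1(1))
  qed
  obtain \<D> where D: "finite \<D>" "disjoint \<D>" "{} \<notin> \<D>"
    "\<Union>\<D> \<subseteq> V" "\<And>C. C \<in> \<D> \<Longrightarrow> C \<in> sets borel \<and> bounded C"
    "\<And>B k. (B, k) \<in> J \<Longrightarrow> V \<inter> B = \<Union>{C \<in> \<D>. C \<subseteq> V \<inter> B}"
  proof (rule window_atoms[OF assms(2) J], goal_cases)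
    case (1 \<D>)
    from 1(2-) show thesis by (rule 1(1))
  qed
  have CD': "C \<inter> D = {}" if "C \<in> \<C>" "D \<in> \<D>" for C D
    using Union_upper[OF that(1)] Union_upper[OF that(2)] C(4) D(4) UV by blast
  have CD: "\<C> \<inter> \<D> = {}"
    using CD' C(3) by (metis Int_absorb disjoint_iff)
  have dCD: "C \<inter> D = {}" if "C \<in> \<C> \<union> \<D>" "D \<in> \<C> \<union> \<D>" "C \<noteq> D" for C D
    using that C(2) D(2) CD' unfolding disjoint_def by (metis Int_commute UnE)
  define n where "n = card (\<C> \<union> \<D>)"
  obtain f where f: "bij_betw f {..<n} (\<C> \<union> \<D>)"
    using ex_bij_betw_nat_finite[of "\<C> \<union> \<D>"] C(1) D(1) unfolding n_def lessThan_atLeast0 by auto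
  define K where "K \<E> = {i \<in> {..<n}. f i \<in> \<E>}" for \<E>
  have ind: "indep_vars (\<lambda>_. count_space UNIV) (\<lambda>i \<omega>. card (S \<omega> \<inter> f i)) {..<n}"
  proof (rule indep_counts)
    show "f i \<in> sets borel \<and> bounded (f i)" if "i \<in> {..<n}" for i
      using f that C(5) D(5) by (auto dest!: bij_betwE)
    show "disjoint_family_on f {..<n}"
      unfolding disjoint_family_on_def
    proof (intro ballI impI)
      fix i j assume "i \<in> {..<n}" "j \<in> {..<n}" "i \<noteq> j"
      then have "f i \<in> \<C> \<union> \<D>" "f j \<in> \<C> \<union> \<D>" "f i \<noteq> f j"
        using f by (auto simp: bij_betw_def inj_on_def)
      then show "f i \<inter> f j = {}" by (rule dCD)
    qed
  qed simp
  define X where "X \<E> \<omega> = restrict (\<lambda>i. card (S \<omega> \<inter> f i)) (K \<E>)" for \<E> \<omega>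
  have iv: "indep_var (PiM (K \<C>) (\<lambda>_. count_space UNIV)) (X \<C>) (PiM (K \<D>) (\<lambda>_. count_space UNIV)) (X \<D>)"
    unfolding X_def by (rule indep_var_restrict[OF ind]) (use CD in \<open>auto simp: K_def\<close>)
  define Z where "Z \<E> W L = {g \<in> space (PiM (K \<E>) (\<lambda>_. count_space UNIV :: nat measure)).
      \<forall>Bk\<in>L. (\<Sum>i\<in>{i \<in> K \<E>. f i \<subseteq> W \<inter> fst Bk}. g i) = snd Bk}" for \<E> L and W :: "'b set"
  have Z_sets: "Z \<E> W L \<in> sets (PiM (K \<E>) (\<lambda>_. count_space UNIV))" if "finite L" for \<E> W and L :: "('b set \<times> nat) set"
    unfolding Z_def using that by measurable
  have card_sum: "card (\<eta> \<inter> (W \<inter> B)) = (\<Sum>i\<in>{i \<in> K \<E>. f i \<subseteq> W \<inter> B}. card (\<eta> \<inter> f i))"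
    if \<eta>: "\<eta> \<in> configs" and \<E>: "\<E> \<subseteq> \<C> \<union> \<D>" "W \<inter> B = \<Union>{C \<in> \<E>. C \<subseteq> W \<inter> B}" for \<eta> W B \<E>
  proof -
    have "\<eta> \<inter> (W \<inter> B) = (\<Union>i\<in>{i \<in> K \<E>. f i \<subseteq> W \<inter> B}. \<eta> \<inter> f i)"
    proof -
      have "{C \<in> \<E>. C \<subseteq> W \<inter> B} = f ` {i \<in> K \<E>. f i \<subseteq> W \<inter> B}"
      proof (intro equalityI subsetI)
        fix C assume C: "C \<in> {C \<in> \<E>. C \<subseteq> W \<inter> B}"
        then have "C \<in> f ` {..<n}" using f \<E>(1) unfolding bij_betw_def by blast
        then obtain i where "C = f i" "i < n" by blast
        then show "C \<in> f ` {i \<in> K \<E>. f i \<subseteq> W \<inter> B}"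
          using C unfolding K_def by blast
      qed (auto simp: K_def)
      then have "\<Union>(f ` {i \<in> K \<E>. f i \<subseteq> W \<inter> B}) = W \<inter> B"
        by (rule trans[OF arg_cong[where f=Union, OF sym] \<E>(2)[symmetric]])
      then show ?thesis by (simp only: Int_UN_distrib[symmetric])
    qed
    moreover have "card (\<Union>i\<in>{i \<in> K \<E>. f i \<subseteq> W \<inter> B}. \<eta> \<inter> f i) = (\<Sum>i\<in>{i \<in> K \<E>. f i \<subseteq> W \<inter> B}. card (\<eta> \<inter> f i))"
    proof (rule card_UN_disjoint)
      show "finite {i \<in> K \<E>. f i \<subseteq> W \<inter> B}" by (auto simp: K_def)
      have "f i \<in> \<C> \<union> \<D>" if "i \<in> K \<E>" for i using that f by (auto simp: K_def dest!: bij_betwE)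
      then show "\<forall>i\<in>{i \<in> K \<E>. f i \<subseteq> W \<inter> B}. finite (\<eta> \<inter> f i)"
        using finite_configs_Int[OF \<eta>] C(5) D(5) by (metis (no_types, lifting) Un_iff mem_Collect_eq)
      show "\<forall>i\<in>{i \<in> K \<E>. f i \<subseteq> W \<inter> B}. \<forall>j\<in>{i \<in> K \<E>. f i \<subseteq> W \<inter> B}. i \<noteq> j \<longrightarrow> \<eta> \<inter> f i \<inter> (\<eta> \<inter> f j) = {}"
      proof (intro ballI impI)
        fix i j assume "i \<in> {i \<in> K \<E>. f i \<subseteq> W \<inter> B}" "j \<in> {i \<in> K \<E>. f i \<subseteq> W \<inter> B}" "i \<noteq> j"
        then have "f i \<in> \<C> \<union> \<D>" "f j \<in> \<C> \<union> \<D>" "f i \<noteq> f j"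
          using f by (auto simp: bij_betw_def inj_on_def K_def)
        then have "f i \<inter> f j = {}" by (rule dCD)
        then show "\<eta> \<inter> f i \<inter> (\<eta> \<inter> f j) = {}" by auto
      qed
    qed
    ultimately show ?thesis by simp
  qed
  have ev: "S \<omega> \<inter> W \<in> counts_event L \<longleftrightarrow> X \<E> \<omega> \<in> Z \<E> W L"
    if \<omega>: "\<omega> \<in> space M" and \<E>: "\<E> \<subseteq> \<C> \<union> \<D>" "\<And>B k. (B, k) \<in> L \<Longrightarrow> W \<inter> B = \<Union>{C \<in> \<E>. C \<subseteq> W \<inter> B}" for \<omega> W L \<E>
  proof -
    have "X \<E> \<omega> \<in> space (PiM (K \<E>) (\<lambda>_. count_space UNIV))"
      by (auto simp: X_def space_PiM)
    moreover have "S \<omega> \<inter> W \<in> configs" by (rule configs_Int[OF S_configs[OF \<omega>]])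
    moreover have "card (S \<omega> \<inter> W \<inter> B) = (\<Sum>i\<in>{i \<in> K \<E>. f i \<subseteq> W \<inter> B}. X \<E> \<omega> i)" if "(B, k) \<in> L" for B k
      using card_sum[OF S_configs[OF \<omega>] \<E>(1) \<E>(2)[OF that]] by (simp add: X_def Int_assoc)
    ultimately show ?thesis unfolding Z_def counts_event_def by (auto simp: split_beta)
  qed
  have evI: "S \<omega> \<inter> U \<in> counts_event I \<longleftrightarrow> X \<C> \<omega> \<in> Z \<C> U I" if "\<omega> \<in> space M" for \<omega>
    by (rule ev[OF that]) (use C(6) in auto)
  have evJ: "S \<omega> \<inter> V \<in> counts_event J \<longleftrightarrow> X \<D> \<omega> \<in> Z \<D> V J" if "\<omega> \<in> space M" for \<omega>
    by (rule ev[OF that]) (use D(6) in auto)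
  have "{\<omega> \<in> space M. S \<omega> \<inter> U \<in> counts_event I} = X \<C> -` Z \<C> U I \<inter> space M"
    "{\<omega> \<in> space M. S \<omega> \<inter> V \<in> counts_event J} = X \<D> -` Z \<D> V J \<inter> space M"
    "{\<omega> \<in> space M. S \<omega> \<inter> U \<in> counts_event I \<and> S \<omega> \<inter> V \<in> counts_event J}
      = (\<lambda>\<omega>. (X \<C> \<omega>, X \<D> \<omega>)) -` (Z \<C> U I \<times> Z \<D> V J) \<inter> space M"
    using evI evJ by auto
  then show ?thesis
    using indep_varD[OF iv Z_sets[OF I(1)] Z_sets[OF J(1)]] by simp
qed

text \<open>
  Independence passes from the intersection-stable generator to the generated sigma-algebras.
\<close>

lemma indep_restrict:
  assumes U [measurable]: "U \<in> sets borel" and V [measurable]: "V \<in> sets borel" and UV: "U \<inter> V = {}"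
  shows "indep_var config_space (\<lambda>\<omega>. S \<omega> \<inter> U) config_space (\<lambda>\<omega>. S \<omega> \<inter> V)"
proof -
  have meas: "(\<lambda>\<omega>. S \<omega> \<inter> W) \<in> M \<rightarrow>\<^sub>M config_space" if "W \<in> sets borel" for W
    by (rule measurable_compose[OF measurable_S measurable_restrict_config[OF that]])
  have gen: "sigma_sets (space M) {(\<lambda>\<omega>. S \<omega> \<inter> W) -` A \<inter> space M |A. A \<in> sets config_space}
    = sigma_sets (space M) {(\<lambda>\<omega>. S \<omega> \<inter> W) -` A \<inter> space M |A. A \<in> count_events}" for W
    unfolding sets_config_space
    by (subst sigma_sets_vimage_commute)
      (auto intro!: configs_Int S_configs sigma_sets_sigma_sets_eq)
  have stable: "Int_stable {(\<lambda>\<omega>. S \<omega> \<inter> W) -` A \<inter> space M |A. A \<in> count_events}" for W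
  proof (rule Int_stableI, safe)
    fix A B :: "'b set set" assume "A \<in> count_events" "B \<in> count_events"
    then show "\<exists>C. ((\<lambda>\<omega>. S \<omega> \<inter> W) -` A \<inter> space M) \<inter> ((\<lambda>\<omega>. S \<omega> \<inter> W) -` B \<inter> space M)
        = (\<lambda>\<omega>. S \<omega> \<inter> W) -` C \<inter> space M \<and> C \<in> count_events"
      using Int_stable_count_events by (intro exI[of _ "A \<inter> B"]) (auto simp: Int_stable_def)
  qed
  have sub: "A \<in> sets config_space" if "A \<in> count_events" for A :: "'b set set"
    using that unfolding sets_config_space by (rule sigma_sets.Basic)
  show ?thesis
    unfolding indep_var_eq gen
  proof (intro conjI meas U V indep_set_sigma_sets stable indep_setI)
    show "{(\<lambda>\<omega>. S \<omega> \<inter> U) -` A \<inter> space M |A. A \<in> count_events} \<subseteq> events"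
      using measurable_sets[OF meas[OF U] sub] by auto
    show "{(\<lambda>\<omega>. S \<omega> \<inter> V) -` A \<inter> space M |A. A \<in> count_events} \<subseteq> events"
      using measurable_sets[OF meas[OF V] sub] by auto
    fix a b assume "a \<in> {(\<lambda>\<omega>. S \<omega> \<inter> U) -` A \<inter> space M |A. A \<in> count_events}"
      "b \<in> {(\<lambda>\<omega>. S \<omega> \<inter> V) -` A \<inter> space M |A. A \<in> count_events}"
    then obtain I J where IJ: "finite I" "\<forall>(B, k)\<in>I. B \<in> sets borel \<and> bounded B"
      "finite J" "\<forall>(B, k)\<in>J. B \<in> sets borel \<and> bounded B"
      and a: "a = {\<omega> \<in> space M. S \<omega> \<inter> U \<in> counts_event I}"
      and b: "b = {\<omega> \<in> space M. S \<omega> \<inter> V \<in> counts_event J}"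
      unfolding count_events_def by (auto simp: vimage_def Int_def conj_commute)
    have "a \<inter> b = {\<omega> \<in> space M. S \<omega> \<inter> U \<in> counts_event I \<and> S \<omega> \<inter> V \<in> counts_event J}"
      unfolding a b by auto
    then show "prob (a \<inter> b) = prob a * prob b"
      unfolding a b using indep_restrict_counts_event[OF U V UV IJ] by simp
  qed
qed

end

section \<open>Transition kernels of the flow\<close>

text \<open>
  Freezing one of two independent variables: the joint law is a product, so Tonelli's theorem applies.
\<close>

lemma (in prob_space) nn_integral_indep_var:
  assumes ind: "indep_var A X B Y" and g [measurable]: "g \<in> borel_measurable (A \<Otimes>\<^sub>M B)"
  shows "(\<integral>\<^sup>+ \<omega>. g (X \<omega>, Y \<omega>) \<partial>M) = (\<integral>\<^sup>+ \<omega>. \<integral>\<^sup>+ \<omega>'. g (X \<omega>, Y \<omega>') \<partial>M \<partial>M)"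
proof -
  note rv [measurable] = indep_var_rv1[OF ind] indep_var_rv2[OF ind]
  interpret Y: prob_space "distr M B Y" by (rule prob_space_distr) measurable
  have "(\<integral>\<^sup>+ \<omega>. g (X \<omega>, Y \<omega>) \<partial>M) = (\<integral>\<^sup>+ p. g p \<partial>distr M (A \<Otimes>\<^sub>M B) (\<lambda>\<omega>. (X \<omega>, Y \<omega>)))"
    by (subst nn_integral_distr) auto
  also have "distr M (A \<Otimes>\<^sub>M B) (\<lambda>\<omega>. (X \<omega>, Y \<omega>)) = distr M A X \<Otimes>\<^sub>M distr M B Y"
    using ind by (simp add: indep_var_distribution_eq)
  also have "(\<integral>\<^sup>+ p. g p \<partial>(distr M A X \<Otimes>\<^sub>M distr M B Y)) = (\<integral>\<^sup>+ x. \<integral>\<^sup>+ y. g (x, y) \<partial>distr M B Y \<partial>distr M A X)"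
    by (subst Y.nn_integral_fst[symmetric]) auto
  also have "\<dots> = (\<integral>\<^sup>+ x. \<integral>\<^sup>+ \<omega>'. g (x, Y \<omega>') \<partial>M \<partial>distr M A X)"
    by (intro nn_integral_cong nn_integral_distr) auto
  also have "\<dots> = (\<integral>\<^sup>+ \<omega>. \<integral>\<^sup>+ \<omega>'. g (X \<omega>, Y \<omega>') \<partial>M \<partial>M)"
    by (subst nn_integral_distr) auto
  finally show ?thesis .
qed

locale poisson_flow = poisson M S lam
  for M :: "'w measure" and S :: "'w \<Rightarrow> ('a::euclidean_space \<times> real) set" and lam :: real
begin

definition kernel :: "real \<Rightarrow> real \<Rightarrow> 'a set \<Rightarrow> 'a set measure" where
  "kernel r t \<eta> = distr M config_space (\<lambda>\<omega>. flow (S \<omega>) r t \<eta>)"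

lemma measurable_flow_S: "\<eta> \<in> configs \<Longrightarrow> (\<lambda>\<omega>. flow (S \<omega>) r t \<eta>) \<in> M \<rightarrow>\<^sub>M config_space"
  by (rule measurable_flow) auto

lemma measurable_kernel [measurable]: "kernel r t \<in> config_space \<rightarrow>\<^sub>M prob_algebra config_space"
  unfolding kernel_def
proof (rule measurable_distr_prob_space2)
  show "(\<lambda>_. M) \<in> config_space \<rightarrow>\<^sub>M prob_algebra M"
    by (rule measurable_const) (simp add: space_prob_algebra prob_space_axioms)
  show "(\<lambda>(\<eta>, \<omega>). flow (S \<omega>) r t \<eta>) \<in> config_space \<Otimes>\<^sub>M M \<rightarrow>\<^sub>M config_space"
    by measurable
qed

lemma kernel_in_prob_algebra: "\<eta> \<in> configs \<Longrightarrow> kernel r t \<eta> \<in> space (prob_algebra config_space)"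
  using measurable_space[OF measurable_kernel] by simp

lemma kernel_refl: "\<eta> \<in> configs \<Longrightarrow> kernel t t \<eta> = return config_space \<eta>"
  unfolding kernel_def by (simp add: distr_const)

lemma kernel_emeasure:
  assumes "\<eta> \<in> configs" "A \<in> sets config_space"
  shows "emeasure (kernel r t \<eta>) A = (\<integral>\<^sup>+ \<omega>. indicator A (flow (S \<omega>) r t \<eta>) \<partial>M)"
proof -
  note [measurable] = measurable_flow_S[OF assms(1)] assms(2)
  have "emeasure (kernel r t \<eta>) A = (\<integral>\<^sup>+ \<zeta>. indicator A \<zeta> \<partial>kernel r t \<eta>)"
    by (rule nn_integral_indicator[symmetric]) (simp add: kernel_def assms)
  also have "\<dots> = (\<integral>\<^sup>+ \<omega>. indicator A (flow (S \<omega>) r t \<eta>) \<partial>M)"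
    unfolding kernel_def by (rule nn_integral_distr) measurable
  finally show ?thesis .
qed

lemma nn_integral_future:
  fixes g :: "('a \<times> real) set \<Rightarrow> ('a \<times> real) set \<Rightarrow> ennreal"
  assumes [measurable]: "(\<lambda>(\<xi>, \<zeta>). g \<xi> \<zeta>) \<in> borel_measurable (config_space \<Otimes>\<^sub>M config_space)"
  shows "(\<integral>\<^sup>+ \<omega>. g (S \<omega> \<inter> (UNIV \<times> {..s})) (S \<omega> \<inter> (UNIV \<times> {s<..})) \<partial>M)
    = (\<integral>\<^sup>+ \<omega>. \<integral>\<^sup>+ \<omega>'. g (S \<omega> \<inter> (UNIV \<times> {..s})) (S \<omega>' \<inter> (UNIV \<times> {s<..})) \<partial>M \<partial>M)"
proof -
  have "UNIV \<times> {..s} \<in> sets (borel :: ('a \<times> real) measure)" "UNIV \<times> {s<..} \<in> sets (borel :: ('a \<times> real) measure)"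
    by (auto intro!: borel_Times)
  then have "indep_var config_space (\<lambda>\<omega>. S \<omega> \<inter> (UNIV \<times> {..s})) config_space (\<lambda>\<omega>. S \<omega> \<inter> (UNIV \<times> {s<..}))"
    by (rule indep_restrict) auto
  from nn_integral_indep_var[OF this assms] show ?thesis by simp
qed

lemma flow_future: "flow (S' \<inter> (UNIV \<times> {s<..})) s t \<eta> = flow S' s t \<eta>"
  by (rule flow_cong) auto

lemma flow_past: "t \<le> s \<Longrightarrow> flow (S' \<inter> (UNIV \<times> {..s})) r t \<eta> = flow S' r t \<eta>"
  by (rule flow_cong) auto

text \<open>
  The flow equation splits the flow over \<open>(r, t]\<close> into two flows that are driven by the points before
  and after time \<open>s\<close>; these are independent.
\<close>

lemma kernel_comp:
  assumes \<eta>: "\<eta> \<in> configs" and rst: "r \<le> s" "s \<le> t"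
  shows "kernel r t \<eta> = kernel r s \<eta> \<bind> kernel s t"
proof (rule measure_eqI)
  note [measurable] = measurable_flow_S[OF \<eta>]
  have "kernel r s \<eta> \<bind> kernel s t \<in> space (prob_algebra config_space)"
    using measurable_space[OF measurable_bind_prob_space[OF measurable_kernel measurable_kernel]] \<eta> by simp
  then have "sets (kernel r s \<eta> \<bind> kernel s t) = sets config_space"
    by (simp add: space_prob_algebra)
  then show "sets (kernel r t \<eta>) = sets (kernel r s \<eta> \<bind> kernel s t)"
    by (simp add: kernel_def)
  fix A assume "A \<in> sets (kernel r t \<eta>)"
  then have A [measurable]: "A \<in> sets config_space" by (simp add: kernel_def)
  have "emeasure (kernel r t \<eta>) A = (\<integral>\<^sup>+ \<omega>. indicator A (flow (S \<omega> \<inter> (UNIV \<times> {s<..})) s t (flow (S \<omega> \<inter> (UNIV \<times> {..s})) r s \<eta>)) \<partial>M)"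
    by (simp add: kernel_emeasure[OF \<eta> A] flow_future flow_past flow_flow rst)
  also have "\<dots> = (\<integral>\<^sup>+ \<omega>. \<integral>\<^sup>+ \<omega>'. indicator A (flow (S \<omega>' \<inter> (UNIV \<times> {s<..})) s t (flow (S \<omega> \<inter> (UNIV \<times> {..s})) r s \<eta>)) \<partial>M \<partial>M)"
  proof (rule nn_integral_future)
    have [measurable]: "(\<lambda>_. \<eta>) \<in> config_space \<Otimes>\<^sub>M config_space \<rightarrow>\<^sub>M config_space"
      using \<eta> by simp
    show "(\<lambda>(\<xi>, \<zeta>). indicator A (flow \<zeta> s t (flow \<xi> r s \<eta>))) \<in> borel_measurable (config_space \<Otimes>\<^sub>M config_space)"
      by measurable
  qed
  also have "\<dots> = (\<integral>\<^sup>+ \<omega>. emeasure (kernel s t (flow (S \<omega>) r s \<eta>)) A \<partial>M)"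
    by (intro nn_integral_cong) (simp add: flow_future flow_past kernel_emeasure flow_in_configs S_configs \<eta>)
  also have "\<dots> = (\<integral>\<^sup>+ \<zeta>. emeasure (kernel s t \<zeta>) A \<partial>kernel r s \<eta>)"
    unfolding kernel_def[of r s]
    by (rule nn_integral_distr[symmetric]) (auto intro!: measurable_compose[OF measurable_prob_algebraD[OF measurable_kernel]])
  also have "\<dots> = emeasure (kernel r s \<eta> \<bind> kernel s t) A"
    by (rule emeasure_bind_prob_algebra[symmetric, OF kernel_in_prob_algebra[OF \<eta>] measurable_kernel A])
  finally show "emeasure (kernel r t \<eta>) A = emeasure (kernel r s \<eta> \<bind> kernel s t) A" .
qed

end

lemma measure_lborel_slab:
  assumes [measurable]: "C \<in> sets borel" and C: "bounded C" and h: "0 \<le> h"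
  shows "measure lborel (C \<times> {t<..t + h}) = measure lborel (C :: 'a::euclidean_space set) * h"
proof -
  have "emeasure (lborel :: ('a \<times> real) measure) (C \<times> {t<..t + h}) = emeasure (lborel \<Otimes>\<^sub>M lborel) (C \<times> {t<..t + h})"
    by (simp add: lborel_prod)
  also have "\<dots> = emeasure lborel C * emeasure lborel {t<..t + h}"
    by (rule lborel.emeasure_pair_measure_Times) auto
  finally show ?thesis using h by (simp add: measure_def enn2real_mult)
qed

lemma slab_borel: "C \<in> sets (borel :: 'a::euclidean_space measure) \<Longrightarrow> C \<times> {r<..t::real} \<in> sets borel"
  by (auto intro!: borel_Times)

context poisson_flow
begin

text \<open>
  Exactly one point over \<open>C\<close>, and that point over \<open>A\<close>, means one point over \<open>A\<close> and none over
  \<open>C - A\<close>. The result is proportional to the volume of \<open>A\<close>: given that there is exactly one point,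
  its position is uniform.
\<close>

lemma prob_one_point_in:
  assumes [measurable]: "C \<in> sets borel" "A \<in> sets borel" and C: "bounded C" "A \<subseteq> C" and h: "0 \<le> h"
  shows "\<P>(\<omega> in M. card (S \<omega> \<inter> C \<times> {t<..t+h}) = 1 \<and> card (S \<omega> \<inter> A \<times> {t<..t+h}) = 1)
    = lam * h * exp (- (lam * (measure lborel C * h))) * measure lborel A"
proof -
  define D where "D i = (if i = 0 then A else C - A) \<times> {t<..t+h}" for i :: nat
  have A: "bounded A" "bounded (C - A)" using C by (auto intro: bounded_subset)
  have CmA [measurable]: "C - A \<in> sets borel" by measurable
  have ind: "indep_vars (\<lambda>_. count_space UNIV) (\<lambda>i \<omega>. card (S \<omega> \<inter> D i)) {0, 1}"
    by (rule indep_counts) (use A CmA in \<open>auto simp: D_def disjoint_family_on_def intro!: bounded_slab slab_borel\<close>)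
  have "C \<times> {t<..t+h} = D 0 \<union> D 1" "D 0 \<inter> D 1 = {}" using C unfolding D_def by auto
  then have split: "card (S \<omega> \<inter> C \<times> {t<..t+h}) = card (S \<omega> \<inter> D 0) + card (S \<omega> \<inter> D 1)" if "\<omega> \<in> space M" for \<omega>
    using A finite_configs_Int[OF S_configs[OF that]] unfolding D_def
    by (subst card_Un_disjoint[symmetric]) (auto intro!: bounded_slab simp: Int_Un_distrib)
  define k where "k i = (if i = 0 then 1 else 0 :: nat)" for i :: nat
  have "{\<omega> \<in> space M. card (S \<omega> \<inter> C \<times> {t<..t+h}) = 1 \<and> card (S \<omega> \<inter> A \<times> {t<..t+h}) = 1}
     = (\<Inter>i\<in>{0, 1}. (\<lambda>\<omega>. card (S \<omega> \<inter> D i)) -` {k i} \<inter> space M)"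
    using split by (auto simp: D_def k_def)
  moreover have "prob (\<Inter>i\<in>{0, 1}. (\<lambda>\<omega>. card (S \<omega> \<inter> D i)) -` {k i} \<inter> space M)
     = (\<Prod>i\<in>{0, 1}. prob ((\<lambda>\<omega>. card (S \<omega> \<inter> D i)) -` {k i} \<inter> space M))"
    by (rule indep_varsD_finite[OF ind]) auto
  moreover have "(\<lambda>\<omega>. card (S \<omega> \<inter> D i)) -` {k i} \<inter> space M = {\<omega> \<in> space M. card (S \<omega> \<inter> D i) = k i}" for i
    by auto
  ultimately have "\<P>(\<omega> in M. card (S \<omega> \<inter> C \<times> {t<..t+h}) = 1 \<and> card (S \<omega> \<inter> A \<times> {t<..t+h}) = 1)
     = (\<Prod>i\<in>{0, 1}. \<P>(\<omega> in M. card (S \<omega> \<inter> D i) = k i))"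
    by (simp only:)
  also have "\<dots> = \<P>(\<omega> in M. card (S \<omega> \<inter> A \<times> {t<..t+h}) = 1) * \<P>(\<omega> in M. card (S \<omega> \<inter> (C - A) \<times> {t<..t+h}) = 0)"
    by (simp add: D_def k_def)
  also have "\<dots> = exp (- (lam * (measure lborel A * h))) * (lam * (measure lborel A * h)) * exp (- (lam * (measure lborel (C - A) * h)))"
    using A by (simp add: prob_card slab_borel bounded_slab measure_lborel_slab h)
  also have "measure lborel (C - A) = measure lborel C - measure lborel A"
    using C A emeasure_bounded_finite[OF C(1)] by (intro measure_Diff) (auto simp: less_top)
  finally show ?thesis
    by (simp add: algebra_simps exp_diff exp_minus divide_inverse)
qed

end

section \<open>Local functions and the short-time expansion\<close>

lemma abs_integral_le:
  fixes f g :: "'x \<Rightarrow> real"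
  assumes "integrable M f" "integrable M g" "\<And>x. x \<in> space M \<Longrightarrow> \<bar>f x\<bar> \<le> g x"
  shows "\<bar>integral\<^sup>L M f\<bar> \<le> integral\<^sup>L M g"
  by (rule order_trans[OF integral_abs_bound integral_mono]) (use assms in auto)

context poisson_flow
begin

text \<open>
  The variable \<open>U\<close> is the position of the only point, and 0 if there is no such point. Its law
  restricted to the event \<open>N = 1\<close> has a constant density on \<open>C\<close>, by \<open>prob_one_point_in\<close>.
\<close>

lemma integral_single_point:
  fixes g :: "'a \<Rightarrow> real" and t :: real
  assumes C [measurable]: "C \<in> sets borel" and bC: "bounded C" and h: "0 \<le> h"
    and g [measurable]: "g \<in> borel_measurable borel"
  defines "N \<equiv> \<lambda>\<omega>. card (S \<omega> \<inter> C \<times> {t<..t+h})"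
  defines "U \<equiv> \<lambda>\<omega>. if N \<omega> = 1 then fst (the_elem (S \<omega> \<inter> C \<times> {t<..t+h})) else 0"
  shows "U \<in> borel_measurable M"
    and "(LINT \<omega>|M. indicator {\<omega>. N \<omega> = 1} \<omega> * g (U \<omega>))
      = lam * h * exp (- (lam * (measure lborel C * h))) * (LINT u|lborel. indicator C u * g u)"
proof -
  have [measurable]: "(\<lambda>\<omega>. card (S \<omega> \<inter> A \<times> {t<..t+h})) \<in> M \<rightarrow>\<^sub>M count_space UNIV"
    if "A \<in> sets borel" "bounded A" for A
    by (rule measurable_card_S) (use that in \<open>auto intro!: bounded_slab slab_borel\<close>)
  have [measurable]: "N \<in> M \<rightarrow>\<^sub>M count_space UNIV" unfolding N_def using bC by measurable
  have bCA: "bounded (A \<inter> C)" for A using bC by (rule bounded_subset) auto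
  have U_in: "U \<omega> \<in> A \<longleftrightarrow> card (S \<omega> \<inter> (A \<inter> C) \<times> {t<..t+h}) = 1" if N: "N \<omega> = 1" for \<omega> A
  proof -
    obtain u s where us: "S \<omega> \<inter> C \<times> {t<..t+h} = {(u, s)}"
      using N unfolding N_def by (metis card_1_singletonE surj_pair)
    then have U: "U \<omega> = u" using N by (simp add: U_def)
    have "S \<omega> \<inter> (A \<inter> C) \<times> {t<..t+h} = (S \<omega> \<inter> C \<times> {t<..t+h}) \<inter> A \<times> UNIV" by auto
    also have "\<dots> = (if u \<in> A then {(u, s)} else {})" unfolding us by auto
    finally show ?thesis using U by simp
  qed
  show U [measurable]: "U \<in> borel_measurable M"
  proof (rule measurableI)
    fix A :: "'a set" assume A [measurable]: "A \<in> sets borel"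
    have "{\<omega> \<in> space M. (N \<omega> = 1 \<and> card (S \<omega> \<inter> (A \<inter> C) \<times> {t<..t+h}) = 1) \<or> (N \<omega> \<noteq> 1 \<and> 0 \<in> A)} \<in> sets M"
      using bCA[of A] by measurable
    also have "{\<omega> \<in> space M. (N \<omega> = 1 \<and> card (S \<omega> \<inter> (A \<inter> C) \<times> {t<..t+h}) = 1) \<or> (N \<omega> \<noteq> 1 \<and> 0 \<in> A)}
      = U -` A \<inter> space M"
    proof (intro set_eqI)
      fix \<omega>
      show "\<omega> \<in> {\<omega> \<in> space M. (N \<omega> = 1 \<and> card (S \<omega> \<inter> (A \<inter> C) \<times> {t<..t+h}) = 1) \<or> (N \<omega> \<noteq> 1 \<and> 0 \<in> A)}
          \<longleftrightarrow> \<omega> \<in> U -` A \<inter> space M"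
        using U_in[of \<omega> A] by (cases "N \<omega> = 1") (auto simp: U_def)
    qed
    finally show "U -` A \<inter> space M \<in> sets M" .
  qed simp
  let ?c = "lam * h * exp (- (lam * (measure lborel C * h)))"
  have c: "0 \<le> ?c" using lam_pos h by simp
  have [measurable]: "{\<omega> \<in> space M. N \<omega> = 1} \<in> sets M" by measurable
  have eq: "distr (density M (\<lambda>\<omega>. ennreal (indicator {\<omega>. N \<omega> = 1} \<omega>))) borel U
    = density lborel (\<lambda>u. ennreal (?c * indicator C u))"
  proof (rule measure_eqI)
    fix A assume "A \<in> sets (distr (density M (\<lambda>\<omega>. ennreal (indicator {\<omega>. N \<omega> = 1} \<omega>))) borel U)"
    then have A [measurable]: "A \<in> sets borel" by simp
    have "emeasure (distr (density M (\<lambda>\<omega>. ennreal (indicator {\<omega>. N \<omega> = 1} \<omega>))) borel U) A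
      = (\<integral>\<^sup>+ \<omega>. ennreal (indicator {\<omega>. N \<omega> = 1} \<omega>) * indicator (U -` A \<inter> space M) \<omega> \<partial>M)"
      by (subst emeasure_distr) (auto simp: emeasure_density)
    also have "\<dots> = (\<integral>\<^sup>+ \<omega>. indicator {\<omega> \<in> space M. N \<omega> = 1 \<and> card (S \<omega> \<inter> (A \<inter> C) \<times> {t<..t+h}) = 1} \<omega> \<partial>M)"
      by (intro nn_integral_cong) (auto simp: indicator_def U_in)
    also have "\<dots> = emeasure M {\<omega> \<in> space M. N \<omega> = 1 \<and> card (S \<omega> \<inter> (A \<inter> C) \<times> {t<..t+h}) = 1}"
      using bCA[of A] by (intro nn_integral_indicator) measurable
    also have "\<dots> = ennreal (?c * measure lborel (A \<inter> C))"
      unfolding N_def emeasure_eq_measure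
      by (subst prob_one_point_in) (use bC h in auto)
    also have "\<dots> = ennreal ?c * emeasure lborel (A \<inter> C)"
      using emeasure_bounded_finite[OF bCA[of A]] c
      by (simp add: ennreal_mult emeasure_eq_ennreal_measure)
    also have "\<dots> = (\<integral>\<^sup>+ u. ennreal (?c * indicator C u) * indicator A u \<partial>lborel)"
    proof -
      have "ennreal ?c * emeasure lborel (A \<inter> C) = (\<integral>\<^sup>+ u. ennreal ?c * indicator (A \<inter> C) u \<partial>lborel)"
        by (rule nn_integral_cmult_indicator[symmetric]) simp
      also have "\<dots> = (\<integral>\<^sup>+ u. ennreal (?c * indicator C u) * indicator A u \<partial>lborel)"
        by (intro nn_integral_cong) (auto simp: indicator_def)
      finally show ?thesis .
    qed
    also have "\<dots> = emeasure (density lborel (\<lambda>u. ennreal (?c * indicator C u))) A"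
      by (simp add: emeasure_density)
    finally show "emeasure (distr (density M (\<lambda>\<omega>. ennreal (indicator {\<omega>. N \<omega> = 1} \<omega>))) borel U) A
      = emeasure (density lborel (\<lambda>u. ennreal (?c * indicator C u))) A" .
  qed simp
  have ind: "(\<lambda>\<omega>. indicator {\<omega>. N \<omega> = 1} \<omega> :: real) \<in> borel_measurable M"
    by measurable
  have "(LINT \<omega>|M. indicator {\<omega>. N \<omega> = 1} \<omega> * g (U \<omega>))
    = (LINT \<omega>|density M (\<lambda>\<omega>. ennreal (indicator {\<omega>. N \<omega> = 1} \<omega>)). g (U \<omega>))"
    using ind by (subst integral_density) auto
  also have "\<dots> = (LINT u|distr (density M (\<lambda>\<omega>. ennreal (indicator {\<omega>. N \<omega> = 1} \<omega>))) borel U. g u)"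
    by (rule integral_distr[symmetric]) auto
  also have "\<dots> = (LINT u|lborel. (?c * indicator C u) *\<^sub>R g u)"
    unfolding eq using c by (subst integral_density) auto
  also have "\<dots> = ?c * (LINT u|lborel. indicator C u * g u)"
    by (simp add: mult.assoc)
  finally show "(LINT \<omega>|M. indicator {\<omega>. N \<omega> = 1} \<omega> * g (U \<omega>))
    = ?c * (LINT u|lborel. indicator C u * g u)" .
qed

end

text \<open>
  Local functions in quantitative form: the radius of the window and the bound are explicit because
  the error terms below depend on them. Balls are enough, since a function that depends on a
  bounded set depends on every larger set.
\<close>

definition window_function :: "real \<Rightarrow> real \<Rightarrow> ('a::euclidean_space set \<Rightarrow> real) \<Rightarrow> bool" where
  "window_function R K f \<longleftrightarrow> 0 \<le> R \<and> f \<in> borel_measurable config_space \<and>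
     (\<forall>\<eta>\<in>configs. \<bar>f \<eta>\<bar> \<le> K \<and> f \<eta> = f (\<eta> \<inter> cball 0 R))"

lemma window_functionD:
  assumes "window_function R K f"
  shows "0 \<le> R" "f \<in> borel_measurable config_space" "\<And>\<eta>. \<eta> \<in> configs \<Longrightarrow> \<bar>f \<eta>\<bar> \<le> K"
    "\<And>\<eta>. \<eta> \<in> configs \<Longrightarrow> f \<eta> = f (\<eta> \<inter> cball 0 R)" "0 \<le> K"
    "\<And>\<eta> \<zeta>. \<eta> \<in> configs \<Longrightarrow> \<zeta> \<in> configs \<Longrightarrow> \<eta> \<inter> cball 0 R = \<zeta> \<inter> cball 0 R \<Longrightarrow> f \<eta> = f \<zeta>"
proof -
  show *: "0 \<le> R" "f \<in> borel_measurable config_space" "\<And>\<eta>. \<eta> \<in> configs \<Longrightarrow> \<bar>f \<eta>\<bar> \<le> K"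
    "\<And>\<eta>. \<eta> \<in> configs \<Longrightarrow> f \<eta> = f (\<eta> \<inter> cball 0 R)"
    using assms unfolding window_function_def by auto
  show "0 \<le> K" using *(3)[OF empty_in_configs] by linarith
  show "\<And>\<eta> \<zeta>. \<eta> \<in> configs \<Longrightarrow> \<zeta> \<in> configs \<Longrightarrow> \<eta> \<inter> cball 0 R = \<zeta> \<inter> cball 0 R \<Longrightarrow> f \<eta> = f \<zeta>"
    using *(4) by metis
qed

lemma window_function_imp_local: "window_function R K f \<Longrightarrow> f \<in> local_functions"
  unfolding window_function_def local_functions_def
proof (intro CollectI conjI)
  assume f: "0 \<le> R \<and> f \<in> borel_measurable config_space \<and> (\<forall>\<eta>\<in>configs. \<bar>f \<eta>\<bar> \<le> K \<and> f \<eta> = f (\<eta> \<inter> cball 0 R))"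
  then show "f \<in> borel_measurable config_space" by simp
  show "bounded (f ` configs)" unfolding bounded_iff using f by (intro exI[of _ K]) auto
  show "\<exists>\<Lambda>. bounded \<Lambda> \<and> (\<forall>\<eta>\<in>configs. f \<eta> = f (\<eta> \<inter> \<Lambda>))"
    using f by (intro exI[of _ "cball 0 R"]) simp
qed

lemma local_function_windowE:
  assumes "f \<in> local_functions"
  obtains R K where "window_function R K f"
proof -
  have f: "f \<in> borel_measurable config_space"
    using assms unfolding local_functions_def by simp
  obtain \<Lambda> where L: "bounded \<Lambda>" "\<And>\<eta>. \<eta> \<in> configs \<Longrightarrow> f \<eta> = f (\<eta> \<inter> \<Lambda>)"
    using assms unfolding local_functions_def by blast
  obtain K where K: "\<And>\<eta>. \<eta> \<in> configs \<Longrightarrow> \<bar>f \<eta>\<bar> \<le> K"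
    using assms unfolding local_functions_def bounded_iff by auto
  obtain R where R: "0 \<le> R" "\<Lambda> \<subseteq> cball 0 R"
    using bounded_subset_ballD[OF L(1), of 0] ball_subset_cball by (metis less_imp_le order_trans)
  have "f \<eta> = f (\<eta> \<inter> cball 0 R)" if "\<eta> \<in> configs" for \<eta>
  proof -
    have "\<eta> \<inter> cball 0 R \<inter> \<Lambda> = \<eta> \<inter> \<Lambda>" using R by auto
    then show ?thesis using L(2)[OF that] L(2)[OF configs_Int[OF that, of "cball 0 R"]] by simp
  qed
  then show ?thesis using that[of R K] R f K unfolding window_function_def by auto
qed

text \<open>
  The rate at which points arrive over the window of radius \<open>R + 1\<close>. The type argument only fixes the
  space in which the ball is taken.
\<close>

definition gen_bound :: "real \<Rightarrow> 'a::euclidean_space itself \<Rightarrow> real \<Rightarrow> real" where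
  "gen_bound lam _ R = lam * measure lborel (cball (0::'a) (R + 1))"

lemma gen_integrand:
  fixes f :: "'a::euclidean_space set \<Rightarrow> real"
  assumes f: "window_function R K f" and \<eta>: "\<eta> \<in> configs"
  shows "(\<lambda>u. f (arrival u \<eta>) - f \<eta>) \<in> borel_measurable borel"
    and "\<bar>f (arrival u \<eta>) - f \<eta>\<bar> \<le> 2 * K"
    and "u \<notin> cball 0 (R + 1) \<Longrightarrow> f (arrival u \<eta>) = f \<eta>"
proof -
  note w = window_functionD[OF f]
  note [measurable] = w(2)
  have [measurable]: "(\<lambda>_. \<eta>) \<in> borel \<rightarrow>\<^sub>M config_space" using \<eta> by simp
  show "(\<lambda>u. f (arrival u \<eta>) - f \<eta>) \<in> borel_measurable borel" by measurable
  show "\<bar>f (arrival u \<eta>) - f \<eta>\<bar> \<le> 2 * K"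
    using w(3)[OF \<eta>] w(3)[OF arrival_in_configs[OF \<eta>, of u]] by linarith
  assume u: "u \<notin> cball 0 (R + 1)"
  have "arrival u \<eta> \<inter> cball 0 R = \<eta> \<inter> cball 0 R"
  proof -
    have "1 < dist u x" if "norm x \<le> R" for x
      using u that norm_triangle_sub[of u x] by (simp add: dist_norm)
    then show ?thesis using u unfolding arrival_def by auto (metis not_le)
  qed
  then show "f (arrival u \<eta>) = f \<eta>" by (rule w(6)[OF arrival_in_configs[OF \<eta>] \<eta>])
qed

lemma gen_eq:
  fixes f :: "'a::euclidean_space set \<Rightarrow> real"
  assumes f: "window_function R K f" and \<eta>: "\<eta> \<in> configs"
  shows "gen lam f \<eta> = lam * (LINT u|lborel. indicator (cball 0 (R + 1)) u * (f (arrival u \<eta>) - f \<eta>))"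
  unfolding gen_def arrival_def[symmetric]
  by (intro arg_cong[where f="(*) lam"] Bochner_Integration.integral_cong)
    (auto simp: indicator_def gen_integrand(3)[OF f \<eta>])

lemma gen_bounded:
  fixes f :: "'a::euclidean_space set \<Rightarrow> real"
  assumes f: "window_function R K f" and \<eta>: "\<eta> \<in> configs" and lam: "0 \<le> lam"
  shows "\<bar>gen lam f \<eta>\<bar> \<le> 2 * gen_bound lam TYPE('a) R * K"
proof -
  let ?C = "cball (0::'a) (R + 1)"
  have fin: "emeasure lborel ?C < \<infinity>" by (rule emeasure_bounded_finite) simp
  have "\<bar>LINT u|lborel. indicator ?C u * (f (arrival u \<eta>) - f \<eta>)\<bar> \<le> (LINT u|lborel. indicator ?C u * (2 * K))"
  proof (rule integral_abs_bound_integral)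
    show "integrable lborel (\<lambda>u. indicator ?C u * (2 * K))"
      using fin by simp
    show "integrable lborel (\<lambda>u. indicator ?C u * (f (arrival u \<eta>) - f \<eta>))"
    proof (rule Bochner_Integration.integrable_bound)
      show "integrable lborel (\<lambda>u. indicator ?C u * (2 * K))"
        using fin by simp
      show "(\<lambda>u. indicator ?C u * (f (arrival u \<eta>) - f \<eta>)) \<in> borel_measurable lborel"
        using gen_integrand(1)[OF f \<eta>] by (intro borel_measurable_times borel_measurable_indicator) simp_all
    qed (use gen_integrand(2)[OF f \<eta>] window_functionD(5)[OF f] in \<open>auto simp: indicator_def\<close>)
    show "\<bar>indicator ?C u * (f (arrival u \<eta>) - f \<eta>)\<bar> \<le> indicator ?C u * (2 * K)" for u
      using gen_integrand(2)[OF f \<eta>] by (auto simp: indicator_def)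
  qed
  also have "\<dots> = 2 * K * measure lborel ?C" using fin by simp
  finally have "\<bar>gen lam f \<eta>\<bar> \<le> lam * (2 * K * measure lborel ?C)"
    unfolding gen_eq[OF f \<eta>] abs_mult using lam by (simp add: mult_left_mono)
  then show ?thesis by (simp add: gen_bound_def mult_ac)
qed

text \<open>
  An arrival changes the particles of the window in a way that depends only on the particles of the
  window. Hence the generator maps functions of a window to functions of the same window, and it is
  bounded there; this makes its exponential series converge.
\<close>

lemma gen_window_function:
  fixes f :: "'a::euclidean_space set \<Rightarrow> real"
  assumes f: "window_function R K f" and lam: "0 \<le> lam"
  shows "window_function R (2 * gen_bound lam TYPE('a) R * K) (gen lam f)"
  unfolding window_function_def
proof (intro conjI ballI)
  note w = window_functionD[OF f]
  show "0 \<le> R" by (rule w)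
  note [measurable] = w(2)
  have "(\<lambda>\<eta>. LINT u|lborel. f (arrival u \<eta>) - f \<eta>) \<in> borel_measurable config_space"
    by (rule lborel.borel_measurable_lebesgue_integral) measurable
  then show "gen lam f \<in> borel_measurable config_space"
    unfolding gen_def[abs_def] arrival_def[symmetric] by measurable
  fix \<eta> :: "'a set" assume \<eta>: "\<eta> \<in> configs"
  show "\<bar>gen lam f \<eta>\<bar> \<le> 2 * gen_bound lam TYPE('a) R * K" by (rule gen_bounded[OF f \<eta> lam])
  have \<eta>': "\<eta> \<inter> cball 0 R \<in> configs" by (rule configs_Int[OF \<eta>])
  have "f (arrival u \<eta>) = f (arrival u (\<eta> \<inter> cball 0 R))" for u
    by (rule w(6)[OF arrival_in_configs[OF \<eta>] arrival_in_configs[OF \<eta>']]) (auto simp: arrival_def)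
  then show "gen lam f \<eta> = gen lam f (\<eta> \<inter> cball 0 R)"
    unfolding gen_def arrival_def[symmetric] using w(4)[OF \<eta>] by simp
qed

context poisson_flow
begin

text \<open>
  With \<open>m\<close> the mean number of points, the probability is \<open>1 - (1 + m) exp (- m)\<close>, and
  \<open>exp (- m) \<ge> 1 - m\<close>.
\<close>

lemma prob_two_points_le:
  assumes "C \<in> sets borel" "bounded C" "0 \<le> h"
  shows "\<P>(\<omega> in M. 2 \<le> card (S \<omega> \<inter> C \<times> {r<..r + h})) \<le> (lam * (measure lborel C * h))\<^sup>2"
proof -
  let ?N = "\<lambda>\<omega>. card (S \<omega> \<inter> C \<times> {r<..r + h})" and ?m = "lam * (measure lborel C * h)"
  have b: "C \<times> {r<..r + h} \<in> sets borel" "bounded (C \<times> {r<..r + h})"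
    using assms by (auto intro!: slab_borel bounded_slab)
  note [measurable] = measurable_card_S[OF b]
  have m0: "0 \<le> ?m" using lam_pos assms(3) by simp
  have "\<P>(\<omega> in M. 2 \<le> ?N \<omega>) = 1 - \<P>(\<omega> in M. ?N \<omega> = 0 \<or> ?N \<omega> = 1)"
    by (subst prob_neg[symmetric]) (auto intro!: arg_cong[where f=prob])
  also have "\<P>(\<omega> in M. ?N \<omega> = 0 \<or> ?N \<omega> = 1) = \<P>(\<omega> in M. ?N \<omega> = 0) + \<P>(\<omega> in M. ?N \<omega> = 1)"
    by (subst finite_measure_Union[symmetric]) (auto intro!: arg_cong[where f=prob])
  also have "\<dots> = exp (- ?m) + exp (- ?m) * ?m"
    unfolding prob_card[OF b] using assms by (simp add: measure_lborel_slab)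
  also have "1 - (exp (- ?m) + exp (- ?m) * ?m) = 1 - (1 + ?m) * exp (- ?m)" by (simp add: algebra_simps)
  also have "\<dots> \<le> 1 - (1 + ?m) * (1 - ?m)"
    using m0 exp_ge_add_one_self[of "- ?m"] by (intro diff_left_mono mult_left_mono) auto
  also have "\<dots> = ?m\<^sup>2" by (simp add: algebra_simps power2_eq_square)
  finally show ?thesis .
qed

lemma integral_kernel:
  assumes "\<eta> \<in> configs" "f \<in> borel_measurable config_space"
  shows "(LINT \<zeta>|kernel r t \<eta>. f \<zeta> :: real) = (LINT \<omega>|M. f (flow (S \<omega>) r t \<eta>))"
  unfolding kernel_def by (rule integral_distr[OF measurable_flow_S[OF assms(1)] assms(2)])

text \<open>
  Split according to the number of points over the enlarged window. No point contributes nothing; one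
  point contributes \<open>h exp (- m) gen lam f \<eta>\<close>, where \<open>m\<close> is the mean number of points; two or more
  points contribute at most \<open>2 K m\<^sup>2\<close>. Replacing \<open>exp (- m)\<close> by 1 costs another \<open>2 K m\<^sup>2\<close>.
\<close>

lemma kernel_generator:
  fixes f :: "'a set \<Rightarrow> real"
  assumes f: "window_function R K f" and \<eta>: "\<eta> \<in> configs" and h: "0 \<le> h"
  shows "\<bar>(LINT \<zeta>|kernel t (t + h) \<eta>. f \<zeta>) - f \<eta> - h * gen lam f \<eta>\<bar> \<le> 4 * K * (gen_bound lam TYPE('a) R * h)\<^sup>2"
proof -
  note w = window_functionD[OF f]
  note [measurable] = w(2) measurable_flow_S[OF \<eta>]
  let ?C = "cball (0::'a) (R + 1)"
  let ?m = "gen_bound lam TYPE('a) R * h"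
  have m: "?m = lam * (measure lborel ?C * h)" by (simp add: gen_bound_def)
  have m0: "0 \<le> ?m" unfolding m using h lam_pos by simp
  define N where "N \<omega> = card (S \<omega> \<inter> ?C \<times> {t<..t+h})" for \<omega>
  have [measurable]: "N \<in> M \<rightarrow>\<^sub>M count_space UNIV"
    unfolding N_def by (rule measurable_card_S) (auto intro!: bounded_slab slab_borel)
  define U where "U \<omega> = (if N \<omega> = 1 then fst (the_elem (S \<omega> \<inter> ?C \<times> {t<..t+h})) else 0)" for \<omega>
  define g where "g u = f (arrival u \<eta>) - f \<eta>" for u
  have g [measurable]: "g \<in> borel_measurable borel"
    unfolding g_def by (rule gen_integrand(1)[OF f \<eta>])
  have U [measurable]: "U \<in> borel_measurable M"
    and one: "(LINT \<omega>|M. indicator {\<omega>. N \<omega> = 1} \<omega> * g (U \<omega>)) = lam * h * exp (- ?m) * (LINT u|lborel. indicator ?C u * g u)"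
    using integral_single_point[of ?C h g t] h unfolding U_def N_def m by auto
  have one': "(LINT \<omega>|M. indicator {\<omega>. N \<omega> = 1} \<omega> * g (U \<omega>)) = h * exp (- ?m) * gen lam f \<eta>"
    unfolding one unfolding gen_eq[OF f \<eta>] g_def by simp
  define F where "F \<omega> = f (flow (S \<omega>) t (t + h) \<eta>) - f \<eta>" for \<omega>
  have [measurable]: "F \<in> borel_measurable M" unfolding F_def by measurable
  have F_bound: "\<bar>F \<omega>\<bar> \<le> 2 * K" if "\<omega> \<in> space M" for \<omega>
    using w(3)[OF \<eta>] w(3)[OF flow_in_configs[OF S_configs[OF that] \<eta>], of t "t + h"] unfolding F_def by linarith
  have F0: "F \<omega> = 0" if \<omega>: "\<omega> \<in> space M" and N: "N \<omega> = 0" for \<omega>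
  proof -
    have "finite (S \<omega> \<inter> ?C \<times> {t<..t+h})"
      by (rule finite_configs_Int[OF S_configs[OF \<omega>] bounded_slab]) simp
    then have "S \<omega> \<inter> ?C \<times> {t<..t+h} = {}" using N by (simp add: N_def)
    from flow_no_arrival[OF this] show ?thesis
      unfolding F_def using w(6)[OF flow_in_configs[OF S_configs[OF \<omega>] \<eta>] \<eta>] by simp
  qed
  have F1: "F \<omega> = g (U \<omega>)" if \<omega>: "\<omega> \<in> space M" and N: "N \<omega> = 1" for \<omega>
  proof -
    obtain u s where us: "S \<omega> \<inter> ?C \<times> {t<..t+h} = {(u, s)}"
      using N unfolding N_def by (metis card_1_singletonE surj_pair)
    then have "U \<omega> = u" using N by (simp add: U_def)
    with flow_one_arrival[OF us] show ?thesis
      unfolding F_def g_def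
      using w(6)[OF flow_in_configs[OF S_configs[OF \<omega>] \<eta>] arrival_in_configs[OF \<eta>]] by simp
  qed
  let ?G = "\<lambda>\<omega>. indicator {\<omega>. N \<omega> = 1} \<omega> * g (U \<omega>)"
  let ?H = "\<lambda>\<omega>. indicator {\<omega>. 2 \<le> N \<omega>} \<omega> * F \<omega>"
  have K: "0 \<le> K" by (rule w(5))
  have g_bound: "\<bar>g u\<bar> \<le> 2 * K" for u
    unfolding g_def by (rule gen_integrand(2)[OF f \<eta>])
  have "?G \<in> borel_measurable M" "?H \<in> borel_measurable M" by measurable
  then have iG: "integrable M ?G" and iH: "integrable M ?H"
    using K F_bound g_bound
    by (auto intro!: integrable_const_bound[of _ "2 * K"] AE_I2 simp: abs_mult indicator_def)
  have "(LINT \<omega>|M. F \<omega>) = (LINT \<omega>|M. ?G \<omega> + ?H \<omega>)"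
  proof (rule Bochner_Integration.integral_cong[OF refl])
    fix \<omega> assume \<omega>: "\<omega> \<in> space M"
    consider "N \<omega> = 0" | "N \<omega> = 1" | "2 \<le> N \<omega>" by linarith
    then show "F \<omega> = ?G \<omega> + ?H \<omega>"
      by cases (use F0[OF \<omega>] F1[OF \<omega>] in auto)
  qed
  also have "\<dots> = h * exp (- ?m) * gen lam f \<eta> + (LINT \<omega>|M. ?H \<omega>)"
    using iG iH one' by simp
  finally have F: "(LINT \<omega>|M. F \<omega>) = h * exp (- ?m) * gen lam f \<eta> + (LINT \<omega>|M. ?H \<omega>)" .
  have "(LINT \<zeta>|kernel t (t + h) \<eta>. f \<zeta>) - f \<eta> = (LINT \<omega>|M. F \<omega>)"
  proof -
    have "integrable M (\<lambda>\<omega>. f (flow (S \<omega>) t (t + h) \<eta>))"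
      using w(3)[OF flow_in_configs[OF S_configs \<eta>]] by (intro integrable_const_bound[of _ K]) auto
    then show ?thesis unfolding F_def integral_kernel[OF \<eta> w(2)] by (simp add: prob_space)
  qed
  also have "\<dots> - h * gen lam f \<eta> = (LINT \<omega>|M. ?H \<omega>) - h * (1 - exp (- ?m)) * gen lam f \<eta>"
    unfolding F by (simp add: algebra_simps)
  finally have *: "\<bar>(LINT \<zeta>|kernel t (t + h) \<eta>. f \<zeta>) - f \<eta> - h * gen lam f \<eta>\<bar>
      \<le> \<bar>LINT \<omega>|M. ?H \<omega>\<bar> + \<bar>h * (1 - exp (- ?m)) * gen lam f \<eta>\<bar>" by linarith
  have em: "1 - exp (- ?m) \<le> ?m" "0 \<le> 1 - exp (- ?m)"
    using exp_ge_add_one_self[of "- ?m"] m0 by auto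
  have "\<bar>h * (1 - exp (- ?m)) * gen lam f \<eta>\<bar> = h * (1 - exp (- ?m)) * \<bar>gen lam f \<eta>\<bar>"
    using h em by (simp add: abs_mult)
  also have "\<dots> \<le> h * ?m * (2 * gen_bound lam TYPE('a) R * K)"
    using h em gen_bounded[OF f \<eta>, of lam] lam_pos m0 by (intro mult_mono) auto
  also have "\<dots> = 2 * K * ?m\<^sup>2" by (simp add: power2_eq_square)
  finally have 1: "\<bar>h * (1 - exp (- ?m)) * gen lam f \<eta>\<bar> \<le> 2 * K * ?m\<^sup>2" .
  have p2: "\<P>(\<omega> in M. 2 \<le> N \<omega>) \<le> ?m\<^sup>2"
    unfolding N_def m by (rule prob_two_points_le) (use h in auto)
  have "\<bar>LINT \<omega>|M. ?H \<omega>\<bar> \<le> (LINT \<omega>|M. 2 * K * indicator {\<omega> \<in> space M. 2 \<le> N \<omega>} \<omega>)"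
  proof (rule abs_integral_le)
    have [measurable]: "{\<omega> \<in> space M. 2 \<le> N \<omega>} \<in> events" by measurable
    show "integrable M (\<lambda>\<omega>. 2 * K * indicator {\<omega> \<in> space M. 2 \<le> N \<omega>} \<omega>)"
      by (intro integrable_mult_right) (simp add: less_top[symmetric])
    show "\<bar>?H \<omega>\<bar> \<le> 2 * K * indicator {\<omega> \<in> space M. 2 \<le> N \<omega>} \<omega>" if "\<omega> \<in> space M" for \<omega>
      using F_bound[OF that] that by (simp add: indicator_def)
  qed (rule iH)
  also have "\<dots> = 2 * K * \<P>(\<omega> in M. 2 \<le> N \<omega>)" by simp
  also have "\<dots> \<le> 2 * K * ?m\<^sup>2" using p2 K by (intro mult_left_mono) auto
  finally show ?thesis using * 1 by linarith
qed

end

section \<open>The generator determines the evolution\<close>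

text \<open>
  A two-parameter evolution, so that the kernels of the flow can be treated before it is known that
  they depend on the difference of the times only. The derivative is required to be uniform in the
  configuration and in the starting time.
\<close>

locale local_evolution =
  fixes Q :: "real \<Rightarrow> real \<Rightarrow> 'a::euclidean_space set \<Rightarrow> 'a set measure" and lam :: real
  assumes lam_nonneg: "0 \<le> lam"
    and kernel: "s \<le> t \<Longrightarrow> Q s t \<in> config_space \<rightarrow>\<^sub>M prob_algebra config_space"
    and start: "\<eta> \<in> configs \<Longrightarrow> Q s s \<eta> = return config_space \<eta>"
    and comp: "r \<le> s \<Longrightarrow> s \<le> t \<Longrightarrow> \<eta> \<in> configs \<Longrightarrow> Q r t \<eta> = Q r s \<eta> \<bind> Q s t"
    and derivative: "f \<in> local_functions \<Longrightarrow> 0 < \<epsilon> \<Longrightarrow> \<exists>\<delta>>0. \<forall>h s. \<forall>\<eta>\<in>configs. 0 < h \<and> h < \<delta> \<longrightarrow>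
        \<bar>(LINT \<zeta>|Q s (s + h) \<eta>. f \<zeta>) - f \<eta> - h * gen lam f \<eta>\<bar> \<le> \<epsilon> * h"
begin

definition expect :: "real \<Rightarrow> 'a set \<Rightarrow> ('a set \<Rightarrow> real) \<Rightarrow> real \<Rightarrow> real" where
  "expect s \<eta> f t = (LINT \<zeta>|Q s t \<eta>. f \<zeta>)"

lemma prob_kernel:
  assumes "s \<le> t" "\<eta> \<in> configs"
  shows "prob_space (Q s t \<eta>)" "sets (Q s t \<eta>) = sets config_space" "space (Q s t \<eta>) = configs"
proof -
  have *: "Q s t \<eta> \<in> space (prob_algebra config_space)"
    using measurable_space[OF kernel[OF assms(1)]] assms(2) by simp
  then show "prob_space (Q s t \<eta>)" and **: "sets (Q s t \<eta>) = sets config_space"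
    by (auto simp: space_prob_algebra)
  from sets_eq_imp_space_eq[OF **] show "space (Q s t \<eta>) = configs" by simp
qed

lemma borel_measurable_kernel:
  fixes f :: "'a set \<Rightarrow> real"
  assumes "s \<le> t" "\<eta> \<in> configs" "f \<in> borel_measurable config_space"
  shows "f \<in> borel_measurable (Q s t \<eta>)"
  using assms(3) unfolding measurable_cong_sets[OF prob_kernel(2)[OF assms(1,2)] refl] .

lemma integrable_kernel:
  assumes f: "window_function R K f" and "s \<le> t" "\<eta> \<in> configs"
  shows "integrable (Q s t \<eta>) f"
proof -
  interpret prob_space "Q s t \<eta>" by (rule prob_kernel(1)[OF assms(2,3)])
  note w = window_functionD[OF f]
  show ?thesis
    by (rule integrable_const_bound[of _ K])
      (use w(3) prob_kernel(3)[OF assms(2,3)] borel_measurable_kernel[OF assms(2,3) w(2)] in auto)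
qed

lemma expect_bound:
  assumes f: "window_function R K f" and st: "s \<le> t" "\<eta> \<in> configs"
  shows "\<bar>expect s \<eta> f t\<bar> \<le> K"
proof -
  interpret prob_space "Q s t \<eta>" by (rule prob_kernel(1)[OF st])
  have "\<bar>expect s \<eta> f t\<bar> \<le> (LINT \<zeta>|Q s t \<eta>. K)"
    unfolding expect_def
    by (rule abs_integral_le[OF integrable_kernel[OF f st]])
      (use window_functionD(3)[OF f] prob_kernel(3)[OF st] in auto)
  then show ?thesis by (simp add: prob_space)
qed

lemma expect_start:
  assumes f: "window_function R K f" and "\<eta> \<in> configs"
  shows "expect s \<eta> f s = f \<eta>"
  unfolding expect_def start[OF assms(2)]
  by (rule integral_return) (use assms window_functionD(2)[OF f] in auto)

lemma measurable_expect:
  assumes f: "window_function R K f" and st: "s \<le> t"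
  shows "(\<lambda>\<eta>. expect s \<eta> f t) \<in> borel_measurable config_space"
  unfolding expect_def
  using measurable_compose[OF measurable_prob_algebraD[OF kernel[OF st]] integral_measurable_subprob_algebra[OF window_functionD(2)[OF f]]]
  by simp

lemma expect_comp:
  assumes f: "window_function R K f" and st: "s \<le> t" "t \<le> u" "\<eta> \<in> configs"
  shows "expect s \<eta> f u = (LINT \<zeta>|Q s t \<eta>. expect t \<zeta> f u)"
proof -
  interpret prob_space "Q s t \<eta>" by (rule prob_kernel(1)[OF st(1,3)])
  have N: "Q t u \<in> Q s t \<eta> \<rightarrow>\<^sub>M subprob_algebra config_space"
    using measurable_prob_algebraD[OF kernel[OF st(2)]]
    unfolding measurable_cong_sets[OF prob_kernel(2)[OF st(1,3)] refl] .
  have "expect s \<eta> f u = (LINT \<zeta>|(Q s t \<eta> \<bind> Q t u). f \<zeta>)"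
    unfolding expect_def comp[OF st] ..
  also have "\<dots> = (LINT \<zeta>|Q s t \<eta>. expect t \<zeta> f u)"
    unfolding expect_def
  proof (rule integral_bind[where B = K and B' = 1, OF window_functionD(2)[OF f] _ N])
    show "finite_measure (Q s t \<eta>)" by unfold_locales
    show "AE \<zeta> in Q s t \<eta>. emeasure (Q t u \<zeta>) (space (Q t u \<zeta>)) \<le> ennreal 1"
      using prob_kernel(3)[OF st(1,3)] prob_space.emeasure_space_1[OF prob_kernel(1)[OF st(2)]] by (intro AE_I2) auto
  qed (use window_functionD(3)[OF f] in simp)
  finally show ?thesis .
qed

text \<open>
  Integrate the derivative at time \<open>t\<close> against the law at time \<open>t\<close>; uniformity of the derivative keeps
  the error bound.
\<close>

lemma expect_increment:
  assumes f: "window_function R K f" and \<epsilon>: "0 < \<epsilon>"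
  shows "\<exists>\<delta>>0. \<forall>h s t. \<forall>\<eta>\<in>configs. s \<le> t \<and> 0 < h \<and> h < \<delta> \<longrightarrow>
    \<bar>expect s \<eta> f (t + h) - expect s \<eta> f t - h * expect s \<eta> (gen lam f) t\<bar> \<le> \<epsilon> * h"
proof -
  note g = gen_window_function[OF f lam_nonneg]
  obtain \<delta> where \<delta>: "0 < \<delta>" "\<And>h s \<eta>. \<eta> \<in> configs \<Longrightarrow> 0 < h \<Longrightarrow> h < \<delta> \<Longrightarrow>
    \<bar>(LINT \<zeta>|Q s (s + h) \<eta>. f \<zeta>) - f \<eta> - h * gen lam f \<eta>\<bar> \<le> \<epsilon> * h"
    using derivative[OF window_function_imp_local[OF f] \<epsilon>] by blast
  have "\<bar>expect s \<eta> f (t + h) - expect s \<eta> f t - h * expect s \<eta> (gen lam f) t\<bar> \<le> \<epsilon> * h"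
    if st: "s \<le> t" "\<eta> \<in> configs" and h: "0 < h" "h < \<delta>" for s t \<eta> h
  proof -
    interpret prob_space "Q s t \<eta>" by (rule prob_kernel(1)[OF st])
    have th: "t \<le> t + h" using h by simp
    have i: "integrable (Q s t \<eta>) (\<lambda>\<zeta>. expect t \<zeta> f (t + h))"
      by (rule integrable_const_bound[of _ K])
        (use expect_bound[OF f th] prob_kernel(3)[OF st] borel_measurable_kernel[OF st measurable_expect[OF f th]] in auto)
    have "expect s \<eta> f (t + h) - expect s \<eta> f t - h * expect s \<eta> (gen lam f) t
      = (LINT \<zeta>|Q s t \<eta>. expect t \<zeta> f (t + h) - f \<zeta> - h * gen lam f \<zeta>)"
      unfolding expect_comp[OF f st(1) th st(2)] unfolding expect_def[of s \<eta>]
      using i integrable_kernel[OF f st] integrable_kernel[OF g st] by simp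
    also have "\<bar>\<dots>\<bar> \<le> (LINT \<zeta>|Q s t \<eta>. \<epsilon> * h)"
      by (rule abs_integral_le)
        (use i integrable_kernel[OF f st] integrable_kernel[OF g st] \<delta>(2)[OF _ h] prob_kernel(3)[OF st] in \<open>auto simp: expect_def\<close>)
    finally show ?thesis by (simp add: prob_space)
  qed
  with \<delta>(1) show ?thesis by blast
qed

text \<open>
  The hypothesis only gives right derivatives, with an error that is uniform in time. On the left of
  \<open>t\<close> one uses the increment that starts at \<open>y < t\<close>; its slope is taken at \<open>y\<close> instead of \<open>t\<close>, and the
  slope is itself Lipschitz since it is the expectation of another function of the same window.
\<close>

lemma expect_has_derivative:
  assumes f: "window_function R K f" and \<eta>: "\<eta> \<in> configs" and t: "s \<le> t"
  shows "((\<lambda>t. expect s \<eta> f t) has_field_derivative expect s \<eta> (gen lam f) t) (at t within {s..b})"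
proof -
  note g = gen_window_function[OF f lam_nonneg]
  note gg = gen_window_function[OF g lam_nonneg]
  let ?u = "expect s \<eta> f" and ?v = "expect s \<eta> (gen lam f)"
  obtain \<delta>' where \<delta>': "0 < \<delta>'" "\<And>h t. s \<le> t \<Longrightarrow> 0 < h \<Longrightarrow> h < \<delta>' \<Longrightarrow>
     \<bar>?v (t + h) - ?v t - h * expect s \<eta> (gen lam (gen lam f)) t\<bar> \<le> 1 * h"
    using expect_increment[OF g zero_less_one] \<eta> by blast
  define L where "L = 1 + 2 * gen_bound lam TYPE('a) R * (2 * gen_bound lam TYPE('a) R * K)"
  have L: "\<bar>?v (t + h) - ?v t\<bar> \<le> L * h" if "s \<le> t" "0 < h" "h < \<delta>'" for t h
  proof -
    have "\<bar>h * expect s \<eta> (gen lam (gen lam f)) t\<bar> \<le> h * (2 * gen_bound lam TYPE('a) R * (2 * gen_bound lam TYPE('a) R * K))"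
      using expect_bound[OF gg that(1) \<eta>] that(2) by (simp add: abs_mult)
    then show ?thesis using \<delta>'(2)[OF that] unfolding L_def distrib_right by (simp add: mult.commute)
  qed
  have L0: "0 < L" unfolding L_def using window_functionD(5)[OF gg] by linarith
  show ?thesis
    unfolding has_field_derivative_def has_derivative_within_alt
  proof (intro conjI allI impI bounded_linear_mult_right)
    fix e :: real assume e: "0 < e"
    obtain \<delta> where \<delta>: "0 < \<delta>" "\<And>h t. s \<le> t \<Longrightarrow> 0 < h \<Longrightarrow> h < \<delta> \<Longrightarrow> \<bar>?u (t + h) - ?u t - h * ?v t\<bar> \<le> e / 2 * h"
      using expect_increment[OF f, of "e / 2"] \<eta> e by auto
    \<comment> \<open>half of \<open>e\<close> for the increment, half for moving its slope from \<open>y\<close> to \<open>t\<close>\<close>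
    define d where "d = Min {\<delta>, \<delta>', e / (2 * L)}"
    have d: "0 < d" "d \<le> \<delta>" "d \<le> \<delta>'" "d \<le> e / (2 * L)"
      unfolding d_def using \<delta>(1) \<delta>'(1) e L0 by auto
    have "norm (?u y - ?u t - ?v t * (y - t)) \<le> e * norm (y - t)" if y: "y \<in> {s..b}" "norm (y - t) < d" for y
    proof -
      consider "y = t" | "t < y" | "y < t" by linarith
      then show ?thesis
      proof cases
        case 2
        have "\<bar>?u (t + (y - t)) - ?u t - (y - t) * ?v t\<bar> \<le> e / 2 * (y - t)"
          by (rule \<delta>(2)) (use y 2 t d in auto)
        also have "\<dots> \<le> e * (y - t)" using 2 e by simp
        finally show ?thesis using 2 by (simp add: mult.commute)
      next
        case 3
        have "\<bar>?u (y + (t - y)) - ?u y - (t - y) * ?v y\<bar> \<le> e / 2 * (t - y)"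
          by (rule \<delta>(2)) (use y 3 t d in auto)
        moreover have "\<bar>(t - y) * (?v (y + (t - y)) - ?v y)\<bar> \<le> (t - y) * (e / 2)"
        proof -
          have "\<bar>?v (y + (t - y)) - ?v y\<bar> \<le> L * (t - y)"
            by (rule L) (use y 3 t d in auto)
          also have "\<dots> \<le> L * (e / (2 * L))"
            using y 3 d L0 by (intro mult_left_mono) auto
          also have "\<dots> = e / 2" using L0 by simp
          finally show ?thesis using 3 by (simp add: abs_mult)
        qed
        moreover have "?u y - ?u t - ?v t * (y - t) =
            (t - y) * (?v (y + (t - y)) - ?v y) - (?u (y + (t - y)) - ?u y - (t - y) * ?v y)"
          by (simp add: algebra_simps)
        moreover have "e / 2 * (t - y) + (t - y) * (e / 2) = e * (t - y)" by simp
        ultimately have "\<bar>?u y - ?u t - ?v t * (y - t)\<bar> \<le> e * (t - y)"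
          by linarith
        then show ?thesis using 3 by simp
      qed simp
    qed
    with d(1) show "\<exists>d>0. \<forall>y\<in>{s..b}. norm (y - t) < d \<longrightarrow>
       norm (?u y - ?u t - ?v t * (y - t)) \<le> e * norm (y - t)" by blast
  qed
qed

lemma window_gen_power:
  fixes f :: "'a set \<Rightarrow> real"
  assumes "window_function R K f"
  shows "window_function R ((2 * gen_bound lam TYPE('a) R) ^ n * K) ((gen lam ^^ n) f)"
proof (induction n)
  case (Suc n)
  from gen_window_function[OF this lam_nonneg] show ?case by (simp add: mult_ac)
qed (use assms in simp)

text \<open>
  By the previous lemmas all derivatives exist and the one of order \<open>n\<close> is the expectation of the
  \<open>n\<close>-th power of the generator, which is bounded by the \<open>n\<close>-th power of a constant. So the remainder
  in Taylor's formula tends to 0.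
\<close>

lemma expect_series:
  assumes f: "window_function R K f" and \<eta>: "\<eta> \<in> configs" and st: "s \<le> t"
  shows "(\<lambda>n. \<Sum>i\<le>n. (gen lam ^^ i) f \<eta> * (t - s) ^ i / fact i) \<longlonglongrightarrow> expect s \<eta> f t"
proof -
  let ?B = "2 * gen_bound lam TYPE('a) R"
  let ?T = "\<lambda>n. \<Sum>i\<le>n. (gen lam ^^ i) f \<eta> * (t - s) ^ i / fact i"
  have bound: "norm (?T n - expect s \<eta> f t) \<le> (K * ?B * (t - s)) * ((?B * (t - s)) ^ n / fact n)" for n
  proof -
    have "norm (expect s \<eta> ((gen lam ^^ 0) f) t - (\<Sum>i\<le>n. expect s \<eta> ((gen lam ^^ i) f) s * (t - s) ^ i / fact i))
      \<le> (?B ^ Suc n * K) * norm (t - s) ^ Suc n / fact n"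
    proof (rule field_Taylor[where S = "{s..t}"])
      fix i x assume "x \<in> {s..t}"
      then show "(expect s \<eta> ((gen lam ^^ i) f) has_field_derivative expect s \<eta> ((gen lam ^^ Suc i) f) x) (at x within {s..t})"
        using expect_has_derivative[OF window_gen_power[OF f, of i] \<eta>, of s x t] by simp
    next
      fix x assume "x \<in> {s..t}"
      then show "norm (expect s \<eta> ((gen lam ^^ Suc n) f) x) \<le> ?B ^ Suc n * K"
        using expect_bound[OF window_gen_power[OF f, of "Suc n"] _ \<eta>] by simp
    qed (use st in auto)
    then show ?thesis
      using st by (simp add: expect_start[OF window_gen_power[OF f] \<eta>] abs_minus_commute power_mult_distrib mult.assoc mult.commute mult.left_commute)
  qed
  have "(\<lambda>n. (K * ?B * (t - s)) * ((?B * (t - s)) ^ n / fact n)) \<longlonglongrightarrow> (K * ?B * (t - s)) * 0"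
    by (intro tendsto_mult_left summable_LIMSEQ_zero)
      (use summable_exp[of "?B * (t - s)"] in \<open>simp add: divide_inverse mult.commute\<close>)
  then have lim: "(\<lambda>n. (K * ?B * (t - s)) * ((?B * (t - s)) ^ n / fact n)) \<longlonglongrightarrow> 0"
    by (simp only: mult_zero_right)
  have "(\<lambda>n. ?T n - expect s \<eta> f t) \<longlonglongrightarrow> 0"
    by (rule Lim_null_comparison[OF always_eventually lim]) (rule allI, rule bound)
  then show ?thesis by (rule LIM_zero_cancel)
qed

end

lemma prob_config_eqI:
  fixes P P' :: "'a::euclidean_space set measure"
  assumes P: "P \<in> space (prob_algebra config_space)" and P': "P' \<in> space (prob_algebra config_space)"
    and eq: "\<And>A. A \<in> count_events \<Longrightarrow> measure P A = measure P' A"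
  shows "P = P'"
proof -
  interpret P: prob_space P using P by (simp add: space_prob_algebra)
  interpret P': prob_space P' using P' by (simp add: space_prob_algebra)
  have sets: "sets P = sigma_sets configs count_events" "sets P' = sigma_sets configs count_events"
    using P P' by (auto simp: space_prob_algebra sets_config_space)
  show ?thesis
    by (rule measure_eqI_generator_eq[OF Int_stable_count_events count_events_subset _ sets, of "\<lambda>_. configs"])
      (use configs_in_count_events eq in \<open>auto simp: P.emeasure_eq_measure P'.emeasure_eq_measure\<close>)
qed

lemma count_event_local:
  assumes "A \<in> count_events"
  obtains R where "window_function R 1 (indicator A :: 'a::euclidean_space set \<Rightarrow> real)"
proof -
  obtain I where A: "A = counts_event I" and I: "finite I" "\<forall>(B, k)\<in>I. B \<in> sets borel \<and> bounded B"
    using assms unfolding count_events_def by auto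
  have "bounded (\<Union>(fst ` I))" using I by (intro bounded_Union) auto
  then obtain R where R: "0 < R" "\<Union>(fst ` I) \<subseteq> ball 0 R"
    using bounded_subset_ballD by blast
  have [measurable]: "A \<in> sets config_space" unfolding A by (rule counts_event_sets[OF I])
  have "(\<eta> \<in> A) = (\<eta> \<inter> cball 0 R \<in> A)" if \<eta>: "\<eta> \<in> configs" for \<eta>
  proof -
    have "\<eta> \<inter> cball 0 R \<inter> B = \<eta> \<inter> B" if "(B, k) \<in> I" for B k
      using R that by force
    then show ?thesis unfolding A counts_event_def using \<eta> configs_Int[OF \<eta>] by fastforce
  qed
  then have "window_function R 1 (indicator A :: 'a set \<Rightarrow> real)"
    unfolding window_function_def using R by (auto simp: indicator_def)
  then show ?thesis by (rule that)
qed

text \<open>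
  The series in \<open>expect_series\<close> mentions the evolution only through \<open>t - s\<close>, and local events
  determine a probability law on configurations.
\<close>

theorem local_evolution_unique:
  assumes Q: "local_evolution Q lam" and Q': "local_evolution Q' lam"
    and \<eta>: "\<eta> \<in> configs" and st: "s \<le> t" "t - s = t' - s'"
  shows "Q s t \<eta> = Q' s' t' \<eta>"
proof -
  interpret Q: local_evolution Q lam by (rule Q)
  interpret Q': local_evolution Q' lam by (rule Q')
  have st': "s' \<le> t'" using st by linarith
  show ?thesis
  proof (rule prob_config_eqI)
    show "Q s t \<eta> \<in> space (prob_algebra config_space)" "Q' s' t' \<eta> \<in> space (prob_algebra config_space)"
      using measurable_space[OF Q.kernel[OF st(1)]] measurable_space[OF Q'.kernel[OF st']] \<eta> by auto
    fix A :: "'a set set" assume A: "A \<in> count_events"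
    then obtain R where f: "window_function R 1 (indicator A :: 'a set \<Rightarrow> real)"
      by (rule count_event_local)
    have As: "A \<in> sets config_space" using A unfolding sets_config_space by (rule sigma_sets.Basic)
    have "Q.expect s \<eta> (indicator A) t = Q'.expect s' \<eta> (indicator A) t'"
      using Q.expect_series[OF f \<eta> st(1)] Q'.expect_series[OF f \<eta> st'] unfolding st(2)
      by (rule LIMSEQ_unique)
    moreover have "A \<inter> configs = A" using sets.sets_into_space[OF As] by auto
    ultimately show "measure (Q s t \<eta>) A = measure (Q' s' t' \<eta>) A"
      using As Q.prob_kernel[OF st(1) \<eta>] Q'.prob_kernel[OF st' \<eta>]
      unfolding Q.expect_def Q'.expect_def by simp
  qed
qed

lemma semigroup_local_evolution:
  assumes P: "transition_semigroup config_space P" "has_generator P (gen lam)" and lam: "0 \<le> lam"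
  shows "local_evolution (\<lambda>s t. P (t - s)) lam"
proof
  show "0 \<le> lam" by (rule lam)
  show "P (t - s) \<in> config_space \<rightarrow>\<^sub>M prob_algebra config_space" if "s \<le> t" for s t
    using P(1) that unfolding transition_semigroup_def by simp
  show "P (s - s) \<eta> = return config_space \<eta>" if "\<eta> \<in> configs" for s \<eta>
    using P(1) that unfolding transition_semigroup_def by simp
  show "P (t - r) \<eta> = P (s - r) \<eta> \<bind> P (t - s)" if "r \<le> s" "s \<le> t" "\<eta> \<in> configs" for r s t \<eta>
  proof -
    have "t - r = (s - r) + (t - s)" by simp
    then show ?thesis using P(1) that unfolding transition_semigroup_def
      by (metis diff_ge_0_iff_ge space_config_space)
  qed
  fix f :: "'a set \<Rightarrow> real" and \<epsilon> :: real assume f: "f \<in> local_functions" and \<epsilon>: "0 < \<epsilon>"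
  have "\<forall>\<^sub>F h in at_right 0. \<forall>\<eta>\<in>configs. dist (((LINT \<zeta>|P h \<eta>. f \<zeta>) - f \<eta>) / h) (gen lam f \<eta>) < \<epsilon>"
    using P(2) f \<epsilon> unfolding has_generator_def uniform_limit_iff by blast
  then obtain \<delta> where \<delta>: "0 < \<delta>" "\<And>h \<eta>. 0 < h \<Longrightarrow> h < \<delta> \<Longrightarrow> \<eta> \<in> configs \<Longrightarrow>
      dist (((LINT \<zeta>|P h \<eta>. f \<zeta>) - f \<eta>) / h) (gen lam f \<eta>) < \<epsilon>"
    unfolding eventually_at_right_field by auto
  have "\<bar>(LINT \<zeta>|P (s + h - s) \<eta>. f \<zeta>) - f \<eta> - h * gen lam f \<eta>\<bar> \<le> \<epsilon> * h"
    if h: "0 < h" "h < \<delta>" and \<eta>: "\<eta> \<in> configs" for h s \<eta>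
  proof -
    let ?d = "((LINT \<zeta>|P h \<eta>. f \<zeta>) - f \<eta>) / h - gen lam f \<eta>"
    have "(LINT \<zeta>|P (s + h - s) \<eta>. f \<zeta>) - f \<eta> - h * gen lam f \<eta> = h * ?d"
      using h by (simp add: field_simps)
    moreover have "\<bar>h * ?d\<bar> \<le> h * \<epsilon>"
      using \<delta>(2)[OF h \<eta>] h by (simp add: abs_mult dist_real_def)
    ultimately show ?thesis by (simp add: mult.commute)
  qed
  with \<delta>(1) show "\<exists>\<delta>>0. \<forall>h s. \<forall>\<eta>\<in>configs. 0 < h \<and> h < \<delta> \<longrightarrow>
        \<bar>(LINT \<zeta>|P (s + h - s) \<eta>. f \<zeta>) - f \<eta> - h * gen lam f \<eta>\<bar> \<le> \<epsilon> * h" by blast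
qed

context poisson_flow
begin

text \<open>
  The error of order \<open>h\<^sup>2\<close> in \<open>kernel_generator\<close> is below \<open>\<epsilon> h\<close> for small \<open>h\<close>, uniformly in time.
\<close>

lemma kernel_local_evolution: "local_evolution kernel lam"
proof
  show "0 \<le> lam" using lam_pos by simp
  fix f :: "'a set \<Rightarrow> real" and \<epsilon> :: real assume f: "f \<in> local_functions" and \<epsilon>: "0 < \<epsilon>"
  obtain R K where w: "window_function R K f" by (rule local_function_windowE[OF f])
  define c where "c = 4 * K * (gen_bound lam TYPE('a) R)\<^sup>2"
  have c: "0 \<le> c" unfolding c_def using window_functionD(5)[OF w] by simp
  have "\<bar>(LINT \<zeta>|kernel s (s + h) \<eta>. f \<zeta>) - f \<eta> - h * gen lam f \<eta>\<bar> \<le> \<epsilon> * h"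
    if h: "0 < h" "h < \<epsilon> / (c + 1)" and \<eta>: "\<eta> \<in> configs" for h s \<eta>
  proof -
    have "\<bar>(LINT \<zeta>|kernel s (s + h) \<eta>. f \<zeta>) - f \<eta> - h * gen lam f \<eta>\<bar> \<le> c * h * h"
      using kernel_generator[OF w \<eta>, of h s] h by (simp add: c_def power2_eq_square mult_ac)
    also have "\<dots> \<le> (c + 1) * (\<epsilon> / (c + 1)) * h"
      using h c by (intro mult_right_mono mult_mono) auto
    also have "\<dots> = \<epsilon> * h" using c by simp
    finally show ?thesis .
  qed
  then show "\<exists>\<delta>>0. \<forall>h s. \<forall>\<eta>\<in>configs. 0 < h \<and> h < \<delta> \<longrightarrow>
        \<bar>(LINT \<zeta>|kernel s (s + h) \<eta>. f \<zeta>) - f \<eta> - h * gen lam f \<eta>\<bar> \<le> \<epsilon> * h"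
    using \<epsilon> c by (intro exI[of _ "\<epsilon> / (c + 1)"]) auto
qed (rule measurable_kernel kernel_refl kernel_comp | assumption)+

definition semigroup :: "real \<Rightarrow> 'a set \<Rightarrow> 'a set measure" where
  "semigroup t = kernel 0 t"

lemma kernel_eq_semigroup: "\<eta> \<in> configs \<Longrightarrow> s \<le> t \<Longrightarrow> kernel s t \<eta> = semigroup (t - s) \<eta>"
  unfolding semigroup_def
  by (rule local_evolution_unique[OF kernel_local_evolution kernel_local_evolution]) auto

lemma semigroup_transition: "transition_semigroup config_space semigroup"
  unfolding transition_semigroup_def
proof (intro conjI allI impI ballI)
  fix s t :: real and \<eta> :: "'a set" assume s: "0 \<le> s" and t: "0 \<le> t" and "\<eta> \<in> space config_space"
  then have \<eta>: "\<eta> \<in> configs" by simp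
  have "semigroup (s + t) \<eta> = kernel 0 s \<eta> \<bind> kernel s (s + t)"
    unfolding semigroup_def by (rule kernel_comp[OF \<eta>]) (use s t in auto)
  also have "\<dots> = semigroup s \<eta> \<bind> semigroup t"
  proof -
    have "space (kernel 0 s \<eta>) = configs" by (simp add: kernel_def)
    then show ?thesis unfolding semigroup_def[of s]
      by (intro bind_cong) (use kernel_eq_semigroup[of _ s "s + t"] t in auto)
  qed
  finally show "semigroup (s + t) \<eta> = semigroup s \<eta> \<bind> semigroup t" .
qed (auto simp: semigroup_def kernel_refl)

lemma semigroup_generator: "has_generator semigroup (gen lam)"
  unfolding has_generator_def uniform_limit_iff
proof (intro ballI allI impI)
  fix f :: "'a set \<Rightarrow> real" and e :: real assume f: "f \<in> local_functions" and e: "0 < e"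
  interpret K: local_evolution kernel lam by (rule kernel_local_evolution)
  obtain \<delta> where \<delta>: "0 < \<delta>" "\<And>h s \<eta>. \<eta> \<in> configs \<Longrightarrow> 0 < h \<Longrightarrow> h < \<delta> \<Longrightarrow>
    \<bar>(LINT \<zeta>|kernel s (s + h) \<eta>. f \<zeta>) - f \<eta> - h * gen lam f \<eta>\<bar> \<le> e / 2 * h"
    using K.derivative[OF f, of "e / 2"] e by auto
  have "dist (((LINT \<zeta>|semigroup h \<eta>. f \<zeta>) - f \<eta>) / h) (gen lam f \<eta>) < e"
    if h: "0 < h" "h < \<delta>" and \<eta>: "\<eta> \<in> configs" for h \<eta>
  proof -
    let ?d = "((LINT \<zeta>|semigroup h \<eta>. f \<zeta>) - f \<eta>) / h - gen lam f \<eta>"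
    have "h * ?d = (LINT \<zeta>|kernel 0 (0 + h) \<eta>. f \<zeta>) - f \<eta> - h * gen lam f \<eta>"
      using h by (simp add: field_simps semigroup_def)
    then have "h * \<bar>?d\<bar> \<le> h * (e / 2)"
      using \<delta>(2)[OF \<eta> h, of 0] h by (metis abs_mult abs_of_pos mult.commute)
    then have "\<bar>?d\<bar> \<le> e / 2" using h by simp
    then show ?thesis using e by (simp add: dist_real_def)
  qed
  with \<delta>(1) show "\<forall>\<^sub>F h in at_right 0. \<forall>\<eta>\<in>configs. dist (((LINT \<zeta>|semigroup h \<eta>. f \<zeta>) - f \<eta>) / h) (gen lam f \<eta>) < e"
    unfolding eventually_at_right_field by auto
qed

text \<open>
  No semigroup other than the law of the flow has this generator; this gives all uniqueness
  statements access to the flow.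
\<close>

lemma semigroup_unique:
  assumes "transition_semigroup config_space P" "has_generator P (gen lam)" "\<eta> \<in> configs" "0 \<le> t"
  shows "P t \<eta> = semigroup t \<eta>"
proof -
  have "P (t - 0) \<eta> = kernel 0 t \<eta>"
    by (rule local_evolution_unique[OF semigroup_local_evolution[OF assms(1,2)] kernel_local_evolution])
      (use assms lam_pos in auto)
  then show ?thesis by (simp add: semigroup_def)
qed

end

section \<open>The law of a Markov process\<close>

lemma space_past [simp]: "space (past M T E Y s) = space M"
  unfolding past_def by (rule space_measure_of) auto

lemma sets_past:
  "sets (past M T E Y s) = sigma_sets (space M) {Y u -` A \<inter> space M | u A. u \<in> T \<and> u \<le> s \<and> A \<in> sets E}"
  unfolding past_def by (rule sets_measure_of) auto

lemma vimage_in_past: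
  assumes "u \<in> T" "u \<le> s" "A \<in> sets E"
  shows "{\<omega> \<in> space M. Y u \<omega> \<in> A} \<in> sets (past M T E Y s)"
proof -
  have "{\<omega> \<in> space M. Y u \<omega> \<in> A} = Y u -` A \<inter> space M" by auto
  then show ?thesis unfolding sets_past using assms by (intro sigma_sets.Basic) auto
qed

lemma measurable_past:
  assumes "u \<in> T" "u \<le> s" "Y u \<in> M \<rightarrow>\<^sub>M E"
  shows "Y u \<in> past M T E Y s \<rightarrow>\<^sub>M E"
proof (rule measurableI)
  fix A assume "A \<in> sets E"
  from vimage_in_past[OF assms(1,2) this, of M Y] show "Y u -` A \<inter> space (past M T E Y s) \<in> sets (past M T E Y s)"
    by (simp add: vimage_def Int_def conj_commute)
qed (use measurable_space[OF assms(3)] in simp)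

lemma subalgebra_past:
  assumes "\<And>u. u \<in> T \<Longrightarrow> Y u \<in> M \<rightarrow>\<^sub>M E"
  shows "subalgebra M (past M T E Y s)"
  unfolding subalgebra_def sets_past
  using assms by (auto intro!: sets.sigma_sets_subset measurable_sets)

text \<open>
  The Markov property in the form needed below: conditional expectations of events are turned into
  an identity of measures on the state space, by restricting to an event \<open>B\<close> of the past, and then
  integrated against a nonnegative function.
\<close>

lemma markov_nn_integral:
  assumes N: "prob_space N" and P: "transition_semigroup E P" and Z: "markov_process N T E P Z"
    and st: "s \<in> T" "t \<in> T" "s \<le> t" and B: "B \<in> sets (past N T E Z s)"
    and f: "f \<in> borel_measurable E"
  shows "(\<integral>\<^sup>+ \<omega>. indicator B \<omega> * f (Z t \<omega>) \<partial>N) = (\<integral>\<^sup>+ \<omega>. indicator B \<omega> * (\<integral>\<^sup>+ y. f y \<partial>P (t - s) (Z s \<omega>)) \<partial>N)"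
proof -
  interpret prob_space N by (rule N)
  have Zm [measurable]: "Z t \<in> N \<rightarrow>\<^sub>M E" "Z s \<in> N \<rightarrow>\<^sub>M E" and "\<And>u. u \<in> T \<Longrightarrow> Z u \<in> N \<rightarrow>\<^sub>M E"
    using Z st unfolding markov_process_def by auto
  from subalgebra_past[OF this(3)] interpret F: finite_measure_subalgebra N "past N T E Z s"
    by unfold_locales
  have BN [measurable]: "B \<in> sets N" using B F.subalg unfolding subalgebra_def by auto
  have Pm: "P (t - s) \<in> E \<rightarrow>\<^sub>M prob_algebra E" using P st unfolding transition_semigroup_def by auto
  note Pms = measurable_prob_algebraD[OF Pm]
  have PZ: "prob_space (P (t - s) (Z s \<omega>))" "sets (P (t - s) (Z s \<omega>)) = sets E" if "\<omega> \<in> space N" for \<omega>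
    using measurable_space[OF Pm measurable_space[OF Zm(2) that]] by (auto simp: space_prob_algebra)
  have ind: "(\<integral>\<^sup>+ \<omega>. indicator B \<omega> * indicator A (Z t \<omega>) \<partial>N) = (\<integral>\<^sup>+ \<omega>. indicator B \<omega> * emeasure (P (t - s) (Z s \<omega>)) A \<partial>N)"
    if A [measurable]: "A \<in> sets E" for A
  proof -
    let ?I = "indicator {\<omega> \<in> space N. Z t \<omega> \<in> A} :: _ \<Rightarrow> real" and ?m = "\<lambda>\<omega>. measure (P (t - s) (Z s \<omega>)) A"
    have [measurable]: "?m \<in> borel_measurable N"
      using measurable_compose[OF Zm(2) measurable_compose[OF Pms measurable_measure_subprob_algebra[OF A]]] .
    have m1: "?m \<omega> \<le> 1" if "\<omega> \<in> space N" for \<omega>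
      by (rule prob_space.prob_le_1[OF PZ(1)[OF that]])
    have iI: "integrable N ?I" by (simp add: less_top[symmetric])
    have "(LINT \<omega>:B|N. ?I \<omega>) = (LINT \<omega>:B|N. real_cond_exp N (past N T E Z s) ?I \<omega>)"
      by (rule F.real_cond_exp_intA[OF iI B])
    also have "\<dots> = (LINT \<omega>:B|N. ?m \<omega>)"
      unfolding set_lebesgue_integral_def
    proof (rule integral_cong_AE)
      have [measurable]: "real_cond_exp N (past N T E Z s) ?I \<in> borel_measurable N"
        by (rule borel_measurable_cond_exp2)
      show "(\<lambda>\<omega>. indicator B \<omega> *\<^sub>R real_cond_exp N (past N T E Z s) ?I \<omega>) \<in> borel_measurable N" by measurable
      have "AE \<omega> in N. real_cond_exp N (past N T E Z s) ?I \<omega> = ?m \<omega>"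
        by (intro Z[unfolded markov_process_def, THEN conjunct2, rule_format] st A)
      then show "AE \<omega> in N. indicator B \<omega> *\<^sub>R real_cond_exp N (past N T E Z s) ?I \<omega> = indicator B \<omega> *\<^sub>R ?m \<omega>"
        by eventually_elim simp
    qed measurable
    finally have *: "(LINT \<omega>|N. indicator B \<omega> * ?I \<omega>) = (LINT \<omega>|N. indicator B \<omega> * ?m \<omega>)"
      by (simp add: set_lebesgue_integral_def)
    have i1: "integrable N (\<lambda>\<omega>. indicator B \<omega> * ?I \<omega>)"
      by (rule integrable_const_bound[of _ 1]) (auto simp: indicator_def)
    have i2: "integrable N (\<lambda>\<omega>. indicator B \<omega> * ?m \<omega>)"
      by (rule integrable_const_bound[of _ 1]) (use m1 in \<open>auto simp: indicator_def\<close>)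
    have "(\<integral>\<^sup>+ \<omega>. indicator B \<omega> * indicator A (Z t \<omega>) \<partial>N) = (\<integral>\<^sup>+ \<omega>. ennreal (indicator B \<omega> * ?I \<omega>) \<partial>N)"
      by (intro nn_integral_cong) (auto simp: indicator_def)
    also have "\<dots> = ennreal (LINT \<omega>|N. indicator B \<omega> * ?I \<omega>)"
      by (rule nn_integral_eq_integral[OF i1]) simp
    also have "\<dots> = ennreal (LINT \<omega>|N. indicator B \<omega> * ?m \<omega>)"
      unfolding * ..
    also have "\<dots> = (\<integral>\<^sup>+ \<omega>. ennreal (indicator B \<omega> * ?m \<omega>) \<partial>N)"
      by (rule nn_integral_eq_integral[OF i2, symmetric]) simp
    also have "\<dots> = (\<integral>\<^sup>+ \<omega>. indicator B \<omega> * emeasure (P (t - s) (Z s \<omega>)) A \<partial>N)"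
      by (intro nn_integral_cong)
        (auto simp: indicator_def finite_measure.emeasure_eq_measure[OF prob_space.finite_measure[OF PZ(1)]])
    finally show ?thesis .
  qed
  let ?N = "density N (indicator B)"
  have Zd: "Z t \<in> ?N \<rightarrow>\<^sub>M E" "Z s \<in> ?N \<rightarrow>\<^sub>M E" using Zm by simp_all
  have ne: "space E \<noteq> {}" using measurable_space[OF Zm(1)] not_empty by blast
  have Pd: "P (t - s) \<in> distr ?N E (Z s) \<rightarrow>\<^sub>M subprob_algebra E" using Pms by simp
  have "distr ?N E (Z t) = distr ?N E (Z s) \<bind> P (t - s)"
  proof (rule measure_eqI)
    show "sets (distr ?N E (Z t)) = sets (distr ?N E (Z s) \<bind> P (t - s))"
      using ne measurable_space[OF Pm] by (subst sets_bind[where N=E]) (auto simp: space_prob_algebra)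
    fix A assume "A \<in> sets (distr ?N E (Z t))"
    then have A [measurable]: "A \<in> sets E" by simp
    have "emeasure (distr ?N E (Z t)) A = (\<integral>\<^sup>+ \<omega>. indicator B \<omega> * indicator A (Z t \<omega>) \<partial>N)"
    proof -
      have "emeasure (distr ?N E (Z t)) A = (\<integral>\<^sup>+ y. indicator A y \<partial>distr ?N E (Z t))" by simp
      also have "\<dots> = (\<integral>\<^sup>+ \<omega>. indicator A (Z t \<omega>) \<partial>?N)" by (rule nn_integral_distr[OF Zd(1)]) simp
      also have "\<dots> = (\<integral>\<^sup>+ \<omega>. indicator B \<omega> * indicator A (Z t \<omega>) \<partial>N)" by (rule nn_integral_density) measurable
      finally show ?thesis .
    qed
    also have "\<dots> = (\<integral>\<^sup>+ \<omega>. indicator B \<omega> * emeasure (P (t - s) (Z s \<omega>)) A \<partial>N)"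
      by (rule ind[OF A])
    also have "\<dots> = (\<integral>\<^sup>+ y. emeasure (P (t - s) y) A \<partial>distr ?N E (Z s))"
    proof -
      have [measurable]: "(\<lambda>y. emeasure (P (t - s) y) A) \<in> borel_measurable E"
        using measurable_compose[OF Pms measurable_emeasure_subprob_algebra[OF A]] .
      have "(\<integral>\<^sup>+ y. emeasure (P (t - s) y) A \<partial>distr ?N E (Z s)) = (\<integral>\<^sup>+ \<omega>. emeasure (P (t - s) (Z s \<omega>)) A \<partial>?N)"
        by (rule nn_integral_distr[OF Zd(2)]) simp
      also have "\<dots> = (\<integral>\<^sup>+ \<omega>. indicator B \<omega> * emeasure (P (t - s) (Z s \<omega>)) A \<partial>N)"
        by (rule nn_integral_density) measurable
      finally show ?thesis by simp
    qed
    also have "\<dots> = emeasure (distr ?N E (Z s) \<bind> P (t - s)) A"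
      by (rule emeasure_bind[OF _ Pd A, symmetric]) (use ne in simp)
    finally show "emeasure (distr ?N E (Z t)) A = emeasure (distr ?N E (Z s) \<bind> P (t - s)) A" .
  qed
  then have "(\<integral>\<^sup>+ y. f y \<partial>distr ?N E (Z t)) = (\<integral>\<^sup>+ y. f y \<partial>(distr ?N E (Z s) \<bind> P (t - s)))"
    by simp
  also have "\<dots> = (\<integral>\<^sup>+ y. (\<integral>\<^sup>+ z. f z \<partial>P (t - s) y) \<partial>distr ?N E (Z s))"
    by (rule nn_integral_bind[OF f Pd])
  finally have eq: "(\<integral>\<^sup>+ y. f y \<partial>distr ?N E (Z t)) = (\<integral>\<^sup>+ y. (\<integral>\<^sup>+ z. f z \<partial>P (t - s) y) \<partial>distr ?N E (Z s))" .
  note [measurable] = f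
  have Pf [measurable]: "(\<lambda>y. \<integral>\<^sup>+ z. f z \<partial>P (t - s) y) \<in> borel_measurable E"
    using measurable_compose[OF Pms nn_integral_measurable_subprob_algebra[OF f]] .
  have "(\<integral>\<^sup>+ y. f y \<partial>distr ?N E (Z t)) = (\<integral>\<^sup>+ \<omega>. f (Z t \<omega>) \<partial>?N)"
    by (rule nn_integral_distr[OF Zd(1)]) simp
  also have "\<dots> = (\<integral>\<^sup>+ \<omega>. indicator B \<omega> * f (Z t \<omega>) \<partial>N)"
    by (rule nn_integral_density) measurable
  finally have 1: "(\<integral>\<^sup>+ y. f y \<partial>distr ?N E (Z t)) = (\<integral>\<^sup>+ \<omega>. indicator B \<omega> * f (Z t \<omega>) \<partial>N)" .
  have "(\<integral>\<^sup>+ y. (\<integral>\<^sup>+ z. f z \<partial>P (t - s) y) \<partial>distr ?N E (Z s)) = (\<integral>\<^sup>+ \<omega>. (\<integral>\<^sup>+ z. f z \<partial>P (t - s) (Z s \<omega>)) \<partial>?N)"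
    by (rule nn_integral_distr[OF Zd(2)]) simp
  also have "\<dots> = (\<integral>\<^sup>+ \<omega>. indicator B \<omega> * (\<integral>\<^sup>+ z. f z \<partial>P (t - s) (Z s \<omega>)) \<partial>N)"
    by (rule nn_integral_density) measurable
  finally show ?thesis using 1 eq by simp
qed

lemma markov_marginal:
  assumes N: "prob_space N" and P: "transition_semigroup E P" and Z: "markov_process N T E P Z"
    and st: "s \<in> T" "t \<in> T" "s \<le> t"
  shows "distr N E (Z t) = distr N E (Z s) \<bind> P (t - s)"
proof -
  interpret prob_space N by (rule N)
  have Zm [measurable]: "Z t \<in> N \<rightarrow>\<^sub>M E" "Z s \<in> N \<rightarrow>\<^sub>M E"
    using Z st unfolding markov_process_def by auto
  have Pm: "P (t - s) \<in> E \<rightarrow>\<^sub>M prob_algebra E" using P st unfolding transition_semigroup_def by auto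
  have d: "distr N E (Z s) \<in> space (prob_algebra E)"
    by (simp add: space_prob_algebra prob_space_distr)
  have b: "distr N E (Z s) \<bind> P (t - s) \<in> space (prob_algebra E)"
    using measurable_space[OF measurable_bind_prob_space[OF measurable_const[OF d] Pm], of undefined "count_space UNIV"] by simp
  show ?thesis
  proof (rule measure_eqI)
    show "sets (distr N E (Z t)) = sets (distr N E (Z s) \<bind> P (t - s))"
      using b by (simp add: space_prob_algebra)
    fix A assume "A \<in> sets (distr N E (Z t))"
    then have A [measurable]: "A \<in> sets E" by simp
    have "space N \<in> sets (past N T E Z s)" using sets.top[of "past N T E Z s"] by simp
    from markov_nn_integral[OF N P Z st this, of "indicator A"]
    have "(\<integral>\<^sup>+ \<omega>. indicator A (Z t \<omega>) \<partial>N) = (\<integral>\<^sup>+ \<omega>. (\<integral>\<^sup>+ y. indicator A y \<partial>P (t - s) (Z s \<omega>)) \<partial>N)"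
      by (simp cong: nn_integral_cong)
    also have "\<dots> = (\<integral>\<^sup>+ \<omega>. emeasure (P (t - s) (Z s \<omega>)) A \<partial>N)"
      using measurable_space[OF Pm measurable_space[OF Zm(2)]]
      by (intro nn_integral_cong nn_integral_indicator) (auto simp: space_prob_algebra)
    also have "\<dots> = (\<integral>\<^sup>+ y. emeasure (P (t - s) y) A \<partial>distr N E (Z s))"
      using measurable_compose[OF measurable_prob_algebraD[OF Pm] measurable_emeasure_subprob_algebra[OF A]]
      by (intro nn_integral_distr[symmetric]) auto
    also have "\<dots> = emeasure (distr N E (Z s) \<bind> P (t - s)) A"
      by (rule emeasure_bind_prob_algebra[OF d Pm A, symmetric])
    also have "(\<integral>\<^sup>+ \<omega>. indicator A (Z t \<omega>) \<partial>N) = emeasure (distr N E (Z t)) A"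
      by (subst nn_integral_distr[symmetric, where M'=E]) auto
    finally show "emeasure (distr N E (Z t)) A = emeasure (distr N E (Z s) \<bind> P (t - s)) A" .
  qed
qed

text \<open>
  Induction on the largest time of \<open>J\<close>: conditioning on the past of that time replaces \<open>f\<close> by its
  image under the kernel and leaves a statement about the remaining times.
\<close>

lemma markov_finite_dimensional:
  fixes J :: "real set"
  assumes M: "prob_space M" and N: "prob_space N" and P: "transition_semigroup E P"
    and Y: "markov_process M UNIV E P Y" and Z: "markov_process N UNIV E P Z"
    and marg: "\<And>t. distr M E (Y t) = distr N E (Z t)"
    and J: "finite J"
  shows "f \<in> borel_measurable E \<Longrightarrow> (\<And>i. i \<in> J \<Longrightarrow> A i \<in> sets E) \<Longrightarrow> (\<And>i. i \<in> J \<Longrightarrow> i \<le> t) \<Longrightarrow>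
    (\<integral>\<^sup>+ \<omega>. indicator {\<omega> \<in> space M. \<forall>i\<in>J. Y i \<omega> \<in> A i} \<omega> * f (Y t \<omega>) \<partial>M) =
    (\<integral>\<^sup>+ \<omega>. indicator {\<omega> \<in> space N. \<forall>i\<in>J. Z i \<omega> \<in> A i} \<omega> * f (Z t \<omega>) \<partial>N)"
  using J
proof (induction J arbitrary: f t rule: finite_linorder_max_induct)
  case empty
  have Ym: "Y t \<in> M \<rightarrow>\<^sub>M E" and Zm: "Z t \<in> N \<rightarrow>\<^sub>M E"
    using Y Z unfolding markov_process_def by auto
  have "(\<integral>\<^sup>+ \<omega>. f (Y t \<omega>) \<partial>M) = (\<integral>\<^sup>+ y. f y \<partial>distr M E (Y t))"
    using empty(1) Ym by (intro nn_integral_distr[symmetric]) auto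
  also have "\<dots> = (\<integral>\<^sup>+ \<omega>. f (Z t \<omega>) \<partial>N)"
    unfolding marg using empty(1) Zm by (intro nn_integral_distr) auto
  finally show ?case by (simp cong: nn_integral_cong)
next
  case (insert b J)
  have step: "(\<integral>\<^sup>+ \<omega>. indicator {\<omega> \<in> space L. \<forall>i\<in>insert b J. X i \<omega> \<in> A i} \<omega> * f (X t \<omega>) \<partial>L) =
    (\<integral>\<^sup>+ \<omega>. indicator {\<omega> \<in> space L. \<forall>i\<in>J. X i \<omega> \<in> A i} \<omega> * (indicator (A b) (X b \<omega>) * (\<integral>\<^sup>+ y. f y \<partial>P (t - b) (X b \<omega>))) \<partial>L)"
    if L: "prob_space L" and X: "markov_process L UNIV E P X" for L :: "'z measure" and X
  proof -
    have "{\<omega> \<in> space (past L UNIV E X b). \<forall>i\<in>insert b J. X i \<omega> \<in> A i} \<in> sets (past L UNIV E X b)"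
    proof (rule sets.sets_Collect_finite_All)
      fix i assume "i \<in> insert b J"
      then show "{\<omega> \<in> space (past L UNIV E X b). X i \<omega> \<in> A i} \<in> sets (past L UNIV E X b)"
        using vimage_in_past[of i UNIV b "A i" E L X] insert.prems(2) insert.hyps(2) by force
    qed (use insert.hyps in simp)
    then have "{\<omega> \<in> space L. \<forall>i\<in>insert b J. X i \<omega> \<in> A i} \<in> sets (past L UNIV E X b)"
      by simp
    from markov_nn_integral[OF L P X _ _ _ this insert.prems(1), of t] insert.prems(3)
    have "(\<integral>\<^sup>+ \<omega>. indicator {\<omega> \<in> space L. \<forall>i\<in>insert b J. X i \<omega> \<in> A i} \<omega> * f (X t \<omega>) \<partial>L) =
     (\<integral>\<^sup>+ \<omega>. indicator {\<omega> \<in> space L. \<forall>i\<in>insert b J. X i \<omega> \<in> A i} \<omega> * (\<integral>\<^sup>+ y. f y \<partial>P (t - b) (X b \<omega>)) \<partial>L)"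
      by simp
    also have "\<dots> = (\<integral>\<^sup>+ \<omega>. indicator {\<omega> \<in> space L. \<forall>i\<in>J. X i \<omega> \<in> A i} \<omega> * (indicator (A b) (X b \<omega>) * (\<integral>\<^sup>+ y. f y \<partial>P (t - b) (X b \<omega>))) \<partial>L)"
      by (intro nn_integral_cong) (auto simp: indicator_def)
    finally show ?thesis .
  qed
  have bt: "b \<le> t" using insert.prems(3) by simp
  have Pm: "P (t - b) \<in> E \<rightarrow>\<^sub>M prob_algebra E" using P bt unfolding transition_semigroup_def by auto
  have [measurable]: "A b \<in> sets E" using insert.prems(2) by simp
  have [measurable]: "(\<lambda>y. \<integral>\<^sup>+ z. f z \<partial>P (t - b) y) \<in> borel_measurable E"
    using measurable_compose[OF measurable_prob_algebraD[OF Pm] nn_integral_measurable_subprob_algebra[OF insert.prems(1)]] .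
  have "(\<lambda>y. indicator (A b) y * (\<integral>\<^sup>+ z. f z \<partial>P (t - b) y)) \<in> borel_measurable E" by measurable
  from insert.IH[OF this, of b] insert.prems(2) insert.hyps(2) show ?case
    unfolding step[OF M Y] step[OF N Z] by (auto simp: less_imp_le)
qed

theorem markov_process_law_unique:
  fixes Y :: "real \<Rightarrow> 'w \<Rightarrow> 'a::euclidean_space set" and Z :: "real \<Rightarrow> 'v \<Rightarrow> 'a set"
  assumes M: "prob_space M" and N: "prob_space N" and P: "transition_semigroup config_space P"
    and Y: "markov_process M UNIV config_space P Y" and Z: "markov_process N UNIV config_space P Z"
    and marg: "\<And>t. distr M config_space (Y t) = distr N config_space (Z t)"
  shows "process_law M Y = process_law N Z"
proof -
  let ?E = "config_space :: 'a set measure"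
  let ?Pi = "PiM UNIV (\<lambda>_::real. ?E)"
  have meas: "(\<lambda>\<omega> t. X t \<omega>) \<in> L \<rightarrow>\<^sub>M ?Pi" if "markov_process L UNIV ?E P X" for L :: "'z measure" and X
  proof (rule measurable_PiM_single')
    show X: "(\<lambda>\<omega>. X t \<omega>) \<in> L \<rightarrow>\<^sub>M ?E" for t using that unfolding markov_process_def by simp
    show "(\<lambda>\<omega> t. X t \<omega>) \<in> space L \<rightarrow> UNIV \<rightarrow>\<^sub>E space ?E" using measurable_space[OF X] by auto
  qed
  show ?thesis
    unfolding process_law_def
  proof (rule measure_eqI_PiM_infinite)
    show "finite_measure (distr M ?Pi (\<lambda>\<omega> t. Y t \<omega>))"
      using prob_space.prob_space_distr[OF M meas[OF Y]] by (rule prob_space.finite_measure)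
    fix A and J :: "real set" assume J: "finite J" and A: "\<And>i. i \<in> J \<Longrightarrow> A i \<in> sets ?E"
    have eq: "emeasure (distr L ?Pi (\<lambda>\<omega> t. X t \<omega>)) (prod_emb UNIV (\<lambda>_. ?E) J (Pi\<^sub>E J A))
      = (\<integral>\<^sup>+ \<omega>. indicator {\<omega> \<in> space L. \<forall>i\<in>J. X i \<omega> \<in> A i} \<omega> * 1 \<partial>L)"
      if X: "markov_process L UNIV ?E P X" for L :: "'z measure" and X
    proof -
      have m: "prod_emb UNIV (\<lambda>_. ?E) J (Pi\<^sub>E J A) \<in> sets ?Pi"
        using J A by (intro sets_PiM_I) auto
      have vi: "(\<lambda>\<omega> t. X t \<omega>) -` prod_emb UNIV (\<lambda>_. ?E) J (Pi\<^sub>E J A) \<inter> space L = {\<omega> \<in> space L. \<forall>i\<in>J. X i \<omega> \<in> A i}"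
        using measurable_space[OF meas[OF X]] by (auto simp: prod_emb_def space_PiM restrict_def PiE_def Pi_def extensional_def)
      have "{\<omega> \<in> space L. \<forall>i\<in>J. X i \<omega> \<in> A i} \<in> sets L"
        using measurable_sets[OF meas[OF X] m] unfolding vi .
      then show ?thesis
        unfolding emeasure_distr[OF meas[OF X] m] vi by simp
    qed
    define t where "t = (if J = {} then 0 else Max J)"
    show "emeasure (distr M ?Pi (\<lambda>\<omega> t. Y t \<omega>)) (prod_emb UNIV (\<lambda>_. ?E) J (Pi\<^sub>E J A))
      = emeasure (distr N ?Pi (\<lambda>\<omega> t. Z t \<omega>)) (prod_emb UNIV (\<lambda>_. ?E) J (Pi\<^sub>E J A))"
      unfolding eq[OF Y] eq[OF Z]
      by (rule markov_finite_dimensional[OF M N P Y Z marg J, where f="\<lambda>_. 1" and t=t])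
        (use A J in \<open>auto simp: t_def\<close>)
  qed auto
qed

lemma markov_process_shift:
  assumes "markov_process M UNIV E P Y"
  shows "markov_process M UNIV E P (\<lambda>t. Y (t + h))"
proof -
  have past: "past M UNIV E (\<lambda>t. Y (t + h)) s = past M UNIV E Y (s + h)" for s
  proof -
    have "{Y (u + h) -` A \<inter> space M |u A. u \<in> UNIV \<and> u \<le> s \<and> A \<in> sets E}
      = {Y u -` A \<inter> space M |u A. u \<in> UNIV \<and> u \<le> s + h \<and> A \<in> sets E}" (is "?L = ?R")
    proof (intro equalityI subsetI)
      fix X assume "X \<in> ?L"
      then obtain u A where "X = Y (u + h) -` A \<inter> space M" "u \<le> s" "A \<in> sets E" by blast
      then show "X \<in> ?R" by (intro CollectI exI[of _ "u + h"] exI[of _ A]) simp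
    next
      fix X assume "X \<in> ?R"
      then obtain u A where "X = Y u -` A \<inter> space M" "u \<le> s + h" "A \<in> sets E" by blast
      then show "X \<in> ?L" by (intro CollectI exI[of _ "u - h"] exI[of _ A]) simp
    qed
    then show ?thesis unfolding past_def by simp
  qed
  show ?thesis
    unfolding markov_process_def past
  proof (intro conjI ballI impI)
    show "Y (t + h) \<in> M \<rightarrow>\<^sub>M E" for t using assms unfolding markov_process_def by auto
    fix s t :: real and A assume "s \<le> t" "A \<in> sets E"
    then have "AE \<omega> in M. real_cond_exp M (past M UNIV E Y (s + h)) (indicator {\<omega> \<in> space M. Y (t + h) \<omega> \<in> A}) \<omega>
        = measure (P ((t + h) - (s + h)) (Y (s + h) \<omega>)) A"
      by (intro assms[unfolded markov_process_def, THEN conjunct2, rule_format]) simp_all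
    then show "AE \<omega> in M. real_cond_exp M (past M UNIV E Y (s + h)) (indicator {\<omega> \<in> space M. Y (t + h) \<omega> \<in> A}) \<omega>
        = measure (P (t - s) (Y (s + h) \<omega>)) A"
      by simp
  qed
qed

lemma markov_process_cong:
  assumes "markov_process M T E P Y" and "\<And>x t. x \<in> space E \<Longrightarrow> 0 \<le> t \<Longrightarrow> P t x = P' t x"
  shows "markov_process M T E P' Y"
  unfolding markov_process_def
proof (intro conjI ballI impI)
  show "Y t \<in> M \<rightarrow>\<^sub>M E" if "t \<in> T" for t using assms(1) that unfolding markov_process_def by auto
  fix s t A assume st: "s \<in> T" "t \<in> T" "s \<le> t" "A \<in> sets E"
  have Ys: "Y s \<in> M \<rightarrow>\<^sub>M E" using assms(1) st unfolding markov_process_def by auto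
  have "AE \<omega> in M. real_cond_exp M (past M T E Y s) (indicator {\<omega> \<in> space M. Y t \<omega> \<in> A}) \<omega> = measure (P (t - s) (Y s \<omega>)) A"
    by (intro assms(1)[unfolded markov_process_def, THEN conjunct2, rule_format] st)
  with AE_space show "AE \<omega> in M. real_cond_exp M (past M T E Y s) (indicator {\<omega> \<in> space M. Y t \<omega> \<in> A}) \<omega> = measure (P' (t - s) (Y s \<omega>)) A"
  proof eventually_elim
    case (elim \<omega>)
    then show ?case using assms(2)[OF measurable_space[OF Ys elim(1)], of "t - s"] st by simp
  qed
qed

section \<open>Loss of memory and the invariant law\<close>

text \<open>
  A point outside a null set escapes from some member of a sequence of events whose probabilities
  tend to 0. Recurrence, distinct times and the absence of explosions are obtained in this way.
\<close>

lemma (in prob_space) AE_escape: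
  fixes E :: "nat \<Rightarrow> 'a set"
  assumes E [measurable]: "\<And>m. E m \<in> events" and lim: "(\<lambda>m. prob (E m)) \<longlonglongrightarrow> 0"
  shows "AE \<omega> in M. \<exists>m. \<omega> \<notin> E m"
proof -
  have "prob (\<Inter>m. E m) \<le> prob (E n)" for n
    by (intro finite_measure_mono) auto
  then have "prob (\<Inter>m. E m) \<le> 0"
    by (intro LIMSEQ_le_const[OF lim]) auto
  then have "prob (\<Inter>m. E m) = 0" using measure_nonneg[of M "\<Inter>m. E m"] by linarith
  then have "(\<Inter>m. E m) \<in> null_sets M"
    by (intro null_setsI) (auto simp: emeasure_eq_measure)
  then show ?thesis by (rule AE_I') auto
qed

lemma (in prob_space) abs_prob_diff_le:
  assumes [measurable]: "{\<omega> \<in> space M. P \<omega>} \<in> events" "{\<omega> \<in> space M. Q \<omega>} \<in> events" "E \<in> events"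
    and eq: "\<And>\<omega>. \<omega> \<in> space M \<Longrightarrow> \<omega> \<notin> E \<Longrightarrow> P \<omega> \<longleftrightarrow> Q \<omega>"
  shows "\<bar>\<P>(\<omega> in M. P \<omega>) - \<P>(\<omega> in M. Q \<omega>)\<bar> \<le> prob E"
proof -
  have *: "\<P>(\<omega> in M. P \<omega>) \<le> \<P>(\<omega> in M. Q \<omega>) + prob E"
    if [measurable]: "{\<omega> \<in> space M. Q \<omega>} \<in> events" and "\<And>\<omega>. \<omega> \<in> space M \<Longrightarrow> \<omega> \<notin> E \<Longrightarrow> P \<omega> \<Longrightarrow> Q \<omega>" for P Q
  proof -
    have "\<P>(\<omega> in M. P \<omega>) \<le> prob ({\<omega> \<in> space M. Q \<omega>} \<union> E)"
      by (intro finite_measure_mono) (use that in auto)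
    also have "\<dots> \<le> \<P>(\<omega> in M. Q \<omega>) + prob E" by (rule measure_Un_le) auto
    finally show ?thesis .
  qed
  show ?thesis using *[of Q P] *[of P Q] eq assms by fastforce
qed

text \<open>
  A fixed countable dense set. Balls of radius 1/2 around its points cover the space, and any two
  points of one such ball are at distance less than 1, so one arrival in it clears it completely.
\<close>

definition sites :: "'a::euclidean_space set" where
  "sites = (SOME D. countable D \<and> (\<forall>X. open X \<and> X \<noteq> {} \<longrightarrow> (\<exists>d\<in>D. d \<in> X)))"

lemma sites: "countable (sites :: 'a::euclidean_space set)" "\<exists>d\<in>sites. (x :: 'a) \<in> ball d (1/2)"
proof -
  obtain D :: "'a set" where "countable D" "\<And>X. open X \<Longrightarrow> X \<noteq> {} \<Longrightarrow> \<exists>d\<in>D. d \<in> X"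
    using countable_dense_setE by blast
  then have "\<exists>D :: 'a set. countable D \<and> (\<forall>X. open X \<and> X \<noteq> {} \<longrightarrow> (\<exists>d\<in>D. d \<in> X))" by blast
  from someI_ex[OF this] have *: "countable (sites :: 'a set)" "\<And>X. open X \<Longrightarrow> X \<noteq> {} \<Longrightarrow> \<exists>d\<in>sites. d \<in> (X :: 'a set)"
    unfolding sites_def by auto
  show "countable (sites :: 'a set)" by (rule *(1))
  have "\<exists>d\<in>sites. d \<in> ball x (1/2)" by (rule *(2)) auto
  then show "\<exists>d\<in>sites. x \<in> ball d (1/2)" by (simp add: dist_commute)
qed

lemma finite_sites_cover:
  obtains F where "finite F" "F \<subseteq> sites" "cball (0::'a::euclidean_space) R \<subseteq> (\<Union>d\<in>F. ball d (1/2))"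
proof -
  have "cball (0::'a) R \<subseteq> (\<Union>d\<in>sites. ball d (1/2))" using sites(2) by blast
  then obtain F where "F \<subseteq> sites" "finite F" "cball (0::'a) R \<subseteq> (\<Union>d\<in>F. ball d (1/2))"
    by (rule compactE_image[OF compact_cball, rotated]) auto
  then show ?thesis by (intro that[of F])
qed

text \<open>
  If every place of the window is covered by some arrival then no initial particle survives there.
\<close>

lemma flow_forget:
  assumes "\<And>x. norm x \<le> R \<Longrightarrow> \<exists>u q. (u, q) \<in> S \<and> r < q \<and> q \<le> t \<and> dist x u \<le> 1"
  shows "flow S r t \<eta> \<inter> cball 0 R = flow S r t \<eta>' \<inter> cball 0 R"
proof -
  have "\<not> clear S x r t" if "norm x \<le> R" for x
    using assms[OF that] unfolding clear_def by (meson not_less)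
  then show ?thesis unfolding flow_def by auto
qed

lemma flow_forget_sites:
  assumes F: "cball 0 R \<subseteq> (\<Union>d\<in>F. ball d (1/2))"
    and hit: "\<And>d. d \<in> F \<Longrightarrow> S \<inter> ball d (1/2) \<times> {r<..t} \<noteq> {}"
  shows "flow S r t \<eta> \<inter> cball 0 R = flow S r t \<eta>' \<inter> cball 0 R"
proof (rule flow_forget)
  fix x :: 'a assume "norm x \<le> R"
  then obtain d where d: "d \<in> F" "x \<in> ball d (1/2)" using F by (meson UN_E mem_cball_0 subsetD)
  obtain u q where u: "(u, q) \<in> S" "u \<in> ball d (1/2)" "r < q" "q \<le> t" using hit[OF d(1)] by auto
  have "dist x u \<le> dist x d + dist d u" by (rule dist_triangle)
  then have "dist x u \<le> 1" using u(2) d(2) by (simp add: dist_commute)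
  then show "\<exists>u q. (u, q) \<in> S \<and> r < q \<and> q \<le> t \<and> dist x u \<le> 1" using u by blast
qed

text \<open>
  This condition concerns the distant past only: it does not change when the points after some time
  are removed. This is what keeps \<open>stat\<close> below adapted to the past.
\<close>

definition recurrent_past :: "('a::euclidean_space \<times> real) set \<Rightarrow> bool" where
  "recurrent_past S \<longleftrightarrow> (\<forall>d\<in>sites. \<forall>n::nat. \<exists>u q. (u, q) \<in> S \<and> u \<in> ball d (1/2) \<and> q \<le> - real n)"

definition recurrent_future :: "('a::euclidean_space \<times> real) set \<Rightarrow> bool" where
  "recurrent_future S \<longleftrightarrow> (\<forall>d\<in>sites. \<forall>n::nat. \<exists>u q. (u, q) \<in> S \<and> u \<in> ball d (1/2) \<and> real n < q)"

text \<open>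
  Without recurrence \<open>alive S t\<close> need not be locally finite; the empty configuration is used on that
  null event.
\<close>

definition stat :: "('a::euclidean_space \<times> real) set \<Rightarrow> real \<Rightarrow> 'a set" where
  "stat S t = (if recurrent_past S then alive S t else {})"

text \<open>
  By recurrence each of the finitely many balls that cover the window has been hit after some time in
  the past, and from then on the flow has forgotten what preceded.
\<close>

lemma alive_window:
  assumes S: "recurrent_past S"
  obtains m :: nat where "\<And>n. m \<le> n \<Longrightarrow> alive S t \<inter> cball 0 R = flow S (t - real n) t {} \<inter> cball 0 R"
proof -
  obtain F where F: "finite F" "F \<subseteq> sites" "cball (0::'a) R \<subseteq> (\<Union>d\<in>F. ball d (1/2))"
    by (rule finite_sites_cover)
  obtain k :: nat where k: "- t \<le> k" using real_arch_simple by blast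
  have "\<exists>m::nat. S \<inter> ball d (1/2) \<times> {t - real m<..t} \<noteq> {}" if "d \<in> F" for d
  proof -
    have "d \<in> sites" using F(2) that by blast
    then obtain u q where u: "(u, q) \<in> S" "u \<in> ball d (1/2)" "q \<le> - real k"
      using S[unfolded recurrent_past_def] by meson
    obtain m :: nat where "t - q < m" using reals_Archimedean2 by blast
    then have "(u, q) \<in> S \<inter> ball d (1/2) \<times> {t - real m<..t}" using u k by auto
    then show ?thesis by blast
  qed
  then obtain m :: "'a \<Rightarrow> nat" where m: "\<And>d. d \<in> F \<Longrightarrow> S \<inter> ball d (1/2) \<times> {t - real (m d)<..t} \<noteq> {}"
    by metis
  define m' where "m' = Max (insert 0 (m ` F))"
  have m': "m d \<le> m'" if "d \<in> F" for d unfolding m'_def using F(1) that by (intro Max_ge) auto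
  show ?thesis
  proof (rule that[of m'])
    fix n assume n: "m' \<le> n"
    have "alive S t \<inter> cball 0 R = flow S (t - real n) t (alive S (t - real n)) \<inter> cball 0 R"
      by (simp add: flow_alive)
    also have "\<dots> = flow S (t - real n) t {} \<inter> cball 0 R"
    proof (rule flow_forget_sites[where F=F])
      fix d assume d: "d \<in> F"
      have "ball d (1/2) \<times> {t - real (m d)<..t} \<subseteq> ball d (1/2) \<times> {t - real n<..t}"
        using m'[OF d] n by auto
      then show "S \<inter> ball d (1/2) \<times> {t - real n<..t} \<noteq> {}" using m[OF d] by blast
    qed (rule F(3))
    finally show "alive S t \<inter> cball 0 R = flow S (t - real n) t {} \<inter> cball 0 R" .
  qed
qed

lemma stat_in_configs:
  assumes S: "S \<in> configs" shows "stat S t \<in> configs"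
proof (cases "recurrent_past S")
  case True
  have "finite (alive S t \<inter> B)" if B: "bounded B" for B
  proof -
    obtain R where R: "B \<subseteq> cball 0 R" using bounded_subset_ballD[OF B, of 0] ball_subset_cball by (metis order_trans)
    obtain m where "\<And>n. m \<le> n \<Longrightarrow> alive S t \<inter> cball 0 R = flow S (t - real n) t {} \<inter> cball 0 R"
      using alive_window[OF True] by blast
    from this[of m] have "finite (alive S t \<inter> cball 0 R)"
      using card_flow(1)[OF S empty_in_configs, of "cball 0 R"] by simp
    then show ?thesis by (rule rev_finite_subset) (use R in blast)
  qed
  then show ?thesis using True unfolding stat_def configs_def by simp
qed (simp add: stat_def)

lemma recurrent_past_sets [measurable]:
  "Measurable.pred config_space (recurrent_past :: ('a::euclidean_space \<times> real) set \<Rightarrow> bool)"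
proof -
  let ?D = "\<lambda>d n m. ball (d::'a) (1/2) \<times> {- real n - real m<..- real n}"
  have [measurable]: "(\<lambda>S. card (S \<inter> ?D d n m)) \<in> config_space \<rightarrow>\<^sub>M count_space UNIV" for d n m
    by (rule measurable_card_Int) (auto intro!: bounded_slab borel_Times)
  have "Measurable.pred config_space (\<lambda>S. \<forall>d\<in>sites. \<forall>n. \<exists>m. card (S \<inter> ?D d n m) \<noteq> 0)"
    unfolding pred_def by (intro sets.sets_Collect_countable_All' sites) measurable
  then show ?thesis
  proof (rule measurable_cong[THEN iffD1, rotated])
    fix S :: "('a \<times> real) set" assume "S \<in> space config_space"
    then have S: "S \<in> configs" by simp
    have "(\<exists>m. card (S \<inter> ?D d n m) \<noteq> 0) \<longleftrightarrow> (\<exists>u q. (u, q) \<in> S \<and> u \<in> ball d (1/2) \<and> q \<le> - real n)" for d n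
    proof
      assume "\<exists>m. card (S \<inter> ?D d n m) \<noteq> 0"
      then obtain m where "S \<inter> ?D d n m \<noteq> {}" by force
      then show "\<exists>u q. (u, q) \<in> S \<and> u \<in> ball d (1/2) \<and> q \<le> - real n" by auto
    next
      assume "\<exists>u q. (u, q) \<in> S \<and> u \<in> ball d (1/2) \<and> q \<le> - real n"
      then obtain u q where u: "(u, q) \<in> S" "u \<in> ball d (1/2)" "q \<le> - real n" by blast
      obtain m :: nat where "- real n - q < m" using reals_Archimedean2 by blast
      then have "(u, q) \<in> S \<inter> ?D d n m" using u by auto
      moreover have "finite (S \<inter> ?D d n m)" by (rule finite_configs_Int[OF S bounded_slab]) simp
      ultimately have "card (S \<inter> ?D d n m) \<noteq> 0" by (auto simp: card_eq_0_iff)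
      then show "\<exists>m. card (S \<inter> ?D d n m) \<noteq> 0" ..
    qed
    then show "(\<forall>d\<in>sites. \<forall>n. \<exists>m. card (S \<inter> ?D d n m) \<noteq> 0) = recurrent_past S"
      unfolding recurrent_past_def by simp
  qed
qed

lemma measurable_stat: "(\<lambda>S. stat S t) \<in> config_space \<rightarrow>\<^sub>M (config_space :: 'a::euclidean_space set measure)"
proof (rule measurable_configI)
  show "stat S t \<in> configs" if "S \<in> space config_space" for S :: "('a \<times> real) set"
    using that by (simp add: stat_in_configs)
  fix B :: "'a set" assume B: "B \<in> sets borel" "bounded B"
  obtain R where R: "B \<subseteq> cball 0 R" using bounded_subset_ballD[OF B(2), of 0] ball_subset_cball by (metis order_trans)
  let ?f = "\<lambda>n S. if recurrent_past S then real (card (flow S (t - real n) t {} \<inter> B)) else 0"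
  have [measurable]: "(\<lambda>S. card (flow S (t - real n) t ({} :: 'a set) \<inter> B)) \<in> config_space \<rightarrow>\<^sub>M count_space UNIV" for n
    by (rule measurable_compose[OF measurable_flow measurable_card_Int[OF B]]) simp_all
  have "(\<lambda>S. real (card (stat S t \<inter> B))) \<in> borel_measurable config_space"
  proof (rule borel_measurable_LIMSEQ_real)
    show "?f n \<in> borel_measurable config_space" for n by measurable
    fix S :: "('a \<times> real) set"
    show "(\<lambda>n. ?f n S) \<longlonglongrightarrow> real (card (stat S t \<inter> B))"
    proof (cases "recurrent_past S")
      case True
      obtain m where m: "\<And>n. m \<le> n \<Longrightarrow> alive S t \<inter> cball 0 R = flow S (t - real n) t {} \<inter> cball 0 R"
        using alive_window[OF True] by blast
      have "flow S (t - real n) t {} \<inter> B = alive S t \<inter> B" if "m \<le> n" for n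
        using m[OF that] R by blast
      then have "\<forall>\<^sub>F n in sequentially. ?f n S = real (card (stat S t \<inter> B))"
        using True by (auto simp: stat_def eventually_sequentially intro!: exI[of _ m])
      then show ?thesis by (rule tendsto_eventually)
    qed (simp add: stat_def)
  qed
  then have "(\<lambda>S. ennreal (real (card (stat S t \<inter> B)))) \<in> borel_measurable config_space" by measurable
  then show "(\<lambda>S. card (stat S t \<inter> B)) \<in> config_space \<rightarrow>\<^sub>M count_space UNIV"
    by (intro measurable_ennreal_nat_count) (simp add: ennreal_of_nat_eq_real_of_nat)
qed

lemma recurrent_past_Int: "recurrent_past (S \<inter> (UNIV \<times> {..s})) \<longleftrightarrow> recurrent_past S"
proof
  assume S: "recurrent_past S"
  show "recurrent_past (S \<inter> (UNIV \<times> {..s}))"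
    unfolding recurrent_past_def
  proof (intro ballI allI)
    fix d :: 'a and n :: nat assume d: "d \<in> sites"
    obtain k :: nat where k: "- s \<le> k" using real_arch_simple by blast
    obtain u q where "(u, q) \<in> S" "u \<in> ball d (1/2)" "q \<le> - real (max k n)"
      using S[unfolded recurrent_past_def] d by meson
    then show "\<exists>u q. (u, q) \<in> S \<inter> (UNIV \<times> {..s}) \<and> u \<in> ball d (1/2) \<and> q \<le> - real n"
      using k by (intro exI[of _ u] exI[of _ q]) (auto simp: of_nat_max)
  qed
qed (unfold recurrent_past_def Int_iff, meson)

lemma stat_past: "u \<le> s \<Longrightarrow> stat (S \<inter> (UNIV \<times> {..s})) u = stat S u"
  unfolding stat_def recurrent_past_Int
  by (cases "recurrent_past S") (auto intro!: alive_cong)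

context poisson_flow
begin

lemma prob_miss:
  assumes "0 \<le> h"
  shows "{\<omega> \<in> space M. S \<omega> \<inter> ball d (1/2) \<times> {r<..r + h} = {}} \<in> events"
    and "\<P>(\<omega> in M. S \<omega> \<inter> ball d (1/2) \<times> {r<..r + h} = {}) = exp (- (lam * measure lborel (ball d (1/2)))) powr h"
proof -
  have eq: "{\<omega> \<in> space M. S \<omega> \<inter> ball d (1/2) \<times> {r<..r + h} = {}} = {\<omega> \<in> space M. card (S \<omega> \<inter> ball d (1/2) \<times> {r<..r + h}) = 0}"
    using finite_configs_Int[OF S_configs bounded_slab[OF bounded_ball]] by (auto simp: card_eq_0_iff)
  have b: "ball d (1/2) \<times> {r<..r + h} \<in> sets borel" "bounded (ball d (1/2) \<times> {r<..r + h})"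
    by (auto intro!: slab_borel bounded_slab)
  note [measurable] = measurable_card_S[OF b]
  show "{\<omega> \<in> space M. S \<omega> \<inter> ball d (1/2) \<times> {r<..r + h} = {}} \<in> events"
    unfolding eq by measurable
  show "\<P>(\<omega> in M. S \<omega> \<inter> ball d (1/2) \<times> {r<..r + h} = {}) = exp (- (lam * measure lborel (ball d (1/2)))) powr h"
    unfolding eq prob_card[OF b] by (simp add: measure_lborel_slab assms powr_def mult_ac)
qed

lemma miss_lim: "(\<lambda>n. exp (- (lam * measure lborel (ball (d::'a) (1/2)))) powr real n) \<longlonglongrightarrow> 0"
proof -
  have "0 < lam * measure lborel (ball d (1/2))" using lam_pos content_ball_pos[of "1/2" d] by simp
  then have "(\<lambda>n. exp (- (lam * measure lborel (ball d (1/2)))) ^ n) \<longlonglongrightarrow> 0"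
    by (intro LIMSEQ_realpow_zero) auto
  then show ?thesis by (simp add: powr_realpow)
qed

lemma AE_recurrent_past: "AE \<omega> in M. recurrent_past (S \<omega>)"
  unfolding recurrent_past_def
proof (intro AE_ball_countable[THEN iffD2] sites ballI AE_all_countable[THEN iffD2] allI)
  fix d :: 'a and n :: nat
  have "AE \<omega> in M. \<exists>m::nat. \<omega> \<notin> {\<omega> \<in> space M. S \<omega> \<inter> ball d (1/2) \<times> {(- real n - real m)<..(- real n - real m) + real m} = {}}"
    by (rule AE_escape; (rule prob_miss(1), simp)?) (unfold prob_miss(2)[OF of_nat_0_le_iff], rule miss_lim)
  with AE_space show "AE \<omega> in M. \<exists>u q. (u, q) \<in> S \<omega> \<and> u \<in> ball d (1/2) \<and> q \<le> - real n"
    by eventually_elim auto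
qed

lemma AE_recurrent_future: "AE \<omega> in M. recurrent_future (S \<omega>)"
  unfolding recurrent_future_def
proof (intro AE_ball_countable[THEN iffD2] sites ballI AE_all_countable[THEN iffD2] allI)
  fix d :: 'a and n :: nat
  have "AE \<omega> in M. \<exists>m::nat. \<omega> \<notin> {\<omega> \<in> space M. S \<omega> \<inter> ball d (1/2) \<times> {real n<..real n + real m} = {}}"
    by (rule AE_escape; (rule prob_miss(1), simp)?) (unfold prob_miss(2)[OF of_nat_0_le_iff], rule miss_lim)
  with AE_space show "AE \<omega> in M. \<exists>u q. (u, q) \<in> S \<omega> \<and> u \<in> ball d (1/2) \<and> real n < q"
    by eventually_elim auto
qed

text \<open>
  The exceptional event is that one of the finitely many balls covering the window is missed during
  \<open>(t - n, t]\<close>. Its probability decays exponentially in \<open>n\<close>, uniformly in \<open>t\<close>.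
\<close>

lemma coupling:
  obtains \<epsilon> :: "nat \<Rightarrow> real" where "\<epsilon> \<longlonglongrightarrow> 0"
    and "\<And>t n. \<exists>E\<in>events. prob E \<le> \<epsilon> n \<and> (\<forall>\<omega>\<in>space M - E. \<forall>\<eta> \<eta>'.
        flow (S \<omega>) (t - real n) t \<eta> \<inter> cball 0 R = flow (S \<omega>) (t - real n) t \<eta>' \<inter> cball 0 R)"
proof -
  obtain F where F: "finite F" "F \<subseteq> sites" "cball (0::'a) R \<subseteq> (\<Union>d\<in>F. ball d (1/2))"
    by (rule finite_sites_cover)
  define \<epsilon> where "\<epsilon> n = (\<Sum>d\<in>F. exp (- (lam * measure lborel (ball d (1/2)))) powr real n)" for n
  show ?thesis
  proof (rule that[of \<epsilon>])
    have "(\<lambda>n. \<Sum>d\<in>F. exp (- (lam * measure lborel (ball d (1/2)))) powr real n) \<longlonglongrightarrow> (\<Sum>d\<in>F. 0)"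
      by (intro tendsto_sum miss_lim)
    then show "\<epsilon> \<longlonglongrightarrow> 0" unfolding \<epsilon>_def by simp
    fix t :: real and n :: nat
    let ?miss = "\<lambda>d. {\<omega> \<in> space M. S \<omega> \<inter> ball d (1/2) \<times> {t - real n<..t} = {}}"
    have miss: "?miss d \<in> events" "prob (?miss d) = exp (- (lam * measure lborel (ball d (1/2)))) powr real n" for d
      using prob_miss[of "real n" d "t - real n"] by auto
    show "\<exists>E\<in>events. prob E \<le> \<epsilon> n \<and> (\<forall>\<omega>\<in>space M - E. \<forall>\<eta> \<eta>'.
        flow (S \<omega>) (t - real n) t \<eta> \<inter> cball 0 R = flow (S \<omega>) (t - real n) t \<eta>' \<inter> cball 0 R)"
    proof (intro bexI[of _ "\<Union>d\<in>F. ?miss d"] conjI ballI allI)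
      show "prob (\<Union>d\<in>F. ?miss d) \<le> \<epsilon> n"
        unfolding \<epsilon>_def miss(2)[symmetric]
        by (rule finite_measure_subadditive_finite[OF F(1)]) (use miss(1) in auto)
      show "flow (S \<omega>) (t - real n) t \<eta> \<inter> cball 0 R = flow (S \<omega>) (t - real n) t \<eta>' \<inter> cball 0 R"
        if "\<omega> \<in> space M - (\<Union>d\<in>F. ?miss d)" for \<omega> \<eta> \<eta>'
        by (rule flow_forget_sites[where F=F]) (use F(3) that in auto)
    qed (use F(1) miss(1) in auto)
  qed
qed

lemma measure_semigroup:
  assumes \<eta>: "\<eta> \<in> configs" and A: "A \<in> sets config_space"
  shows "measure (semigroup (real n) \<eta>) A = \<P>(\<omega> in M. flow (S \<omega>) (t - real n) t \<eta> \<in> A)"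
proof -
  have "semigroup (real n) \<eta> = kernel (t - real n) t \<eta>"
    using kernel_eq_semigroup[OF \<eta>, of "t - real n" t] by simp
  also have "measure \<dots> A = \<P>(\<omega> in M. flow (S \<omega>) (t - real n) t \<eta> \<in> A)"
    unfolding kernel_def by (subst measure_distr[OF measurable_flow_S[OF \<eta>] A]) (simp add: vimage_def Int_def conj_commute)
  finally show ?thesis .
qed

lemma measurable_stat_S [measurable]: "(\<lambda>\<omega>. stat (S \<omega>) t) \<in> M \<rightarrow>\<^sub>M config_space"
  by (rule measurable_compose[OF measurable_S measurable_stat])

text \<open>
  Both the flow from \<open>\<eta>\<close> and the process from time minus infinity agree in the window with the flow
  from the empty configuration, outside the exceptional event of the coupling.
\<close>

lemma semigroup_forgets:
  assumes A: "A \<in> count_events"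
  obtains \<epsilon> :: "nat \<Rightarrow> real" where "\<epsilon> \<longlonglongrightarrow> 0"
    "\<And>n \<eta>. \<eta> \<in> configs \<Longrightarrow> \<bar>measure (semigroup (real n) \<eta>) A - measure (semigroup (real n) {}) A\<bar> \<le> \<epsilon> n"
    "\<And>n t. \<bar>measure (distr M config_space (\<lambda>\<omega>. stat (S \<omega>) t)) A - measure (semigroup (real n) {}) A\<bar> \<le> \<epsilon> n"
proof -
  have As [measurable]: "A \<in> sets config_space" using A unfolding sets_config_space by (rule sigma_sets.Basic)
  obtain R where w: "window_function R 1 (indicator A :: 'a set \<Rightarrow> real)" by (rule count_event_local[OF A])
  have loc: "\<eta> \<in> A \<longleftrightarrow> \<zeta> \<in> A" if "\<eta> \<in> configs" "\<zeta> \<in> configs" "\<eta> \<inter> cball 0 R = \<zeta> \<inter> cball 0 R" for \<eta> \<zeta>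
    using window_functionD(6)[OF w that] by (auto simp: indicator_def split: if_splits)
  obtain \<epsilon> where \<epsilon>: "\<epsilon> \<longlonglongrightarrow> 0"
    and cpl: "\<And>t n. \<exists>E\<in>events. prob E \<le> \<epsilon> n \<and> (\<forall>\<omega>\<in>space M - E. \<forall>\<eta> \<eta>'.
        flow (S \<omega>) (t - real n) t \<eta> \<inter> cball 0 R = flow (S \<omega>) (t - real n) t \<eta>' \<inter> cball 0 R)"
  proof (rule coupling[of R], goal_cases)
    case (1 \<epsilon>)
    from 1(2-) show thesis by (rule 1(1))
  qed
  have ev: "{\<omega> \<in> space M. flow (S \<omega>) (t - real n) t \<eta> \<in> A} \<in> events" if "\<eta> \<in> configs" for \<eta> t n
    using measurable_sets[OF measurable_flow_S[OF that] As] by (simp add: vimage_def Int_def conj_commute)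
  show ?thesis
  proof (rule that[OF \<epsilon>])
    fix n and \<eta> :: "'a set" assume \<eta>: "\<eta> \<in> configs"
    obtain E where E: "E \<in> events" "prob E \<le> \<epsilon> n" "\<And>\<omega> \<eta> \<eta>'. \<omega> \<in> space M - E \<Longrightarrow>
        flow (S \<omega>) (0 - real n) 0 \<eta> \<inter> cball 0 R = flow (S \<omega>) (0 - real n) 0 \<eta>' \<inter> cball 0 R"
      using cpl[of n 0] by blast
    have "\<bar>measure (semigroup (real n) \<eta>) A - measure (semigroup (real n) {}) A\<bar> \<le> prob E"
      unfolding measure_semigroup[OF \<eta> As, of n 0] measure_semigroup[OF empty_in_configs As, of n 0]
    proof (rule abs_prob_diff_le)
      fix \<omega> assume \<omega>: "\<omega> \<in> space M" "\<omega> \<notin> E"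
      then have "flow (S \<omega>) (0 - real n) 0 \<eta> \<inter> cball 0 R = flow (S \<omega>) (0 - real n) 0 {} \<inter> cball 0 R"
        using E(3) by blast
      then show "flow (S \<omega>) (0 - real n) 0 \<eta> \<in> A \<longleftrightarrow> flow (S \<omega>) (0 - real n) 0 {} \<in> A"
        by (intro loc flow_in_configs S_configs \<omega> \<eta> empty_in_configs)
    qed (use ev \<eta> E(1) in auto)
    then show "\<bar>measure (semigroup (real n) \<eta>) A - measure (semigroup (real n) {}) A\<bar> \<le> \<epsilon> n"
      using E(2) by linarith
  next
    fix n t
    obtain E where E: "E \<in> events" "prob E \<le> \<epsilon> n" "\<And>\<omega> \<eta> \<eta>'. \<omega> \<in> space M - E \<Longrightarrow>
        flow (S \<omega>) (t - real n) t \<eta> \<inter> cball 0 R = flow (S \<omega>) (t - real n) t \<eta>' \<inter> cball 0 R"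
      using cpl[of n t] by blast
    let ?N = "{\<omega> \<in> space M. \<not> recurrent_past (S \<omega>)}"
    have N [measurable]: "?N \<in> events" by measurable
    have N0: "prob ?N = 0"
      using AE_recurrent_past prob_eq_0[OF N] by simp
    have "\<bar>\<P>(\<omega> in M. stat (S \<omega>) t \<in> A) - \<P>(\<omega> in M. flow (S \<omega>) (t - real n) t {} \<in> A)\<bar> \<le> prob (E \<union> ?N)"
    proof (rule abs_prob_diff_le)
      fix \<omega> assume \<omega>: "\<omega> \<in> space M" "\<omega> \<notin> E \<union> ?N"
      then have "stat (S \<omega>) t \<inter> cball 0 R = flow (S \<omega>) (t - real n) t (alive (S \<omega>) (t - real n)) \<inter> cball 0 R"
        by (simp add: stat_def flow_alive)
      also have "\<dots> = flow (S \<omega>) (t - real n) t {} \<inter> cball 0 R" using E(3) \<omega> by blast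
      finally show "stat (S \<omega>) t \<in> A \<longleftrightarrow> flow (S \<omega>) (t - real n) t {} \<in> A"
        by (intro loc stat_in_configs flow_in_configs S_configs \<omega> empty_in_configs)
    qed (use ev E(1) N in auto)
    also have "\<dots> \<le> \<epsilon> n" using measure_Un_le[OF E(1) N] N0 E(2) by linarith
    finally show "\<bar>measure (distr M config_space (\<lambda>\<omega>. stat (S \<omega>) t)) A - measure (semigroup (real n) {}) A\<bar> \<le> \<epsilon> n"
      unfolding measure_semigroup[OF empty_in_configs As, of n t]
      by (subst measure_distr) (auto simp: vimage_def Int_def conj_commute)
  qed
qed

lemma stat_law_in_prob_algebra: "distr M config_space (\<lambda>\<omega>. stat (S \<omega>) t) \<in> space (prob_algebra config_space)"
  by (simp add: space_prob_algebra prob_space_distr)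

lemma stat_law_const:
  "distr M config_space (\<lambda>\<omega>. stat (S \<omega>) s) = distr M config_space (\<lambda>\<omega>. stat (S \<omega>) t)"
proof (rule prob_config_eqI[OF stat_law_in_prob_algebra stat_law_in_prob_algebra])
  fix A :: "'a set set" assume "A \<in> count_events"
  then obtain \<epsilon> :: "nat \<Rightarrow> real" where \<epsilon>: "\<epsilon> \<longlonglongrightarrow> 0"
    "\<And>n t. \<bar>measure (distr M config_space (\<lambda>\<omega>. stat (S \<omega>) t)) A - measure (semigroup (real n) {}) A\<bar> \<le> \<epsilon> n"
    by (rule semigroup_forgets) blast
  have "\<bar>measure (distr M config_space (\<lambda>\<omega>. stat (S \<omega>) s)) A - measure (distr M config_space (\<lambda>\<omega>. stat (S \<omega>) t)) A\<bar> \<le> 2 * \<epsilon> n" for n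
    using \<epsilon>(2)[of s n] \<epsilon>(2)[of t n] by linarith
  then have "\<bar>measure (distr M config_space (\<lambda>\<omega>. stat (S \<omega>) s)) A - measure (distr M config_space (\<lambda>\<omega>. stat (S \<omega>) t)) A\<bar> \<le> 2 * 0"
    by (intro LIMSEQ_le_const[OF tendsto_mult_left[OF \<epsilon>(1)]]) auto
  then show "measure (distr M config_space (\<lambda>\<omega>. stat (S \<omega>) s)) A = measure (distr M config_space (\<lambda>\<omega>. stat (S \<omega>) t)) A"
    by simp
qed

text \<open>
  An invariant law is the average of \<open>semigroup n \<eta>\<close> over \<open>\<eta>\<close>, hence close to \<open>semigroup n {}\<close> on local
  events, and so is the law of \<open>stat\<close>.
\<close>

lemma invariant_law_unique:
  assumes \<mu>: "\<mu> \<in> space (prob_algebra config_space)" and inv: "\<And>t. 0 \<le> t \<Longrightarrow> \<mu> \<bind> semigroup t = \<mu>"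
  shows "\<mu> = distr M config_space (\<lambda>\<omega>. stat (S \<omega>) t)"
proof (rule prob_config_eqI[OF \<mu> stat_law_in_prob_algebra])
  interpret \<mu>: prob_space \<mu> using \<mu> by (simp add: space_prob_algebra)
  have sets_\<mu>: "sets \<mu> = sets config_space" using \<mu> by (simp add: space_prob_algebra)
  have space_\<mu>: "space \<mu> = configs" using sets_eq_imp_space_eq[OF sets_\<mu>] by simp
  fix A :: "'a set set" assume A: "A \<in> count_events"
  then obtain \<epsilon> :: "nat \<Rightarrow> real" where \<epsilon>: "\<epsilon> \<longlonglongrightarrow> 0"
    "\<And>n \<eta>. \<eta> \<in> configs \<Longrightarrow> \<bar>measure (semigroup (real n) \<eta>) A - measure (semigroup (real n) {}) A\<bar> \<le> \<epsilon> n"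
    "\<And>n t. \<bar>measure (distr M config_space (\<lambda>\<omega>. stat (S \<omega>) t)) A - measure (semigroup (real n) {}) A\<bar> \<le> \<epsilon> n"
    by (rule semigroup_forgets) blast
  have As: "A \<in> sets config_space" using A unfolding sets_config_space by (rule sigma_sets.Basic)
  have "\<bar>measure \<mu> A - measure (semigroup (real n) {}) A\<bar> \<le> \<epsilon> n" for n
  proof -
    have k: "semigroup (real n) \<in> config_space \<rightarrow>\<^sub>M subprob_algebra config_space"
      unfolding semigroup_def by (rule measurable_prob_algebraD[OF measurable_kernel])
    then have k\<mu>: "semigroup (real n) \<in> \<mu> \<rightarrow>\<^sub>M subprob_algebra config_space"
      unfolding measurable_cong_sets[OF sets_\<mu> refl] .
    let ?f = "\<lambda>\<eta>. measure (semigroup (real n) \<eta>) A"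
    have f: "?f \<in> borel_measurable \<mu>"
      using measurable_compose[OF k\<mu> measurable_measure_subprob_algebra[OF As]] .
    have prob_k: "prob_space (semigroup (real n) \<eta>)" if "\<eta> \<in> configs" for \<eta>
      using kernel_in_prob_algebra[OF that, of 0 "real n"] by (simp add: semigroup_def space_prob_algebra)
    have if': "integrable \<mu> ?f"
      using prob_space.prob_le_1[OF prob_k] f space_\<mu> by (intro \<mu>.integrable_const_bound[of _ 1]) auto
    have "measure \<mu> A = measure (\<mu> \<bind> semigroup (real n)) A" using inv by simp
    also have "\<dots> = (LINT \<eta>|\<mu>. ?f \<eta>)" by (rule \<mu>.measure_bind[OF k\<mu> As])
    finally have "measure \<mu> A - measure (semigroup (real n) {}) A = (LINT \<eta>|\<mu>. ?f \<eta> - measure (semigroup (real n) {}) A)"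
      using if' by (simp add: \<mu>.prob_space)
    also have "\<bar>\<dots>\<bar> \<le> (LINT \<eta>|\<mu>. \<epsilon> n)"
      by (rule abs_integral_le) (use if' \<epsilon>(2) space_\<mu> in auto)
    finally show ?thesis by (simp add: \<mu>.prob_space)
  qed
  then have "\<bar>measure \<mu> A - measure (distr M config_space (\<lambda>\<omega>. stat (S \<omega>) t)) A\<bar> \<le> 2 * \<epsilon> n" for n
    using \<epsilon>(3)[of t n] by (smt (verit))
  then have "\<bar>measure \<mu> A - measure (distr M config_space (\<lambda>\<omega>. stat (S \<omega>) t)) A\<bar> \<le> 2 * 0"
    by (intro LIMSEQ_le_const[OF tendsto_mult_left[OF \<epsilon>(1)]]) auto
  then show "measure \<mu> A = measure (distr M config_space (\<lambda>\<omega>. stat (S \<omega>) t)) A" by simp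
qed

end

section \<open>The Markov property of the flow\<close>

context poisson_flow
begin

text \<open>
  By adaptedness an event of the past up to \<open>s\<close> is an event of the points up to time \<open>s\<close>, while the
  flow over \<open>(s, t]\<close> is driven by the later points, which are independent of them.
\<close>

lemma markov_flow:
  fixes g :: "real \<Rightarrow> ('a \<times> real) set \<Rightarrow> 'a set"
  assumes g: "\<And>u. u \<in> T \<Longrightarrow> g u \<in> config_space \<rightarrow>\<^sub>M config_space"
    and adapted: "\<And>u s \<xi>. u \<in> T \<Longrightarrow> u \<le> s \<Longrightarrow> g u (\<xi> \<inter> (UNIV \<times> {..s})) = g u \<xi>"
    and evol: "\<And>s t. s \<in> T \<Longrightarrow> t \<in> T \<Longrightarrow> s \<le> t \<Longrightarrow> AE \<omega> in M. g t (S \<omega>) = flow (S \<omega>) s t (g s (S \<omega>))"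
  shows "markov_process M T config_space semigroup (\<lambda>t \<omega>. g t (S \<omega>))"
proof -
  let ?E = "config_space :: 'a set measure"
  let ?Y = "\<lambda>t \<omega>. g t (S \<omega>)"
  have Y [measurable]: "?Y t \<in> M \<rightarrow>\<^sub>M ?E" if "t \<in> T" for t
    by (rule measurable_compose[OF measurable_S g[OF that]])
  show ?thesis
    unfolding markov_process_def
  proof (intro conjI ballI impI Y)
    fix s t A assume s: "s \<in> T" and t: "t \<in> T" and st: "s \<le> t" and A [measurable]: "A \<in> sets ?E"
    let ?F = "past M T ?E ?Y s"
    interpret F: finite_measure_subalgebra M ?F
      by unfold_locales (rule subalgebra_past[OF Y])
    note [measurable] = Y[OF s] Y[OF t] g[OF s]
    define P where "P = (\<lambda>\<omega>. S \<omega> \<inter> (UNIV \<times> {..s}))"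
    have P: "P \<in> M \<rightarrow>\<^sub>M config_space"
      unfolding P_def by (rule measurable_compose[OF measurable_S measurable_restrict_config]) (auto intro!: borel_Times)
    have past: "\<exists>B'\<in>sets config_space. B = P -` B' \<inter> space M" if "B \<in> sets ?F" for B
    proof -
      let ?V = "vimage_algebra (space M) P config_space"
      have V: "sets ?V = {P -` A \<inter> space M | A. A \<in> sets config_space}"
        by (rule sets_vimage_algebra2) (use measurable_space[OF P] in simp)
      have "{?Y u -` A \<inter> space M | u A. u \<in> T \<and> u \<le> s \<and> A \<in> sets ?E} \<subseteq> sets ?V"
      proof
        fix X assume "X \<in> {?Y u -` A \<inter> space M | u A. u \<in> T \<and> u \<le> s \<and> A \<in> sets ?E}"
        then obtain u A where X: "X = ?Y u -` A \<inter> space M" and u: "u \<in> T" "u \<le> s" and A: "A \<in> sets ?E" by blast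
        have "X = P -` (g u -` A \<inter> configs) \<inter> space M"
          unfolding X using adapted[OF u] measurable_space[OF P] by (auto simp: P_def)
        moreover have "g u -` A \<inter> configs \<in> sets config_space"
          using measurable_sets[OF g[OF u(1)] A] by simp
        ultimately show "X \<in> sets ?V" unfolding V by blast
      qed
      then have "sigma_sets (space ?V) {?Y u -` A \<inter> space M | u A. u \<in> T \<and> u \<le> s \<and> A \<in> sets ?E} \<subseteq> sets ?V"
        by (rule sets.sigma_sets_subset)
      then have "sets ?F \<subseteq> sets ?V" unfolding sets_past by simp
      then show ?thesis using that unfolding V by blast
    qed
    let ?I = "indicator {\<omega> \<in> space M. ?Y t \<omega> \<in> A} :: 'w \<Rightarrow> real"
    let ?m = "\<lambda>\<omega>. measure (semigroup (t - s) (?Y s \<omega>)) A"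
    have K: "semigroup (t - s) \<in> ?E \<rightarrow>\<^sub>M prob_algebra ?E"
      unfolding semigroup_def by (rule measurable_kernel)
    note mK = measurable_compose[OF measurable_prob_algebraD[OF K] measurable_measure_subprob_algebra[OF A]]
    have PK: "prob_space (semigroup (t - s) (?Y s \<omega>))" if "\<omega> \<in> space M" for \<omega>
      using measurable_space[OF K measurable_space[OF Y[OF s] that]] by (simp add: space_prob_algebra)
    have YF: "?Y s \<in> ?F \<rightarrow>\<^sub>M ?E" by (rule measurable_past[where Y="?Y", OF s order_refl Y[OF s]])
    have mM [measurable]: "?m \<in> borel_measurable M" by (rule measurable_compose[OF Y[OF s] mK])
    have m1: "?m \<omega> \<le> 1" if "\<omega> \<in> space M" for \<omega> by (rule prob_space.prob_le_1[OF PK[OF that]])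
    show "AE \<omega> in M. real_cond_exp M ?F ?I \<omega> = ?m \<omega>"
    proof (rule F.real_cond_exp_charact)
      show "integrable M ?I" by (simp add: less_top[symmetric])
      show "integrable M ?m" using m1 by (intro integrable_const_bound[of _ 1] AE_I2) auto
      show "?m \<in> borel_measurable ?F" by (rule measurable_compose[OF YF mK])
      fix B assume B: "B \<in> sets ?F"
      then have BM [measurable]: "B \<in> events" using F.subalg unfolding subalgebra_def by auto
      obtain B' where B' [measurable]: "B' \<in> sets config_space" and BB': "B = P -` B' \<inter> space M"
        using past[OF B] by blast
      have iB: "indicator B \<omega> = (indicator B' (P \<omega>) :: ennreal)" if "\<omega> \<in> space M" for \<omega>
        using that unfolding BB' by (simp add: indicator_def)
      have gP: "g s (P \<omega>) = ?Y s \<omega>" for \<omega> unfolding P_def by (rule adapted[OF s]) simp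
      have PS: "S \<omega> \<inter> (UNIV \<times> {..s}) = P \<omega>" for \<omega> unfolding P_def ..
      let ?h = "\<lambda>\<xi> \<zeta>. indicator B' \<xi> * indicator A (flow \<zeta> s t (g s \<xi>)) :: ennreal"
      have "(\<integral>\<^sup>+ \<omega>. indicator B \<omega> * indicator A (?Y t \<omega>) \<partial>M)
        = (\<integral>\<^sup>+ \<omega>. ?h (S \<omega> \<inter> (UNIV \<times> {..s})) (S \<omega> \<inter> (UNIV \<times> {s<..})) \<partial>M)"
      proof (rule nn_integral_cong_AE)
        show "AE \<omega> in M. indicator B \<omega> * indicator A (?Y t \<omega>) = ?h (S \<omega> \<inter> (UNIV \<times> {..s})) (S \<omega> \<inter> (UNIV \<times> {s<..}))"
          using evol[OF s t st] AE_space
          by eventually_elim (simp add: iB PS gP flow_future)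
      qed
      also have "\<dots> = (\<integral>\<^sup>+ \<omega>. \<integral>\<^sup>+ \<omega>'. ?h (S \<omega> \<inter> (UNIV \<times> {..s})) (S \<omega>' \<inter> (UNIV \<times> {s<..})) \<partial>M \<partial>M)"
        by (rule nn_integral_future) measurable
      also have "\<dots> = (\<integral>\<^sup>+ \<omega>. indicator B \<omega> * emeasure (semigroup (t - s) (?Y s \<omega>)) A \<partial>M)"
      proof (rule nn_integral_cong)
        fix \<omega> assume \<omega>: "\<omega> \<in> space M"
        have Ys: "?Y s \<omega> \<in> configs" using measurable_space[OF Y[OF s] \<omega>] by simp
        note [measurable] = measurable_flow_S[OF Ys]
        have "(\<integral>\<^sup>+ \<omega>'. ?h (S \<omega> \<inter> (UNIV \<times> {..s})) (S \<omega>' \<inter> (UNIV \<times> {s<..})) \<partial>M)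
          = (\<integral>\<^sup>+ \<omega>'. indicator B \<omega> * indicator A (flow (S \<omega>') s t (?Y s \<omega>)) \<partial>M)"
          using \<omega> by (simp add: iB PS gP flow_future)
        also have "\<dots> = indicator B \<omega> * (\<integral>\<^sup>+ \<omega>'. indicator A (flow (S \<omega>') s t (?Y s \<omega>)) \<partial>M)"
          by (rule nn_integral_cmult) measurable
        also have "(\<integral>\<^sup>+ \<omega>'. indicator A (flow (S \<omega>') s t (?Y s \<omega>)) \<partial>M) = emeasure (semigroup (t - s) (?Y s \<omega>)) A"
          using kernel_eq_semigroup[OF Ys st] kernel_emeasure[OF Ys A, of s t] by simp
        finally show "(\<integral>\<^sup>+ \<omega>'. ?h (S \<omega> \<inter> (UNIV \<times> {..s})) (S \<omega>' \<inter> (UNIV \<times> {s<..})) \<partial>M)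
          = indicator B \<omega> * emeasure (semigroup (t - s) (?Y s \<omega>)) A" .
      qed
      finally have nn: "(\<integral>\<^sup>+ \<omega>. indicator B \<omega> * indicator A (?Y t \<omega>) \<partial>M)
        = (\<integral>\<^sup>+ \<omega>. indicator B \<omega> * emeasure (semigroup (t - s) (?Y s \<omega>)) A \<partial>M)" .
      have "(LINT \<omega>:B|M. ?I \<omega>) = enn2real (\<integral>\<^sup>+ \<omega>. indicator B \<omega> * indicator A (?Y t \<omega>) \<partial>M)"
      proof -
        have "(LINT \<omega>:B|M. ?I \<omega>) = enn2real (\<integral>\<^sup>+ \<omega>. ennreal (indicator B \<omega> *\<^sub>R ?I \<omega>) \<partial>M)"
          unfolding set_lebesgue_integral_def by (rule integral_eq_nn_integral) auto
        also have "(\<integral>\<^sup>+ \<omega>. ennreal (indicator B \<omega> *\<^sub>R ?I \<omega>) \<partial>M) = (\<integral>\<^sup>+ \<omega>. indicator B \<omega> * indicator A (?Y t \<omega>) \<partial>M)"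
          by (intro nn_integral_cong) (auto simp: indicator_def)
        finally show ?thesis .
      qed
      also have "\<dots> = enn2real (\<integral>\<^sup>+ \<omega>. ennreal (indicator B \<omega> *\<^sub>R ?m \<omega>) \<partial>M)"
        unfolding nn by (intro arg_cong[where f=enn2real] nn_integral_cong)
          (auto simp: indicator_def finite_measure.emeasure_eq_measure[OF prob_space.finite_measure[OF PK]])
      also have "\<dots> = (LINT \<omega>:B|M. ?m \<omega>)"
        unfolding set_lebesgue_integral_def by (rule integral_eq_nn_integral[symmetric]) auto
      finally show "(LINT \<omega>:B|M. ?I \<omega>) = (LINT \<omega>:B|M. ?m \<omega>)" .
    qed
  qed
qed

lemma markov_flow_from:
  assumes \<eta>: "\<eta> \<in> configs"
  shows "markov_process M {t'..} config_space semigroup (\<lambda>t \<omega>. flow (S \<omega>) t' t \<eta>)"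
proof (rule markov_flow[of _ "\<lambda>t \<xi>. flow \<xi> t' t \<eta>"])
  show "(\<lambda>\<xi>. flow \<xi> t' u \<eta>) \<in> config_space \<rightarrow>\<^sub>M config_space" for u
    by (rule measurable_flow) (use \<eta> in auto)
qed (auto simp: flow_past flow_flow)

lemma markov_stat: "markov_process M UNIV config_space semigroup (\<lambda>t \<omega>. stat (S \<omega>) t)"
proof (rule markov_flow[of _ "\<lambda>t \<xi>. stat \<xi> t"])
  fix s t :: real assume "s \<le> t"
  then show "AE \<omega> in M. stat (S \<omega>) t = flow (S \<omega>) s t (stat (S \<omega>) s)"
    using AE_recurrent_past by (auto simp: stat_def flow_alive elim: eventually_mono)
qed (auto simp: stat_past measurable_stat)

text \<open>
  The shifted process is Markov for the same kernels and has the same marginals.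
\<close>

lemma stationary_stat: "stationary M (\<lambda>t \<omega>. stat (S \<omega>) t)"
  unfolding stationary_def
proof
  fix h
  show "process_law M (\<lambda>t \<omega>. stat (S \<omega>) (t + h)) = process_law M (\<lambda>t \<omega>. stat (S \<omega>) t)"
    by (rule markov_process_law_unique[OF prob_space_axioms prob_space_axioms semigroup_transition
        markov_process_shift[OF markov_stat] markov_stat stat_law_const])
qed

lemma stat_law_invariant:
  assumes "0 \<le> t"
  shows "distr M config_space (\<lambda>\<omega>. stat (S \<omega>) s) \<bind> semigroup t = distr M config_space (\<lambda>\<omega>. stat (S \<omega>) s)"
proof -
  have "distr M config_space (\<lambda>\<omega>. stat (S \<omega>) (s + t)) = distr M config_space (\<lambda>\<omega>. stat (S \<omega>) s) \<bind> semigroup (s + t - s)"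
    by (rule markov_marginal[OF prob_space_axioms semigroup_transition markov_stat]) (use assms in auto)
  then show ?thesis using stat_law_const[of "s + t" s] by simp
qed

text \<open>
  The semigroup of \<open>Z\<close> is the semigroup of the flow, and by stationarity the marginal of \<open>Z\<close> is an
  invariant law, so kernels and marginals agree with those of \<open>stat\<close>.
\<close>

lemma stationary_law_unique:
  fixes N :: "'v measure" and Z :: "real \<Rightarrow> 'v \<Rightarrow> 'a set"
  assumes N: "prob_space N" and Z: "markov_with_generator N UNIV (gen lam) Z" and stat: "stationary N Z"
  shows "process_law N Z = process_law M (\<lambda>t \<omega>. stat (S \<omega>) t)"
proof -
  let ?E = "config_space :: 'a set measure"
  obtain P where P: "transition_semigroup ?E P" "has_generator P (gen lam)" "markov_process N UNIV ?E P Z"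
    using Z unfolding markov_with_generator_def by blast
  have Zs: "markov_process N UNIV ?E semigroup Z"
    by (rule markov_process_cong[OF P(3)]) (use semigroup_unique[OF P(1,2)] in simp)
  have Zm: "Z t \<in> N \<rightarrow>\<^sub>M ?E" for t using Zs unfolding markov_process_def by simp
  have law: "distr (process_law N (\<lambda>t. Z (t + h))) ?E (\<lambda>z. z 0) = distr N ?E (Z h)" for h
  proof -
    have "(\<lambda>\<omega> t. Z (t + h) \<omega>) \<in> N \<rightarrow>\<^sub>M PiM UNIV (\<lambda>_. ?E)"
      using measurable_space[OF Zm] by (intro measurable_PiM_single' Zm) auto
    then show ?thesis unfolding process_law_def
      by (subst distr_distr) (auto simp: comp_def measurable_component_singleton)
  qed
  have const: "distr N ?E (Z t) = distr N ?E (Z 0)" for t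
    using law[of t] law[of 0] stat unfolding stationary_def by simp
  have "distr N ?E (Z 0) \<bind> semigroup t = distr N ?E (Z 0)" if "0 \<le> t" for t
    using markov_marginal[OF N semigroup_transition Zs, of 0 t] that const[of t] by simp
  then have law0: "distr N ?E (Z 0) = distr M ?E (\<lambda>\<omega>. stat (S \<omega>) t)" for t
    by (intro invariant_law_unique) (simp_all add: space_prob_algebra prob_space.prob_space_distr[OF N Zm])
  show ?thesis
    by (rule markov_process_law_unique[OF N prob_space_axioms semigroup_transition Zs markov_stat])
      (rule trans[OF const law0])
qed

lemma invariant_stat_law:
  "invariant_measure (gen lam) (distr M config_space (\<lambda>\<omega>. stat (S \<omega>) t))"
  unfolding invariant_measure_def
  by (intro conjI exI[of _ semigroup] allI impI stat_law_in_prob_algebra semigroup_transition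
      semigroup_generator stat_law_invariant)

lemma invariant_measure_unique:
  assumes "invariant_measure (gen lam) \<mu>"
  shows "\<mu> = distr M config_space (\<lambda>\<omega>. stat (S \<omega>) t)"
proof -
  obtain P where \<mu>: "\<mu> \<in> space (prob_algebra config_space)"
    and P: "transition_semigroup config_space P" "has_generator P (gen lam)" and inv: "\<And>t. 0 \<le> t \<Longrightarrow> \<mu> \<bind> P t = \<mu>"
    using assms unfolding invariant_measure_def by blast
  have "sets \<mu> = sets config_space" using \<mu> by (simp add: space_prob_algebra)
  from sets_eq_imp_space_eq[OF this] have sp: "space \<mu> = configs" by simp
  show ?thesis
  proof (rule invariant_law_unique[OF \<mu>])
    fix t :: real assume t: "0 \<le> t"
    have "\<mu> \<bind> semigroup t = \<mu> \<bind> P t"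
      by (rule bind_cong) (use semigroup_unique[OF P _ t] sp in auto)
    then show "\<mu> \<bind> semigroup t = \<mu>" using inv[OF t] by simp
  qed
qed

end

section \<open>Particle paths and the flow\<close>

text \<open>
  A chain of jumps of length at most 1 through infinitely many points of \<open>S\<close> in bounded time. The path
  of a particle is such a chain unless it makes finitely many jumps before each time.
\<close>

definition explosive :: "('a::euclidean_space \<times> real) set \<Rightarrow> bool" where
  "explosive S \<longleftrightarrow> (\<exists>p T. \<forall>n::nat. p n \<in> S \<and> snd (p n) < snd (p (Suc n)) \<and>
     dist (fst (p n)) (fst (p (Suc n))) \<le> 1 \<and> snd (p n) \<le> (T::real))"

definition regular_points :: "('a::euclidean_space \<times> real) set \<Rightarrow> bool" where
  "regular_points S \<longleftrightarrow> S \<in> configs \<and> inj_on snd S \<and> recurrent_future S \<and> \<not> explosive S"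

text \<open>
  Local finiteness makes the infimum in the definition of \<open>tau\<close> a minimum, recurrence makes the set
  nonempty, and distinct times make the point in the definition of \<open>alpha\<close> unique.
\<close>

lemma alpha_first_hit:
  assumes S: "regular_points S"
  shows "alpha S s \<in> S" "snd s < snd (alpha S s)" "dist (fst s) (fst (alpha S s)) \<le> 1"
    and "\<And>u q. (u, q) \<in> S \<Longrightarrow> snd s < q \<Longrightarrow> q < snd (alpha S s) \<Longrightarrow> 1 < dist (fst s) u"
proof -
  obtain x r where s: "s = (x, r)" by (cases s)
  have SC: "S \<in> configs" and inj: "inj_on snd S" and fut: "recurrent_future S"
    using S unfolding regular_points_def by auto
  define A where "A = {t. r < t \<and> (\<exists>x'. (x', t) \<in> S \<and> norm (x - x') \<le> 1)}"
  have tau: "tau S s = Inf A" unfolding tau_def A_def s by simp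
  obtain t0 where t0: "t0 \<in> A"
  proof -
    obtain d where d: "d \<in> sites" "x \<in> ball d (1/2)" using sites(2) by blast
    obtain n :: nat where n: "r \<le> n" using real_arch_simple by blast
    obtain u q where u: "(u, q) \<in> S" "u \<in> ball d (1/2)" "real n < q"
      using fut[unfolded recurrent_future_def] d(1) by meson
    have "dist x u \<le> dist x d + dist d u" by (rule dist_triangle)
    then have "norm (x - u) \<le> 1" using u(2) d(2) by (simp add: dist_commute dist_norm[symmetric])
    then show ?thesis using that[of q] u n unfolding A_def by auto
  qed
  have fin: "finite (A \<inter> {..t0})"
  proof (rule finite_subset)
    show "A \<inter> {..t0} \<subseteq> snd ` (S \<inter> cball x 1 \<times> {r<..t0})"
      unfolding A_def by (force simp: dist_norm)
    show "finite (snd ` (S \<inter> cball x 1 \<times> {r<..t0}))"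
      by (intro finite_imageI finite_configs_Int[OF SC bounded_slab]) simp
  qed
  define m where "m = Min (A \<inter> {..t0})"
  have m: "m \<in> A" "m \<le> t0" using Min_in[OF fin] t0 unfolding m_def by auto
  have m_le: "m \<le> a" if "a \<in> A" for a
  proof (cases "a \<le> t0")
    case True
    then show ?thesis unfolding m_def using fin that by (intro Min_le) auto
  qed (use m(2) in simp)
  have tm: "tau S s = m" unfolding tau using m(1) m_le by (intro cInf_eq_minimum)
  obtain u where u: "(u, m) \<in> S" "norm (x - u) \<le> 1" "r < m" using m(1) unfolding A_def by blast
  have "alpha S s = (u, m)"
    unfolding alpha_def s tm[unfolded s] fst_conv
  proof (rule the_equality)
    fix p assume p: "p \<in> S \<and> snd p = m \<and> norm (x - fst p) \<le> 1"
    then have "p = (u, m)" using inj_onD[OF inj, of p "(u, m)"] u(1) by auto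
    then show "p = (u, m)" .
  qed (use u in simp)
  then show "alpha S s \<in> S" "snd s < snd (alpha S s)" "dist (fst s) (fst (alpha S s)) \<le> 1"
    using u s by (auto simp: dist_norm)
  fix v q assume v: "(v, q) \<in> S" "snd s < q" "q < snd (alpha S s)"
  show "1 < dist (fst s) v"
  proof (rule ccontr)
    assume "\<not> 1 < dist (fst s) v"
    then have "q \<in> A" using v s unfolding A_def by (auto simp: dist_norm)
    from m_le[OF this] v(3) \<open>alpha S s = (u, m)\<close> show False by simp
  qed
qed

lemma position_at:
  assumes S: "regular_points S" and n: "tau_iter S n s \<le> t" "t < tau_iter S (Suc n) s"
  shows "position S s t = fst ((alpha S ^^ n) s)"
proof -
  have mono: "strict_mono (\<lambda>n. tau_iter S n s)"
    unfolding strict_mono_Suc_iff tau_iter_def using alpha_first_hit(2)[OF S] by simp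
  have "(THE n. tau_iter S n s \<le> t \<and> t < tau_iter S (Suc n) s) = n"
  proof (rule the_equality)
    fix k assume k: "tau_iter S k s \<le> t \<and> t < tau_iter S (Suc k) s"
    have "\<not> Suc k \<le> n" "\<not> Suc n \<le> k"
      using k n strict_mono_leD[OF mono] by (meson le_less_trans not_less)+
    then show "k = n" by simp
  qed (use n in simp)
  then show ?thesis unfolding position_def by simp
qed

text \<open>
  Since the particle does not explode, its jump times exceed \<open>t\<close> at some stage; the last jump before
  that gives the position, and no point has come near since then.
\<close>

lemma position_cases:
  assumes S: "regular_points S" and t: "snd s \<le> t"
  obtains n where "position S s t = fst ((alpha S ^^ n) s)" "snd ((alpha S ^^ n) s) \<le> t"
    "clear S (fst ((alpha S ^^ n) s)) (snd ((alpha S ^^ n) s)) t"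
proof -
  let ?p = "\<lambda>n. (alpha S ^^ n) s"
  have "\<exists>n. t < snd (?p n)"
  proof (rule ccontr)
    assume "\<nexists>n. t < snd (?p n)"
    then have le: "snd (?p n) \<le> t" for n by (simp add: not_less)
    have "snd (alpha S (?p n)) \<le> t" for n using le[of "Suc n"] by simp
    then have "\<forall>n. ?p (Suc n) \<in> S \<and> snd (?p (Suc n)) < snd (?p (Suc (Suc n))) \<and>
       dist (fst (?p (Suc n))) (fst (?p (Suc (Suc n)))) \<le> 1 \<and> snd (?p (Suc n)) \<le> t"
      using alpha_first_hit(1-3)[OF S] by simp
    then have "explosive S" unfolding explosive_def by (intro exI[of _ "\<lambda>n. ?p (Suc n)"] exI[of _ t])
    with S show False unfolding regular_points_def by simp
  qed
  then obtain m where m: "t < snd (?p m)" "\<And>k. k < m \<Longrightarrow> \<not> t < snd (?p k)"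
    using exists_least_iff[of "\<lambda>n. t < snd (?p n)"] by blast
  then obtain n where n: "m = Suc n" using t by (cases m) auto
  show ?thesis
  proof (rule that[of n])
    show le: "snd (?p n) \<le> t" using m(2)[of n] n by simp
    have lt: "t < snd (alpha S (?p n))" using m(1) n by simp
    show "position S s t = fst (?p n)"
      by (rule position_at[OF S]) (use le lt in \<open>simp_all add: tau_iter_def\<close>)
    show "clear S (fst (?p n)) (snd (?p n)) t"
      unfolding clear_def using alpha_first_hit(4)[OF S] lt by fastforce
  qed
qed

lemma position_clear:
  assumes S: "regular_points S" and t: "r \<le> t" "clear S x r t"
  shows "position S (x, r) t = x"
proof -
  have "t < snd (alpha S (x, r))"
  proof (rule ccontr)
    assume "\<not> t < snd (alpha S (x, r))"
    then have "1 < dist x (fst (alpha S (x, r)))"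
      using t(2) alpha_first_hit(1,2)[OF S, of "(x, r)"] unfolding clear_def
      by (metis fst_conv not_less prod.collapse snd_conv)
    then show False using alpha_first_hit(3)[OF S, of "(x, r)"] by simp
  qed
  then have "position S (x, r) t = fst ((alpha S ^^ 0) (x, r))"
    by (intro position_at[OF S]) (use t in \<open>simp_all add: tau_iter_def\<close>)
  then show ?thesis by simp
qed

lemma alpha_funpow_in: "regular_points S \<Longrightarrow> n \<noteq> 0 \<Longrightarrow> (alpha S ^^ n) s \<in> S"
  by (cases n) (auto intro: alpha_first_hit(1))

lemma alpha_funpow_time: "regular_points S \<Longrightarrow> n \<noteq> 0 \<Longrightarrow> snd s < snd ((alpha S ^^ n) s)"
proof (induction n)
  case (Suc n)
  then show ?case using alpha_first_hit(2)[OF Suc.prems(1), of "(alpha S ^^ n) s"] by (cases "n = 0") auto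
qed simp

text \<open>
  A particle that sits at \<open>y\<close> at time \<open>t\<close> was brought there by a point of \<open>S\<close> at \<open>y\<close> which has not been
  covered since. Conversely, the particle born at such a point has not moved.
\<close>

theorem eta_eq_alive:
  assumes S: "regular_points S"
  shows "eta S t = alive S t"
proof (intro equalityI subsetI)
  fix y assume "y \<in> eta S t"
  then obtain x r where xr: "(x, r) \<in> S" "r \<le> t" and y: "y = position S (x, r) t"
    unfolding eta_def by blast
  obtain n where n: "y = fst ((alpha S ^^ n) (x, r))" "snd ((alpha S ^^ n) (x, r)) \<le> t"
    "clear S (fst ((alpha S ^^ n) (x, r))) (snd ((alpha S ^^ n) (x, r))) t"
    using position_cases[OF S, of "(x, r)" t] xr(2) y by (metis snd_conv)
  have "(alpha S ^^ n) (x, r) \<in> S" using alpha_funpow_in[OF S, of n] xr(1) by (cases "n = 0") auto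
  then show "y \<in> alive S t" unfolding alive_def using n by (metis (mono_tags, lifting) mem_Collect_eq prod.collapse)
next
  fix y assume "y \<in> alive S t"
  then obtain r where r: "(y, r) \<in> S" "r \<le> t" "clear S y r t" unfolding alive_def by blast
  from position_clear[OF S r(2,3)] show "y \<in> eta S t" unfolding eta_def using r(1,2) by force
qed

text \<open>
  As in \<open>eta_eq_alive\<close>. Points of \<open>S\<close> at the initial time itself are born in \<open>eta_from\<close> but do not
  act in the flow, so they have to be excluded.
\<close>

theorem eta_from_eq_flow:
  assumes S: "regular_points S" and t': "\<And>x. (x, t') \<notin> S" and t: "t' \<le> t"
  shows "eta_from S \<eta> t' t = flow S t' t \<eta>"
proof (intro equalityI subsetI)
  fix y assume "y \<in> eta_from S \<eta> t' t"
  then obtain x r where xr: "((x, r) \<in> S \<and> t' \<le> r \<and> r \<le> t) \<or> (x \<in> \<eta> \<and> r = t')" and y: "y = position S (x, r) t"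
    unfolding eta_from_def by blast
  then have r: "t' \<le> r" "r \<le> t" using t by auto
  let ?p = "\<lambda>n. (alpha S ^^ n) (x, r)"
  obtain n where n: "y = fst (?p n)" "snd (?p n) \<le> t" "clear S (fst (?p n)) (snd (?p n)) t"
    using position_cases[OF S, of "(x, r)" t] r(2) y by (metis snd_conv)
  show "y \<in> flow S t' t \<eta>"
  proof (cases "n = 0 \<and> x \<in> \<eta> \<and> r = t'")
    case True
    then show ?thesis using n unfolding flow_def by simp
  next
    case False
    have "?p n \<in> S" "t' < snd (?p n)"
    proof -
      show "?p n \<in> S" using False xr alpha_funpow_in[OF S, of n "(x, r)"] by (cases "n = 0") auto
      show "t' < snd (?p n)"
      proof (cases "n = 0")
        case True
        then have "(x, r) \<in> S" using False xr by auto
        moreover then have "r \<noteq> t'" using t' by blast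
        ultimately show ?thesis using True r by simp
      next
        case False
        then show ?thesis using alpha_funpow_time[OF S, of n "(x, r)"] r by simp
      qed
    qed
    then have "(y, snd (?p n)) \<in> S \<and> t' < snd (?p n) \<and> snd (?p n) \<le> t \<and> clear S y (snd (?p n)) t"
      using n by simp
    then show ?thesis unfolding flow_def by blast
  qed
next
  fix y assume "y \<in> flow S t' t \<eta>"
  then consider "y \<in> \<eta>" "clear S y t' t" | r where "(y, r) \<in> S" "t' < r" "r \<le> t" "clear S y r t"
    unfolding flow_def by blast
  then show "y \<in> eta_from S \<eta> t' t"
  proof cases
    case 1
    with position_clear[OF S t 1(2)] show ?thesis unfolding eta_from_def by force
  next
    case 2
    with position_clear[OF S 2(3,4)] show ?thesis unfolding eta_from_def by (force intro: less_imp_le)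
  qed
qed

section \<open>Almost sure regularity of the Poisson points\<close>

text \<open>
  Unit cubes with integer corners. An index is a function on the basis, undefined elsewhere, so that
  distinct indices of the form considered here have disjoint cells.
\<close>

definition cell_index :: "'a::euclidean_space \<Rightarrow> 'a \<Rightarrow> int" where
  "cell_index x = (\<lambda>b\<in>Basis. \<lfloor>x \<bullet> b\<rfloor>)"

definition cell :: "('a::euclidean_space \<Rightarrow> int) \<Rightarrow> 'a set" where
  "cell c = {x. \<forall>b\<in>Basis. \<lfloor>x \<bullet> b\<rfloor> = c b}"

definition cell_nbrs :: "('a::euclidean_space \<Rightarrow> int) \<Rightarrow> ('a \<Rightarrow> int) set" where
  "cell_nbrs c = (\<Pi>\<^sub>E b\<in>Basis. {c b - 1..c b + 1})"

lemma in_cell_index [simp]: "x \<in> cell (cell_index x)"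
  unfolding cell_def cell_index_def by simp

lemma cell_borel: "cell c \<in> sets borel"
proof -
  have "cell c = (\<Inter>b\<in>Basis. {x. \<lfloor>x \<bullet> b\<rfloor> = c b})" unfolding cell_def by auto
  also have "\<dots> \<in> sets borel" by (intro sets.finite_INT) auto
  finally show ?thesis .
qed

lemma cell_subset_cbox: "cell c \<subseteq> cbox (\<Sum>b\<in>Basis. real_of_int (c b) *\<^sub>R b) (\<Sum>b\<in>Basis. (real_of_int (c b) + 1) *\<^sub>R b)"
proof
  fix x assume x: "x \<in> cell c"
  have "real_of_int (c b) \<le> x \<bullet> b \<and> x \<bullet> b \<le> real_of_int (c b) + 1" if "b \<in> Basis" for b
  proof -
    have "\<lfloor>x \<bullet> b\<rfloor> = c b" using x that unfolding cell_def by simp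
    then show ?thesis by linarith
  qed
  then show "x \<in> cbox (\<Sum>b\<in>Basis. real_of_int (c b) *\<^sub>R b) (\<Sum>b\<in>Basis. (real_of_int (c b) + 1) *\<^sub>R b)"
    by (simp add: mem_box)
qed

lemma cell_bounded: "bounded (cell c)"
  by (rule bounded_subset[OF bounded_cbox cell_subset_cbox])

lemma cell_volume: "measure lborel (cell c) \<le> 1"
proof -
  have "measure lborel (cell c) \<le> measure lborel (cbox (\<Sum>b\<in>Basis. real_of_int (c b) *\<^sub>R b) (\<Sum>b\<in>Basis. (real_of_int (c b) + 1) *\<^sub>R b))"
    by (intro measure_mono_fmeasurable cell_subset_cbox) (auto simp: cell_borel)
  also have "\<dots> = 1" by (simp add: content_cbox_if box_ne_empty inner_add_left)
  finally show ?thesis .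
qed

lemma cell_disjoint:
  assumes "c \<in> Basis \<rightarrow>\<^sub>E UNIV" "c' \<in> Basis \<rightarrow>\<^sub>E UNIV" "c \<noteq> c'"
  shows "cell c \<inter> cell c' = {}"
  using assms unfolding cell_def by (auto; metis PiE_ext)

lemma cell_index_nbr:
  assumes "dist x y \<le> 1"
  shows "cell_index y \<in> cell_nbrs (cell_index x)"
  unfolding cell_nbrs_def
proof (rule PiE_I)
  fix b :: 'a assume b: "b \<in> Basis"
  have "\<bar>(x - y) \<bullet> b\<bar> \<le> 1" using Basis_le_norm[OF b, of "x - y"] assms by (simp add: dist_norm)
  then have "x \<bullet> b \<le> y \<bullet> b + 1" "y \<bullet> b \<le> x \<bullet> b + 1" by (auto simp: inner_diff_left)
  then have "\<lfloor>x \<bullet> b\<rfloor> \<le> \<lfloor>y \<bullet> b\<rfloor> + 1" "\<lfloor>y \<bullet> b\<rfloor> \<le> \<lfloor>x \<bullet> b\<rfloor> + 1" by linarith+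
  then show "cell_index y b \<in> {cell_index x b - 1..cell_index x b + 1}"
    using b by (simp add: cell_index_def)
qed (simp add: cell_index_def)

lemma finite_cell_nbrs: "finite (cell_nbrs c)"
  unfolding cell_nbrs_def by (intro finite_PiE) auto

lemma card_cell_nbrs: "card (cell_nbrs (c :: 'a::euclidean_space \<Rightarrow> int)) = 3 ^ DIM('a)"
  unfolding cell_nbrs_def by (simp add: card_PiE)

text \<open>
  Walks through neighbouring cells, without the starting cell. Diagonal neighbours count, and a cell
  is a neighbour of itself.
\<close>

fun cell_walks :: "('a::euclidean_space \<Rightarrow> int) \<Rightarrow> nat \<Rightarrow> ('a \<Rightarrow> int) list set" where
  "cell_walks c 0 = {[]}"
| "cell_walks c (Suc n) = (\<Union>c'\<in>cell_nbrs c. (#) c' ` cell_walks c' n)"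

lemma cell_walks_finite: "finite (cell_walks c n)"
  by (induction n arbitrary: c) (auto simp: finite_cell_nbrs)

lemma cell_walks_card: "card (cell_walks (c :: 'a::euclidean_space \<Rightarrow> int) n) \<le> (3 ^ DIM('a)) ^ n"
proof (induction n arbitrary: c)
  case (Suc n)
  have "card (cell_walks c (Suc n)) \<le> (\<Sum>c'\<in>cell_nbrs c. card ((#) c' ` cell_walks c' n))"
    by (simp add: card_UN_le finite_cell_nbrs)
  also have "\<dots> \<le> (\<Sum>c'\<in>cell_nbrs c. (3 ^ DIM('a)) ^ n)"
    using Suc by (intro sum_mono order_trans[OF card_image_le[OF cell_walks_finite]]) auto
  finally show ?case by (simp add: card_cell_nbrs)
qed simp

lemma cell_walks_length: "l \<in> cell_walks c n \<Longrightarrow> length l = n"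
  by (induction n arbitrary: c l) auto

lemma cell_walks_set: "l \<in> cell_walks c n \<Longrightarrow> set l \<subseteq> Basis \<rightarrow>\<^sub>E UNIV"
proof (induction n arbitrary: c l)
  case (Suc n)
  then obtain c' l' where l: "l = c' # l'" "c' \<in> cell_nbrs c" "l' \<in> cell_walks c' n" by auto
  have "c' \<in> Basis \<rightarrow>\<^sub>E UNIV" using l(2) unfolding cell_nbrs_def by (auto simp: PiE_def)
  then show ?case using Suc.IH[OF l(3)] l(1) by simp
qed simp

lemma cell_walks_take: "l \<in> cell_walks c n \<Longrightarrow> m \<le> n \<Longrightarrow> take m l \<in> cell_walks c m"
proof (induction n arbitrary: c l m)
  case (Suc n)
  show ?case
  proof (cases m)
    case (Suc m')
    obtain c' l' where l: "l = c' # l'" "c' \<in> cell_nbrs c" "l' \<in> cell_walks c' n" using Suc.prems(1) by auto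
    have "take m' l' \<in> cell_walks c' m'" using Suc.IH[OF l(3)] Suc.prems(2) Suc by simp
    then show ?thesis using l Suc by auto
  qed simp
qed simp

lemma rtrancl_path_cell_walk:
  assumes "rtrancl_path (\<lambda>c c'. c' \<in> cell_nbrs c \<and> c' \<in> C) c l c'"
  shows "l \<in> cell_walks c (length l)" "set l \<subseteq> C" "c' = last (c # l)"
  using assms by (induction rule: rtrancl_path.induct) auto

text \<open>
  Only finitely many cells are the end of a walk with fewer than \<open>n\<close> steps. A reachable cell beyond
  them is reached by a walk without repetitions, which is long enough to be cut at length \<open>n\<close>.
\<close>

lemma long_distinct_cell_walk:
  assumes C: "infinite C" and reach: "\<And>c'. c' \<in> C \<Longrightarrow> (\<lambda>c c'. c' \<in> cell_nbrs c \<and> c' \<in> C)\<^sup>*\<^sup>* c c'"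
  obtains l where "l \<in> cell_walks c n" "distinct l" "set l \<subseteq> C"
proof -
  have "finite (\<Union>m<n. (\<lambda>l. last (c # l)) ` cell_walks c m)"
    using cell_walks_finite by auto
  \<comment> \<open>a cell that no walk with fewer than \<open>n\<close> steps reaches\<close>
  then obtain c' where c': "c' \<in> C" "c' \<notin> (\<Union>m<n. (\<lambda>l. last (c # l)) ` cell_walks c m)"
    using C by (meson finite_subset subsetI)
  obtain xs where "rtrancl_path (\<lambda>c c'. c' \<in> cell_nbrs c \<and> c' \<in> C) c xs c'"
    using reach[OF c'(1)] by (auto simp: rtranclp_eq_rtrancl_path)
  then obtain l where l: "rtrancl_path (\<lambda>c c'. c' \<in> cell_nbrs c \<and> c' \<in> C) c l c'" "distinct (c # l)"
    by (rule rtrancl_path_distinct)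
  note w = rtrancl_path_cell_walk[OF l(1)]
  have "\<not> length l < n" using c'(2) w(1,3) by blast
  then have "take n l \<in> cell_walks c n" using cell_walks_take[OF w(1)] by simp
  moreover have "set (take n l) \<subseteq> C" using w(2) set_take_subset[of n l] by blast
  ultimately show ?thesis using that l(2) by auto
qed

text \<open>
  The points of the chain are distinct and each cell contains finitely many points of the slab, so
  the chain visits infinitely many cells. Successive points lie in neighbouring cells.
\<close>

lemma chain_long_walk:
  fixes p :: "nat \<Rightarrow> 'a::euclidean_space \<times> real"
  assumes S: "S \<in> configs" and pS: "\<And>k. p k \<in> S" and mono: "\<And>k. snd (p k) < snd (p (Suc k))"
    and step: "\<And>k. dist (fst (p k)) (fst (p (Suc k))) \<le> 1" and slab: "\<And>k. snd (p k) \<in> {a<..b}"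
  obtains l where "l \<in> cell_walks (cell_index (fst (p 0))) n" "distinct l"
    "\<And>c. c \<in> set l \<Longrightarrow> S \<inter> cell c \<times> {a<..b} \<noteq> {}"
proof -
  define C where "C = range (\<lambda>k. cell_index (fst (p k)))"
  have inj: "inj p"
  proof -
    have "strict_mono (\<lambda>k. snd (p k))" unfolding strict_mono_Suc_iff using mono by simp
    then have "inj (\<lambda>k. snd (p k))" by (rule strict_mono_imp_inj_on)
    then show ?thesis unfolding inj_on_def by metis
  qed
  have inf: "infinite C"
  proof
    assume fC: "finite C"
    have "finite (S \<inter> (\<Union>c\<in>C. cell c) \<times> {a<..b})"
      by (rule finite_configs_Int[OF S bounded_slab]) (use fC cell_bounded in auto)
    moreover have "range p \<subseteq> S \<inter> (\<Union>c\<in>C. cell c) \<times> {a<..b}"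
    proof
      fix x assume "x \<in> range p"
      then obtain k where k: "x = p k" by blast
      have "fst (p k) \<in> (\<Union>c\<in>C. cell c)" unfolding C_def using in_cell_index[of "fst (p k)"] by blast
      then show "x \<in> S \<inter> (\<Union>c\<in>C. cell c) \<times> {a<..b}"
        unfolding k using pS[of k] slab[of k] by (simp add: mem_Times_iff)
    qed
    ultimately have "finite (range p)" by (rule finite_subset[rotated])
    then show False using finite_imageD[OF _ inj] infinite_UNIV_nat by blast
  qed
  have step_C: "(\<lambda>c c'. c' \<in> cell_nbrs c \<and> c' \<in> C)\<^sup>*\<^sup>* (cell_index (fst (p 0))) (cell_index (fst (p k)))" for k
  proof (induction k)
    case (Suc k)
    have "cell_index (fst (p (Suc k))) \<in> cell_nbrs (cell_index (fst (p k))) \<and> cell_index (fst (p (Suc k))) \<in> C"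
      using cell_index_nbr[OF step[of k]] by (simp add: C_def)
    from rtranclp.rtrancl_into_rtrancl[where r="\<lambda>c c'. c' \<in> cell_nbrs c \<and> c' \<in> C", OF Suc this] show ?case .
  qed simp
  have reach: "(\<lambda>c c'. c' \<in> cell_nbrs c \<and> c' \<in> C)\<^sup>*\<^sup>* (cell_index (fst (p 0))) c'" if "c' \<in> C" for c'
  proof -
    from that obtain k where k: "c' = cell_index (fst (p k))" unfolding C_def image_iff by (elim bexE)
    show ?thesis unfolding k by (rule step_C)
  qed
  obtain l where l: "l \<in> cell_walks (cell_index (fst (p 0))) n" "distinct l" "set l \<subseteq> C"
    by (rule long_distinct_cell_walk[OF inf reach])
  show ?thesis
  proof (rule that[OF l(1,2)])
    fix c assume "c \<in> set l"
    then have "c \<in> C" by (rule subsetD[OF l(3)])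
    then obtain k where "c = cell_index (fst (p k))" unfolding C_def image_iff by (elim bexE)
    then have "p k \<in> S \<inter> cell c \<times> {a<..b}" using pS[of k] slab[of k] by (simp add: mem_Times_iff)
    then show "S \<inter> cell c \<times> {a<..b} \<noteq> {}" unfolding ex_in_conv[symmetric] by (rule exI)
  qed
qed

text \<open>
  The times increase to a limit; from some index on they lie in the slab that contains this limit.
\<close>

lemma explosive_slab:
  assumes S: "explosive S" and h: "0 < h"
  obtains p :: "nat \<Rightarrow> 'a::euclidean_space \<times> real" and z :: int where "\<And>k. p k \<in> S" "\<And>k. snd (p k) < snd (p (Suc k))"
    "\<And>k. dist (fst (p k)) (fst (p (Suc k))) \<le> 1" "\<And>k. snd (p k) \<in> {of_int z * h<..of_int z * h + h}"
proof -
  obtain p T where p: "\<And>n::nat. p n \<in> S" "\<And>n. snd (p n) < snd (p (Suc n))"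
     "\<And>n. dist (fst (p n)) (fst (p (Suc n))) \<le> 1" "\<And>n. snd (p n) \<le> T"
    using S unfolding explosive_def by blast
  let ?s = "\<lambda>n. snd (p n)"
  have sm: "strict_mono ?s" unfolding strict_mono_Suc_iff using p(2) by simp
  have bdd: "bdd_above (range ?s)" using p(4) by (intro bdd_aboveI[of _ T]) auto
  define t where "t = Sup (range ?s)"
  have le: "?s n \<le> t" for n unfolding t_def by (rule cSup_upper[OF _ bdd]) simp
  \<comment> \<open>slabs are open on the left: this one contains its right end, hence also a limit that is not attained\<close>
  define z where "z = \<lceil>t / h\<rceil> - 1"
  have z: "of_int z * h < t" "t \<le> of_int z * h + h"
  proof -
    have "of_int z < t / h" "t / h \<le> of_int z + 1" unfolding z_def by linarith+
    then show "of_int z * h < t" "t \<le> of_int z * h + h" using h by (simp_all add: field_simps)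
  qed
  obtain N where N: "of_int z * h < ?s N"
    using less_cSup_iff[of "range ?s" "of_int z * h"] bdd z(1) unfolding t_def by auto
  show ?thesis
  proof (rule that[of "\<lambda>k. p (N + k)" z])
    show "snd (p (N + k)) \<in> {of_int z * h<..of_int z * h + h}" for k
      using N strict_mono_leD[OF sm, of N "N + k"] le[of "N + k"] z(2) by auto
  qed (use p in auto)
qed

context poisson_flow
begin

lemma prob_hit_le:
  assumes "C \<in> sets borel" "bounded C" "0 \<le> h"
  shows "\<P>(\<omega> in M. card (S \<omega> \<inter> C \<times> {r<..r + h}) \<noteq> 0) \<le> lam * (measure lborel C * h)"
proof -
  have b: "C \<times> {r<..r + h} \<in> sets borel" "bounded (C \<times> {r<..r + h})"
    using assms by (auto intro!: slab_borel bounded_slab)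
  note [measurable] = measurable_card_S[OF b]
  have "\<P>(\<omega> in M. card (S \<omega> \<inter> C \<times> {r<..r + h}) \<noteq> 0) = 1 - \<P>(\<omega> in M. card (S \<omega> \<inter> C \<times> {r<..r + h}) = 0)"
    by (rule prob_neg) measurable
  also have "\<dots> = 1 - exp (- (lam * (measure lborel C * h)))"
    unfolding prob_card[OF b] using assms by (simp add: measure_lborel_slab)
  also have "\<dots> \<le> lam * (measure lborel C * h)"
    using exp_ge_add_one_self[of "- (lam * (measure lborel C * h))"] by linarith
  finally show ?thesis .
qed

text \<open>
  The cells of a walk without repetitions are disjoint, so they are occupied independently, each with
  probability at most \<open>lam h\<close>.
\<close>

lemma prob_walk_occupied:
  fixes l :: "('a \<Rightarrow> int) list"
  assumes l: "distinct l" "set l \<subseteq> Basis \<rightarrow>\<^sub>E UNIV" and h: "0 \<le> h"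
  shows "{\<omega> \<in> space M. \<forall>c\<in>set l. card (S \<omega> \<inter> cell c \<times> {r<..r + h}) \<noteq> 0} \<in> events"
    and "\<P>(\<omega> in M. \<forall>c\<in>set l. card (S \<omega> \<inter> cell c \<times> {r<..r + h}) \<noteq> 0) \<le> (lam * h) ^ length l"
proof -
  let ?D = "\<lambda>i. cell (l ! i) \<times> {r<..r + h}" and ?n = "length l"
  have b: "cell c \<times> {r<..r + h} \<in> sets borel" "bounded (cell c \<times> {r<..r + h})" for c :: "'a \<Rightarrow> int"
    using cell_borel cell_bounded by (auto intro!: slab_borel bounded_slab)
  note [measurable] = measurable_card_S[OF b]
  show "{\<omega> \<in> space M. \<forall>c\<in>set l. card (S \<omega> \<inter> cell c \<times> {r<..r + h}) \<noteq> 0} \<in> events"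
    by measurable
  show "\<P>(\<omega> in M. \<forall>c\<in>set l. card (S \<omega> \<inter> cell c \<times> {r<..r + h}) \<noteq> 0) \<le> (lam * h) ^ length l"
  proof (cases "l = []")
    case False
    have ind: "indep_vars (\<lambda>_. count_space UNIV) (\<lambda>i \<omega>. card (S \<omega> \<inter> ?D i)) {..<?n}"
    proof (rule indep_counts)
      show "disjoint_family_on ?D {..<?n}"
        unfolding disjoint_family_on_def
      proof (intro ballI impI)
        fix i j assume "i \<in> {..<?n}" "j \<in> {..<?n}" "i \<noteq> j"
        then have "l ! i \<in> Basis \<rightarrow>\<^sub>E UNIV" "l ! j \<in> Basis \<rightarrow>\<^sub>E UNIV" "l ! i \<noteq> l ! j"
          using l by (auto simp: nth_eq_iff_index_eq dest: nth_mem)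
        from cell_disjoint[OF this] show "?D i \<inter> ?D j = {}" by blast
      qed
    qed (use b in auto)
    have "{\<omega> \<in> space M. \<forall>c\<in>set l. card (S \<omega> \<inter> cell c \<times> {r<..r + h}) \<noteq> 0}
      = (\<Inter>i\<in>{..<?n}. (\<lambda>\<omega>. card (S \<omega> \<inter> ?D i)) -` (- {0}) \<inter> space M)"
      using False by (intro set_eqI) (simp add: all_set_conv_all_nth, blast)
    also have "prob \<dots> = (\<Prod>i\<in>{..<?n}. prob ((\<lambda>\<omega>. card (S \<omega> \<inter> ?D i)) -` (- {0}) \<inter> space M))"
      by (rule indep_varsD_finite[OF ind]) (use False in auto)
    also have "\<dots> \<le> (\<Prod>i\<in>{..<?n}. lam * h)"
    proof (intro prod_mono conjI measure_nonneg)
      fix i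
      have "(\<lambda>\<omega>. card (S \<omega> \<inter> ?D i)) -` (- {0}) \<inter> space M = {\<omega> \<in> space M. card (S \<omega> \<inter> ?D i) \<noteq> 0}" by auto
      moreover have "\<P>(\<omega> in M. card (S \<omega> \<inter> ?D i) \<noteq> 0) \<le> lam * (measure lborel (cell (l ! i)) * h)"
        by (rule prob_hit_le[OF cell_borel cell_bounded h])
      moreover have "lam * (measure lborel (cell (l ! i)) * h) \<le> lam * (1 * h)"
        using lam_pos h cell_volume by (intro mult_left_mono mult_right_mono) auto
      ultimately show "prob ((\<lambda>\<omega>. card (S \<omega> \<inter> ?D i)) -` (- {0}) \<inter> space M) \<le> lam * h" by simp
    qed
    finally show ?thesis by simp
  qed (simp add: prob_space)
qed

text \<open>
  A first-moment argument. There are at most \<open>K ^ n\<close> walks of \<open>n\<close> steps from a given cell, with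
  \<open>K = 3 ^ d\<close>, and a walk without repetitions is occupied in a slab of height \<open>h\<close> with probability at
  most \<open>(lam h) ^ n\<close>. If \<open>K lam h = 1/2\<close> the expected number of occupied walks tends to 0, while an
  explosion in the slab would produce occupied walks of every length.
\<close>

lemma AE_not_explosive: "AE \<omega> in M. \<not> explosive (S \<omega>)"
proof -
  let ?K = "3 ^ DIM('a) :: real"
  \<comment> \<open>the height for which \<open>K lam h = 1/2\<close>\<close>
  define h where "h = 1 / (2 * ?K * lam)"
  have h: "0 < h" "?K * (lam * h) = 1 / 2" unfolding h_def using lam_pos by auto
  define E where "E z c n = {\<omega> \<in> space M. \<exists>l\<in>{l \<in> cell_walks c n. distinct l}.
     \<forall>c\<in>set l. card (S \<omega> \<inter> cell c \<times> {of_int z * h<..of_int z * h + h}) \<noteq> 0}" for z :: int and c :: "'a \<Rightarrow> int" and n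
  have E_UN: "E z c n = (\<Union>l\<in>{l \<in> cell_walks c n. distinct l}.
     {\<omega> \<in> space M. \<forall>c\<in>set l. card (S \<omega> \<inter> cell c \<times> {of_int z * h<..of_int z * h + h}) \<noteq> 0})" for z c n
    unfolding E_def by auto
  have fin: "finite {l \<in> cell_walks c n. distinct l}" for c :: "'a \<Rightarrow> int" and n
    using cell_walks_finite[of c n] by simp
  have ev: "{\<omega> \<in> space M. \<forall>c\<in>set l. card (S \<omega> \<inter> cell c \<times> {of_int z * h<..of_int z * h + h}) \<noteq> 0} \<in> events"
    "\<P>(\<omega> in M. \<forall>c\<in>set l. card (S \<omega> \<inter> cell c \<times> {of_int z * h<..of_int z * h + h}) \<noteq> 0) \<le> (lam * h) ^ n"
    if "l \<in> {l \<in> cell_walks c n. distinct l}" for l z n and c :: "'a \<Rightarrow> int"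
  proof -
    have l: "distinct l" "set l \<subseteq> Basis \<rightarrow>\<^sub>E UNIV" "length l = n"
      using that cell_walks_set[of l c n] cell_walks_length[of l c n] by simp_all
    show "{\<omega> \<in> space M. \<forall>c\<in>set l. card (S \<omega> \<inter> cell c \<times> {of_int z * h<..of_int z * h + h}) \<noteq> 0} \<in> events"
      by (rule prob_walk_occupied(1)[OF l(1,2) less_imp_le[OF h(1)]])
    show "\<P>(\<omega> in M. \<forall>c\<in>set l. card (S \<omega> \<inter> cell c \<times> {of_int z * h<..of_int z * h + h}) \<noteq> 0) \<le> (lam * h) ^ n"
      using prob_walk_occupied(2)[OF l(1,2) less_imp_le[OF h(1)]] unfolding l(3) .
  qed
  have E_ev: "E z c n \<in> events" for z c n
    unfolding E_UN using fin ev(1) by (intro sets.finite_UN) auto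
  have E_le: "prob (E z c n) \<le> (1 / 2) ^ n" for z c n
  proof -
    have "prob (E z c n) \<le> (\<Sum>l\<in>{l \<in> cell_walks c n. distinct l}.
       \<P>(\<omega> in M. \<forall>c\<in>set l. card (S \<omega> \<inter> cell c \<times> {of_int z * h<..of_int z * h + h}) \<noteq> 0))"
      unfolding E_UN by (rule finite_measure_subadditive_finite[OF fin]) (use ev(1) in auto)
    also have "\<dots> \<le> (\<Sum>l\<in>{l \<in> cell_walks c n. distinct l}. (lam * h) ^ n)"
      by (intro sum_mono ev(2))
    also have "\<dots> = real (card {l \<in> cell_walks c n. distinct l}) * (lam * h) ^ n" by simp
    also have "\<dots> \<le> ?K ^ n * (lam * h) ^ n"
    proof (rule mult_right_mono)
      have "card {l \<in> cell_walks c n. distinct l} \<le> card (cell_walks c n)"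
        by (rule card_mono[OF cell_walks_finite]) auto
      also have "\<dots> \<le> (3 ^ DIM('a)) ^ n" by (rule cell_walks_card)
      finally show "real (card {l \<in> cell_walks c n. distinct l}) \<le> ?K ^ n"
        by (metis of_nat_le_iff of_nat_numeral of_nat_power)
    qed (use lam_pos h(1) in simp)
    also have "\<dots> = (1 / 2) ^ n" by (simp only: power_mult_distrib[symmetric] h(2))
    finally show ?thesis .
  qed
  have "AE \<omega> in M. \<exists>n. \<omega> \<notin> E z c n" for z c
  proof (rule AE_escape[OF E_ev])
    show "(\<lambda>n. prob (E z c n)) \<longlonglongrightarrow> 0"
      by (rule tendsto_sandwich[OF _ _ tendsto_const LIMSEQ_realpow_zero[of "1/2"]])
        (simp_all add: E_le)
  qed
  moreover have "countable (Basis \<rightarrow>\<^sub>E UNIV :: ('a \<Rightarrow> int) set)" by (intro countable_PiE) auto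
  ultimately have "AE \<omega> in M. \<forall>z. \<forall>c\<in>Basis \<rightarrow>\<^sub>E UNIV. \<exists>n. \<omega> \<notin> E z c n"
    by (simp add: AE_all_countable AE_ball_countable)
  with AE_space show ?thesis
  proof eventually_elim
    case (elim \<omega>)
    show ?case
    proof
      assume ex: "explosive (S \<omega>)"
      obtain p z where p: "\<And>k. p k \<in> S \<omega>" "\<And>k. snd (p k) < snd (p (Suc k))"
        "\<And>k. dist (fst (p k)) (fst (p (Suc k))) \<le> 1" "\<And>k. snd (p k) \<in> {of_int z * h<..of_int z * h + h}"
      proof (rule explosive_slab[OF ex h(1)], goal_cases)
        case (1 p z)
        from 1(2-) show thesis by (rule 1(1))
      qed
      have "cell_index (fst (p 0)) \<in> Basis \<rightarrow>\<^sub>E UNIV" by (simp add: cell_index_def)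
      then obtain n where n: "\<omega> \<notin> E z (cell_index (fst (p 0))) n" using elim(2) by blast
      obtain l where l: "l \<in> cell_walks (cell_index (fst (p 0))) n" "distinct l"
        "\<And>c. c \<in> set l \<Longrightarrow> S \<omega> \<inter> cell c \<times> {of_int z * h<..of_int z * h + h} \<noteq> {}"
      proof (rule chain_long_walk[where p=p and n=n, OF S_configs[OF elim(1)] p], goal_cases)
        case (1 l)
        from 1(2-) show thesis by (rule 1(1))
      qed
      have "finite (S \<omega> \<inter> cell c \<times> {of_int z * h<..of_int z * h + h})" for c
        by (rule finite_configs_Int[OF S_configs[OF elim(1)] bounded_slab[OF cell_bounded]])
      then have occ: "\<forall>c\<in>set l. card (S \<omega> \<inter> cell c \<times> {of_int z * h<..of_int z * h + h}) \<noteq> 0"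
        using l(3) card_0_eq by metis
      have "\<omega> \<in> E z (cell_index (fst (p 0))) n"
        unfolding E_def by (intro CollectI conjI elim(1) bexI[of _ l] occ l(1,2))
      with n show False by simp
    qed
  qed
qed

text \<open>
  Cut a bounded time interval into \<open>m\<close> slabs. Two points at the same time lie in one slab, and by
  \<open>prob_two_points_le\<close> the probability of such a slab is at most a constant times \<open>m / m\<^sup>2\<close>.
\<close>

lemma AE_distinct_times: "AE \<omega> in M. inj_on snd (S \<omega>)"
proof -
  define I where "I R m k = {- real R + real k * (2 * real R / real (Suc m))<..- real R + real k * (2 * real R / real (Suc m)) + 2 * real R / real (Suc m)}" for R m k :: nat
  define E where "E R m = (\<Union>k<Suc m. {\<omega> \<in> space M. 2 \<le> card (S \<omega> \<inter> cball 0 (real R) \<times> I R m k)})" for R m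
  define V where "V R = lam * (measure lborel (cball (0::'a) (real R)) * (2 * real R))" for R
  have [measurable]: "(\<lambda>\<omega>. card (S \<omega> \<inter> cball 0 (real R) \<times> I R m k)) \<in> M \<rightarrow>\<^sub>M count_space UNIV" for R m k
    unfolding I_def by (rule measurable_card_S) (auto intro!: slab_borel bounded_slab)
  have E_ev [measurable]: "E R m \<in> events" for R m unfolding E_def by measurable
  have "prob (E R m) \<le> (V R)\<^sup>2 * (1 / real (Suc m))" for R m
  proof -
    have "prob (E R m) \<le> (\<Sum>k<Suc m. \<P>(\<omega> in M. 2 \<le> card (S \<omega> \<inter> cball 0 (real R) \<times> I R m k)))"
      unfolding E_def by (rule finite_measure_subadditive_finite) auto
    also have "\<dots> \<le> (\<Sum>k<Suc m. (lam * (measure lborel (cball (0::'a) (real R)) * (2 * real R / real (Suc m))))\<^sup>2)"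
      unfolding I_def by (intro sum_mono prob_two_points_le) auto
    also have "\<dots> = (V R)\<^sup>2 * (1 / real (Suc m))"
      unfolding V_def by (simp add: power2_eq_square field_simps del: of_nat_Suc)
    finally show ?thesis .
  qed
  then have "AE \<omega> in M. \<exists>m. \<omega> \<notin> E R m" for R
  proof (intro AE_escape[OF E_ev])
    assume le: "\<And>R m. prob (E R m) \<le> (V R)\<^sup>2 * (1 / real (Suc m))"
    have "(\<lambda>m. (V R)\<^sup>2 * (1 / real (Suc m))) \<longlonglongrightarrow> (V R)\<^sup>2 * 0"
      by (intro tendsto_mult_left LIMSEQ_Suc[OF lim_1_over_n])
    then have lim: "(\<lambda>m. (V R)\<^sup>2 * (1 / real (Suc m))) \<longlonglongrightarrow> 0"
      by (simp only: mult_zero_right)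
    show "(\<lambda>m. prob (E R m)) \<longlonglongrightarrow> 0"
      by (rule tendsto_sandwich[OF _ _ tendsto_const lim]) (intro always_eventually allI measure_nonneg le)+
  qed
  then have "AE \<omega> in M. \<forall>R. \<exists>m. \<omega> \<notin> E R m" by (simp add: AE_all_countable)
  with AE_space show ?thesis
  proof eventually_elim
    case (elim \<omega>)
    show ?case
    proof (rule inj_onI, rule ccontr)
      fix p q assume pq: "p \<in> S \<omega>" "q \<in> S \<omega>" "snd p = snd q" "p \<noteq> q"
      obtain R :: nat where R: "max (max (norm (fst p)) (norm (fst q))) (\<bar>snd p\<bar> + 1) \<le> real R"
        using real_arch_simple by blast
      obtain m where m: "\<omega> \<notin> E R m" using elim(2) by blast
      let ?w = "2 * real R / real (Suc m)"
      have R0: "0 < real R" using R by linarith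
      have w: "0 < ?w" using R0 by simp
      \<comment> \<open>the slabs are open on the left, so the index is the ceiling minus one, not the floor\<close>
      define z where "z = \<lceil>(snd p + real R) / ?w\<rceil> - 1"
      have z: "of_int z < (snd p + real R) / ?w" "(snd p + real R) / ?w \<le> of_int z + 1"
        unfolding z_def by linarith+
      have pos: "0 < (snd p + real R) / ?w" using R w by (intro divide_pos_pos) auto
      have ub: "(snd p + real R) / ?w \<le> real (Suc m)"
      proof -
        have "(snd p + real R) / ?w \<le> (2 * real R) / ?w" using R w by (intro divide_right_mono) auto
        also have "\<dots> = real (Suc m)" using R0 by simp
        finally show ?thesis .
      qed
      have z0: "0 \<le> z" "z < int (Suc m)" using z pos ub by linarith+
      define k where "k = nat z"
      have k: "real k = of_int z" "k < Suc m" using z0 by (auto simp: k_def)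
      have "snd p \<in> I R m k"
        unfolding I_def k(1) using z w by (simp add: field_simps del: of_nat_Suc)
      then have sub: "{p, q} \<subseteq> S \<omega> \<inter> cball 0 (real R) \<times> I R m k"
        using pq R by (auto simp: mem_Times_iff)
      have "finite (S \<omega> \<inter> cball 0 (real R) \<times> I R m k)"
        unfolding I_def by (rule finite_configs_Int[OF S_configs[OF elim(1)] bounded_slab]) simp
      from card_mono[OF this sub] have "2 \<le> card (S \<omega> \<inter> cball 0 (real R) \<times> I R m k)" using pq(4) by simp
      then have "\<omega> \<in> E R m" unfolding E_def using k(2) elim(1) by blast
      with m show False by simp
    qed
  qed
qed

lemma AE_regular_points: "AE \<omega> in M. regular_points (S \<omega>)"
  using AE_space AE_distinct_times AE_recurrent_future AE_not_explosive
  by eventually_elim (simp add: regular_points_def S_configs)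

lemma AE_no_point_at_time: "AE \<omega> in M. \<forall>x. (x, t) \<notin> S \<omega>"
proof -
  have b: "cball 0 (real R) \<times> {t} \<in> sets (borel :: ('a \<times> real) measure)" "bounded (cball (0::'a) (real R) \<times> {t})" for R :: nat
    by (auto intro!: borel_Times bounded_Times)
  have v: "measure lborel (cball (0::'a) (real R) \<times> {t}) = 0" for R :: nat
  proof -
    have "emeasure (lborel :: ('a \<times> real) measure) (cball 0 (real R) \<times> {t}) = emeasure (lborel \<Otimes>\<^sub>M lborel) (cball (0::'a) (real R) \<times> {t})"
      by (simp add: lborel_prod)
    also have "\<dots> = emeasure lborel (cball (0::'a) (real R)) * emeasure lborel {t}"
      by (rule lborel.emeasure_pair_measure_Times) auto
    finally show ?thesis by (simp add: measure_def)
  qed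
  have "\<P>(\<omega> in M. card (S \<omega> \<inter> cball 0 (real R) \<times> {t}) = 0) = 1" for R :: nat
    unfolding prob_card[OF b] v by simp
  then have "AE \<omega> in M. card (S \<omega> \<inter> cball 0 (real R) \<times> {t}) = 0" for R :: nat
    using measurable_card_S[OF b[of R]] by (subst prob_Collect_eq_1[symmetric]) auto
  then have "AE \<omega> in M. \<forall>R::nat. card (S \<omega> \<inter> cball 0 (real R) \<times> {t}) = 0"
    by (simp add: AE_all_countable)
  with AE_space show ?thesis
  proof eventually_elim
    case (elim \<omega>)
    show ?case
    proof (intro allI notI)
      fix x assume x: "(x, t) \<in> S \<omega>"
      obtain R :: nat where R: "norm x \<le> real R" using real_arch_simple by blast
      have "finite (S \<omega> \<inter> cball 0 (real R) \<times> {t})" by (rule finite_configs_Int[OF S_configs[OF elim(1)] b(2)])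
      moreover have "card (S \<omega> \<inter> cball 0 (real R) \<times> {t}) = 0" using elim(2) ..
      ultimately have "S \<omega> \<inter> cball 0 (real R) \<times> {t} = {}" using card_0_eq by blast
      then show False using x R by auto
    qed
  qed
qed

end

section \<open>Generator, stationarity and uniqueness\<close>

theorem proposition4p1:
  fixes M :: "'w measure"
    and S :: "'w \<Rightarrow> ((real ^ 'n) \<times> real) set"
    and lam :: real
  assumes "prob_space M"
    and "lam > 0"
    and "poisson_process M lam S"
  shows "(\<forall>\<eta>\<in>configs. \<forall>t'. \<exists>Y.
            (AE \<omega> in M. \<forall>t\<ge>t'. Y t \<omega> = eta_from (S \<omega>) \<eta> t' t) \<and>
            (AE \<omega> in M. Y t' \<omega> = \<eta>) \<and>
            markov_with_generator M {t'..} (gen lam) Y)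
       \<and> (\<exists>Y.
            (AE \<omega> in M. \<forall>t. Y t \<omega> = eta (S \<omega>) t) \<and>
            markov_with_generator M UNIV (gen lam) Y \<and>
            stationary M Y \<and>
            (\<forall>(N :: 'v measure) Z.
               prob_space N \<and> markov_with_generator N UNIV (gen lam) Z \<and> stationary N Z \<longrightarrow>
               process_law N Z = process_law M Y) \<and>
            (\<forall>t. invariant_measure (gen lam) (distr M config_space (Y t)) \<and>
                 (\<forall>\<mu>. invariant_measure (gen lam) \<mu> \<longrightarrow>
                      \<mu> = distr M config_space (Y t))))"
proof -
  interpret poisson_flow M S lam
    using assms by (simp add: poisson_flow_def poisson_def poisson_axioms_def)
  have generator: "markov_with_generator M T (gen lam) Y"
    if "markov_process M T config_space semigroup Y" for T Y
    unfolding markov_with_generator_def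
    using that semigroup_transition semigroup_generator by blast
  show ?thesis
  proof (intro conjI ballI allI)
    fix \<eta> :: "(real ^ 'n) set" and t' :: real assume \<eta>: "\<eta> \<in> configs"
    show "\<exists>Y. (AE \<omega> in M. \<forall>t\<ge>t'. Y t \<omega> = eta_from (S \<omega>) \<eta> t' t) \<and>
            (AE \<omega> in M. Y t' \<omega> = \<eta>) \<and> markov_with_generator M {t'..} (gen lam) Y"
    proof (intro exI[of _ "\<lambda>t \<omega>. flow (S \<omega>) t' t \<eta>"] conjI)
      show "AE \<omega> in M. \<forall>t\<ge>t'. flow (S \<omega>) t' t \<eta> = eta_from (S \<omega>) \<eta> t' t"
        using AE_regular_points AE_no_point_at_time[of t']
        by eventually_elim (simp add: eta_from_eq_flow)
    qed (simp_all add: generator[OF markov_flow_from[OF \<eta>]])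
  next
    show "\<exists>Y. (AE \<omega> in M. \<forall>t. Y t \<omega> = eta (S \<omega>) t) \<and>
            markov_with_generator M UNIV (gen lam) Y \<and>
            stationary M Y \<and>
            (\<forall>(N :: 'v measure) Z.
               prob_space N \<and> markov_with_generator N UNIV (gen lam) Z \<and> stationary N Z \<longrightarrow>
               process_law N Z = process_law M Y) \<and>
            (\<forall>t. invariant_measure (gen lam) (distr M config_space (Y t)) \<and>
                 (\<forall>\<mu>. invariant_measure (gen lam) \<mu> \<longrightarrow>
                      \<mu> = distr M config_space (Y t)))"
    proof (intro exI[of _ "\<lambda>t \<omega>. stat (S \<omega>) t"] conjI allI impI)
      show "AE \<omega> in M. \<forall>t. stat (S \<omega>) t = eta (S \<omega>) t"
        using AE_regular_points AE_recurrent_past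
        by eventually_elim (simp add: eta_eq_alive stat_def)
      show "process_law N Z = process_law M (\<lambda>t \<omega>. stat (S \<omega>) t)"
        if "prob_space N \<and> markov_with_generator N UNIV (gen lam) Z \<and> stationary N Z" for N :: "'v measure" and Z
        using that stationary_law_unique by blast
    qed (use generator[OF markov_stat] stationary_stat invariant_stat_law invariant_measure_unique in auto)
  qed
qed

end
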